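(* Let $n \in \mathbb{N}$ and let $S = \{g_1, \dots, g_s\} \subseteq \mathbb{Q}[X] = \mathbb{Q}[X_1, \dots, X_n]$ be a finite set of polynomials. Suppose that $K_S = \{x \in \mathbb{R}^n \mid g_1(x) \geq 0, \dots, g_s(x) \geq 0\}$ is compact. Then for any $f \in \mathbb{Q}[X]$ such that $f > 0$ on $K_S$ (that is, $f(x) > 0$ for all $x \in K_S$), there is a representation $$f = \sum_{e = (e_1, \dots, e_s) \in \{0,1\}^s} \sigma_e \, g_1^{e_1} \cdots g_s^{e_s}$$ with $\sigma_e \in \sum \mathbb{Q}[X]^2$ for all $e \in \{0,1\}^s$.
   Context: $\sum \mathbb{Q}[X]^2$ denotes the set of finite sums of squares of polynomials in $\mathbb{Q}[X] = \mathbb{Q}[X_1, \dots, X_n]$. *)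

theory Defs
  imports "HOL-Analysis.Analysis" "HOL-Library.Poly_Mapping"
begin

text \<open>
  A monomial is a finitely supported map from variable indices to exponents, and a polynomial is a
  finitely supported map from monomials to coefficients; the ring operations are those of
  the library (multiplication is convolution). Polynomials in \<open>n\<close> variables are the ones
  that only involve the variables with indices \<open>0, \<dots>, n - 1\<close>.
\<close>

type_synonym rat_mpoly = "(nat \<Rightarrow>\<^sub>0 nat) \<Rightarrow>\<^sub>0 rat"

definition polys :: "nat \<Rightarrow> rat_mpoly set" where
  "polys n = {p. \<forall>m \<in> Poly_Mapping.keys p. Poly_Mapping.keys m \<subseteq> {..<n}}"

definition eval_mpoly :: "rat_mpoly \<Rightarrow> (nat \<Rightarrow> real) \<Rightarrow> real" where
  "eval_mpoly p x =
     (\<Sum>m \<in> Poly_Mapping.keys p. of_rat (Poly_Mapping.lookup p m) *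
        (\<Prod>i \<in> Poly_Mapping.keys m. x i ^ Poly_Mapping.lookup m i))"

definition sums_of_squares :: "nat \<Rightarrow> rat_mpoly set" where
  "sums_of_squares n = {\<Sum>p\<leftarrow>ps. p ^ 2 | ps. set ps \<subseteq> polys n}"

text \<open>
  Real \<open>n\<close>-space is the library's \<^term>\<open>Euclidean_space n\<close>: the real sequences vanishing at all
  indices \<open>i \<ge> n\<close>.
\<close>

definition basic_closed_set :: "nat \<Rightarrow> rat_mpoly set \<Rightarrow> (nat \<Rightarrow> real) set" where
  "basic_closed_set n S = {x \<in> topspace (Euclidean_space n). \<forall>g \<in> S. eval_mpoly g x \<ge> 0}"

end

theory Submission
  imports Defs "HOL-Algebra.Algebraic_Closure_Type"
begin

text \<open>
  Let \<open>T\<close> be the preordering generated by the \<open>g i\<close>, that is, the least set of polynomials that contains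
  them and all squares and is closed under sums and products. Since \<open>g i ^ 2\<close> is a square, the elements of
  \<open>T\<close> are precisely the sums that the theorem asks for, so the claim is \<open>f \<in> T\<close>. There are three ideas.

  (1) Positivstellensatz (\<open>positivstellensatz\<close>). If \<open>f > 0\<close> on the set \<open>K\<close> where all \<open>g i\<close> are nonnegative,
  then \<open>f * p = 1 + q\<close> for some \<open>p, q \<in> T\<close>. Otherwise \<open>T - f T\<close> is a preordering without \<open>-1\<close>, and by Zorn's
  lemma it extends to a prime cone \<open>P\<close> (\<open>exists_prime_cone\<close>). Modulo the ideal \<open>P \<inter> -P\<close> the polynomials
  form an ordered domain, whose field of fractions has a real closed extension \<open>R\<close>. The residue classes of the
  variables are a point with coordinates in \<open>R\<close> where all \<open>g i\<close> are nonnegative and \<open>f\<close> is not positive. A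
  Tarski transfer (\<open>mpoly_sign_transfer\<close>) replaces it by a point with real coordinates, where finitely many
  polynomials have the same signs; this contradicts \<open>f > 0\<close> on \<open>K\<close>. The transfer goes variable by variable:
  whether a sign pattern of finitely many polynomials in one variable over a real closed field is realized
  depends only on the signs of finitely many polynomial expressions in their coefficients
  (\<open>univariate_sign_transfer\<close>, the method of Cohen and Hoermander).

  (2) Woermann's argument (\<open>archimedean_if_compact\<close>). As \<open>K\<close> is compact, \<open>N - (\<Sum>i<n. X i ^ 2)\<close> is positive on
  \<open>K\<close> for some number \<open>N\<close>. Applying (1) to it and eliminating the denominator shows that \<open>T\<close> itself contains
  such a polynomial, with a larger \<open>N\<close>. This makes \<open>T\<close> archimedean: for every polynomial \<open>p\<close> it contains
  \<open>M - p\<close> for some number \<open>M\<close>.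

  (3) In an archimedean \<open>T\<close> the denominator in (1) can be removed as well (\<open>archimedean_representation\<close>): if
  \<open>f * t = 1 + q\<close> and \<open>k - t \<in> T\<close>, then \<open>f + r \<in> T\<close> implies \<open>f + r - 1 / k \<in> T\<close> for \<open>r \<ge> 0\<close>, and
  starting from a natural number \<open>r\<close> with \<open>f + r \<in> T\<close> one reaches \<open>f \<in> T\<close> in \<open>r * k\<close> steps.

  All this is done in the ring of polynomials in countably many variables, without a carrier for
  the polynomials in \<open>n\<close> variables. To this end the generators \<open>- (X i ^ 2)\<close> with \<open>i \<ge> n\<close> are
  added to the \<open>g i\<close>; they force \<open>X i = 0\<close>, and the substitution of \<open>0\<close> for these \<open>X i\<close> removes them again at the end.
\<close>


text \<open>
  The algebraic closure of a field brings in algebra over explicit carriers, whose names clash with those of the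
  type-based polynomials used below.
\<close>

hide_const (open) Polynomials.degree Polynomials.lead_coeff up_ring.coeff up_ring.monom
  Coset.order Divisibility.irreducible Divisibility.prime Module.smult Poly_Mapping.degree

section \<open>Preorderings and prime cones\<close>

definition ring_preordering :: "'a::comm_ring_1 set \<Rightarrow> bool" where
  "ring_preordering T \<longleftrightarrow> (\<forall>a. a^2 \<in> T) \<and> (\<forall>a\<in>T. \<forall>b\<in>T. a + b \<in> T \<and> a * b \<in> T)"

text \<open>
  A prime cone is the set of nonnegative elements of a total order on the residue ring modulo a prime ideal;
  the prime ideal consists of the elements \<open>a\<close> such that \<open>a\<close> and \<open>-a\<close> belong to the cone.
\<close>

definition prime_cone :: "'a::comm_ring_1 set \<Rightarrow> bool" where
  "prime_cone P \<longleftrightarrow> ring_preordering P \<and> -1 \<notin> P \<and> (\<forall>a. a \<in> P \<or> -a \<in> P) \<and>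
     (\<forall>a b. a * b \<in> P \<and> -(a * b) \<in> P \<longrightarrow> a \<in> P \<and> -a \<in> P \<or> b \<in> P \<and> -b \<in> P)"

lemma ring_preorderingD:
  assumes "ring_preordering T"
  shows ring_preordering_sq: "a^2 \<in> T"
    and ring_preordering_add: "a \<in> T \<Longrightarrow> b \<in> T \<Longrightarrow> a + b \<in> T"
    and ring_preordering_mult: "a \<in> T \<Longrightarrow> b \<in> T \<Longrightarrow> a * b \<in> T"
  using assms by (auto simp: ring_preordering_def)

lemma ring_preordering_0 [simp]: "ring_preordering T \<Longrightarrow> 0 \<in> T"
  using ring_preordering_sq[of T 0] by simp

lemma ring_preordering_1 [simp]: "ring_preordering T \<Longrightarrow> 1 \<in> T"
  using ring_preordering_sq[of T 1] by simp

lemma ring_preordering_adjoin: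
  assumes T: "ring_preordering T"
  shows "ring_preordering {t + x * u | t u. t \<in> T \<and> u \<in> T}" (is "ring_preordering ?A")
  unfolding ring_preordering_def
proof (intro conjI allI ballI)
  fix a show "a^2 \<in> ?A"
    using ring_preordering_sq[OF T, of a] ring_preordering_0[OF T] by force
next
  fix a b assume "a \<in> ?A" "b \<in> ?A"
  then obtain t u t' u' where *: "a = t + x * u" "b = t' + x * u'" "t \<in> T" "u \<in> T" "t' \<in> T" "u' \<in> T"
    by blast
  have "a + b = (t + t') + x * (u + u')" using * by (simp add: algebra_simps)
  then show "a + b \<in> ?A" using * ring_preordering_add[OF T] by blast
  have "a * b = (t * t' + x^2 * (u * u')) + x * (t * u' + u * t')"
    using * by (simp add: algebra_simps power2_eq_square)
  moreover have "t * t' + x^2 * (u * u') \<in> T" "t * u' + u * t' \<in> T"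
    using * by (auto intro!: ring_preordering_add[OF T] ring_preordering_mult[OF T] ring_preordering_sq[OF T])
  ultimately show "a * b \<in> ?A" by blast
qed

text \<open>
  A preordering that is maximal among those without \<open>-1\<close> is a prime cone. If \<open>x \<notin> P\<close>, then adjoining \<open>x\<close> to
  the maximal \<open>P\<close> produces \<open>-1\<close>, so \<open>-1 = t + x * u\<close> with \<open>t, u \<in> P\<close>. Two such equations, for \<open>a\<close> and \<open>-a\<close> or
  for two elements whose product lies in \<open>P \<inter> -P\<close>, multiply to an equation that puts \<open>-1\<close> into \<open>P\<close>.
\<close>

lemma exists_prime_cone:
  assumes T: "ring_preordering T" and proper: "-1 \<notin> T"
  obtains P where "prime_cone P" "T \<subseteq> P"
proof -
  define F where "F = {P. ring_preordering P \<and> -1 \<notin> P \<and> T \<subseteq> P}"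
  have "\<Union>C \<in> F" if "C \<noteq> {}" and C: "subset.chain F C" for C
  proof -
    have CF: "C \<subseteq> F" and tot: "\<And>Y Z. Y \<in> C \<Longrightarrow> Z \<in> C \<Longrightarrow> Y \<subseteq> Z \<or> Z \<subseteq> Y"
      using C by (auto simp: subset_chain_def)
    have "ring_preordering (\<Union>C)"
      unfolding ring_preordering_def
    proof (intro conjI allI ballI)
      fix a show "a^2 \<in> \<Union>C"
        using \<open>C \<noteq> {}\<close> CF ring_preordering_sq unfolding F_def by blast
    next
      fix a b assume "a \<in> \<Union>C" "b \<in> \<Union>C"
      then obtain Z where "Z \<in> C" "a \<in> Z" "b \<in> Z" using tot by (metis UnionE subsetD)
      then have "a + b \<in> Z" "a * b \<in> Z"
        using CF by (auto simp: F_def intro: ring_preordering_add ring_preordering_mult)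
      with \<open>Z \<in> C\<close> show "a + b \<in> \<Union>C" "a * b \<in> \<Union>C" by auto
    qed
    then show ?thesis using CF \<open>C \<noteq> {}\<close> by (auto simp: F_def)
  qed
  moreover have "F \<noteq> {}" using T proper by (auto simp: F_def)
  ultimately obtain P where "P \<in> F" and max: "\<And>Z. Z \<in> F \<Longrightarrow> P \<subseteq> Z \<Longrightarrow> Z = P"
    using subset_Zorn_nonempty[of F] by metis
  then have P: "ring_preordering P" and nP: "-1 \<notin> P" and TP: "T \<subseteq> P" by (auto simp: F_def)
  note add = ring_preordering_add[OF P] and mult = ring_preordering_mult[OF P] and sq = ring_preordering_sq[OF P]
  have adjoin: "\<exists>t\<in>P. \<exists>u\<in>P. -1 = t + x * u" if "x \<notin> P" for x
  proof (rule ccontr)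
    assume *: "\<not> ?thesis"
    let ?A = "{t + x * u | t u. t \<in> P \<and> u \<in> P}"
    have "P \<subseteq> ?A"
    proof
      fix p assume "p \<in> P"
      then show "p \<in> ?A" using P by (intro CollectI exI[of _ p] exI[of _ 0]) auto
    qed
    moreover have "?A \<in> F"
      using ring_preordering_adjoin[OF P] * TP \<open>P \<subseteq> ?A\<close> unfolding F_def by blast
    ultimately have "?A = P" using max by blast
    moreover have "x \<in> ?A" using P by (intro CollectI exI[of _ 0] exI[of _ 1]) auto
    ultimately show False using that by simp
  qed
  have isolate: "x * q = -(1 + p)" if "-1 = p + x * q" for p x q :: 'a
    using that by (metis add.commute add_diff_cancel_left' diff_conv_add_uminus minus_add_distrib)
  have total: "a \<in> P \<or> -a \<in> P" for a
  proof (rule ccontr)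
    assume "\<not> ?thesis"
    then obtain p q p' q' where *: "p \<in> P" "q \<in> P" "-1 = p + a * q" "p' \<in> P" "q' \<in> P" "-1 = p' + (-a) * q'"
      using adjoin[of a] adjoin[of "-a"] by blast
    then have "a * q = -(1 + p)" "a * q' = 1 + p'" using isolate[of p a q] isolate[of p' "-a" q']
      by (metis, metis minus_mult_left neg_equal_iff_equal)
    then have "(a * q) * (a * q') = -((1 + p) * (1 + p'))" by (simp only: minus_mult_left)
    then have "(1 + p) * (1 + p') = - (a^2 * (q * q'))" by (simp add: ac_simps power2_eq_square)
    moreover have "-1 = p + p' + p * p' - (1 + p) * (1 + p')" by (simp add: algebra_simps)
    ultimately have "-1 = p + p' + p * p' + a^2 * (q * q')" by simp
    moreover have "p + p' + p * p' + a^2 * (q * q') \<in> P" using * by (intro add mult sq)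
    ultimately show False using nP by simp
  qed
  have prime: "b \<in> P \<and> -b \<in> P" if ab: "a * b \<in> P" "-(a * b) \<in> P" and na: "\<not> (a \<in> P \<and> -a \<in> P)" for a b
  proof -
    have key: False if "a * b \<in> P" "-(a * b) \<in> P" "a \<notin> P" "b \<notin> P" for a b
    proof -
      obtain p q p' q' where *: "p \<in> P" "q \<in> P" "-1 = p + a * q" "p' \<in> P" "q' \<in> P" "-1 = p' + b * q'"
        using adjoin[of a] adjoin[of b] \<open>a \<notin> P\<close> \<open>b \<notin> P\<close> by blast
      then have "a * q = -(1 + p)" "b * q' = -(1 + p')"
        using isolate[of p a q] isolate[of p' b q'] by (metis, metis)
      then have "(a * q) * (b * q') = (1 + p) * (1 + p')" by (simp only: minus_mult_minus)
      then have "(1 + p) * (1 + p') = a * b * (q * q')" by (simp add: ac_simps)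
      moreover have "-1 = p + p' + p * p' - (1 + p) * (1 + p')" by (simp add: algebra_simps)
      ultimately have "-1 = p + p' + p * p' + (-(a * b)) * (q * q')" by simp
      moreover have "p + p' + p * p' + (-(a * b)) * (q * q') \<in> P" using * that by (intro add mult)
      ultimately show False using nP by simp
    qed
    from na consider "a \<notin> P" | "-a \<notin> P" by blast
    then show ?thesis
    proof cases
      case 1
      then show ?thesis using key[of a b] key[of a "-b"] ab by auto
    next
      case 2
      then show ?thesis using key[of "-a" b] key[of "-a" "-b"] ab by auto
    qed
  qed
  have "prime_cone P" unfolding prime_cone_def using P nP total prime by blast
  then show ?thesis using that TP by blast
qed

lemma prime_coneD:
  assumes "prime_cone P"
  shows prime_cone_preordering: "ring_preordering P" and prime_cone_m1: "-1 \<notin> P"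
    and prime_cone_total: "a \<in> P \<or> -a \<in> P"
    and prime_cone_prime: "a * b \<in> P \<Longrightarrow> -(a * b) \<in> P \<Longrightarrow> a \<in> P \<and> -a \<in> P \<or> b \<in> P \<and> -b \<in> P"
  using assms unfolding prime_cone_def by blast+

section \<open>Real closed fields\<close>

text \<open>
  Real closed fields are characterized by the intermediate value property of polynomials. It is stated with
  coefficient functions because the type of polynomials over the ground type of a class needs sort
  constraints that do not yet hold inside the class specification.
\<close>

class real_closed_field = linordered_field +
  assumes sign_change_root:
    "a < b \<Longrightarrow> (\<Sum>i\<le>n. c i * a ^ i) < 0 \<Longrightarrow> 0 < (\<Sum>i\<le>n. c i * b ^ i) \<Longrightarrow>
     \<exists>x. a < x \<and> x < b \<and> (\<Sum>i\<le>n. c i * x ^ i) = 0"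

lemma sign_change_imp_root:
  fixes p :: "'a::real_closed_field poly"
  assumes "a < b" "poly p a * poly p b < 0"
  obtains x where "a < x" "x < b" "poly p x = 0"
proof -
  have neg: "\<exists>x. a < x \<and> x < b \<and> poly p x = 0" if "poly p a < 0" "poly p b > 0" for p :: "'a poly"
    using sign_change_root[of a b "coeff p" "degree p"] that assms(1) by (simp add: poly_altdef)
  from assms(2) consider "poly p a < 0" "poly p b > 0" | "poly (-p) a < 0" "poly (-p) b > 0"
    by (auto simp: mult_less_0_iff)
  then show ?thesis using neg[of p] neg[of "-p"] that by (cases; fastforce)
qed

instance real :: real_closed_field
proof
  fix a b :: real and c :: "nat \<Rightarrow> real" and n
  assume "a < b" "(\<Sum>i\<le>n. c i * a ^ i) < 0" "0 < (\<Sum>i\<le>n. c i * b ^ i)"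
  moreover have "continuous_on {a..b} (\<lambda>x. \<Sum>i\<le>n. c i * x ^ i)" by (intro continuous_intros)
  ultimately obtain x where "a \<le> x" "x \<le> b" "(\<Sum>i\<le>n. c i * x ^ i) = 0"
    using IVT'[of "\<lambda>x. \<Sum>i\<le>n. c i * x ^ i" a 0 b] by auto
  moreover from this have "x \<noteq> a" "x \<noteq> b"
    using \<open>(\<Sum>i\<le>n. c i * a ^ i) < 0\<close> \<open>0 < (\<Sum>i\<le>n. c i * b ^ i)\<close> by auto
  ultimately show "\<exists>x>a. x < b \<and> (\<Sum>i\<le>n. c i * x ^ i) = 0" by (intro exI[of _ x]) auto
qed

text \<open>
  Signs of elements of different ordered fields have to be compared, so the sign is an integer
  rather than an element of the field.
\<close>

definition isgn :: "'a::linordered_idom \<Rightarrow> int" where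
  "isgn x = (if x > 0 then 1 else if x < 0 then -1 else 0)"

lemma isgn_simps [simp]:
  "isgn (0::'a::linordered_idom) = 0" "isgn (1::'a) = 1" "isgn (-x) = - isgn (x::'a)"
  "isgn x = 0 \<longleftrightarrow> x = 0" "isgn x = 1 \<longleftrightarrow> x > 0" "isgn x = -1 \<longleftrightarrow> x < 0"
  "0 < isgn x \<longleftrightarrow> x > 0" "isgn x < 0 \<longleftrightarrow> x < 0"
  by (auto simp: isgn_def)

lemma isgn_mult: "isgn (x * y) = isgn x * isgn (y::'a::linordered_idom)"
  by (auto simp: isgn_def mult_less_0_iff zero_less_mult_iff)

lemma isgn_power: "isgn (x ^ n) = isgn (x::'a::linordered_idom) ^ n"
  by (induction n) (auto simp: isgn_mult)

lemma isgn_eq_iff: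
  "isgn (x::'a::linordered_idom) = isgn (y::'b::linordered_idom) \<longleftrightarrow> (x > 0 \<longleftrightarrow> y > 0) \<and> (x < 0 \<longleftrightarrow> y < 0)"
  by (auto simp: isgn_def)

lemma isgn_poly_constant:
  fixes p :: "'a::real_closed_field poly"
  assumes "a \<le> b" "\<And>x. a \<le> x \<Longrightarrow> x \<le> b \<Longrightarrow> poly p x \<noteq> 0"
  shows "isgn (poly p a) = isgn (poly p b)"
proof (rule ccontr)
  assume *: "isgn (poly p a) \<noteq> isgn (poly p b)"
  have "poly p a \<noteq> 0" "poly p b \<noteq> 0" using assms by auto
  with * have "poly p a * poly p b < 0"
    by (auto simp: isgn_def mult_less_0_iff split: if_splits)
  moreover have "a < b" using * assms(1) by (cases "a = b") auto
  ultimately obtain x where "a < x" "x < b" "poly p x = 0" using sign_change_imp_root by blast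
  then show False using assms(2)[of x] by simp
qed

text \<open>
  Without compactness, Rolle's theorem has an algebraic proof: write \<open>p = A ^ Suc m * B ^ Suc n * q\<close> with
  \<open>A = Y - a\<close>, \<open>B = Y - b\<close> and \<open>q\<close> without zeros in \<open>[a, b]\<close>. Then the derivative of \<open>p\<close> is \<open>A ^ m * B ^ n * s\<close>
  for a polynomial \<open>s\<close> whose values at \<open>a\<close> and \<open>b\<close> are multiples of \<open>q a\<close> and \<open>q b\<close> with factors of opposite signs.
\<close>

lemma Rolle_consecutive:
  fixes p :: "'a::real_closed_field poly"
  assumes "a < b" "p \<noteq> 0" "poly p a = 0" "poly p b = 0" and no: "\<And>x. a < x \<Longrightarrow> x < b \<Longrightarrow> poly p x \<noteq> 0"
  obtains c where "a < c" "c < b" "poly (pderiv p) c = 0"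
proof -
  let ?A = "[:-a,1:]" and ?B = "[:-b,1:]"
  obtain r where r: "p = ?A ^ order a p * r" "\<not> ?A dvd r" using order_decomp[OF \<open>p \<noteq> 0\<close>] by blast
  have "r \<noteq> 0" using r by auto
  have "order a p \<noteq> 0" using assms order_root by blast
  then obtain m where m: "order a p = Suc m" by (cases "order a p") auto
  have "poly r b = 0"
    using \<open>poly p b = 0\<close> \<open>a < b\<close> by (subst (asm) r(1)) auto
  obtain q where q: "r = ?B ^ order b r * q" "\<not> ?B dvd q" using order_decomp[OF \<open>r \<noteq> 0\<close>] by blast
  have "order b r \<noteq> 0" using \<open>poly r b = 0\<close> \<open>r \<noteq> 0\<close> order_root by blast
  then obtain n where n: "order b r = Suc n" by (cases "order b r") auto
  have pe: "p = ?A ^ Suc m * (?B ^ Suc n * q)" using r q m n by simp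
  have "poly r a \<noteq> 0" using r(2) by (simp add: dvd_iff_poly_eq_0)
  have qa: "poly q a \<noteq> 0" using \<open>poly r a \<noteq> 0\<close> by (subst (asm) q(1)) auto
  have qb: "poly q b \<noteq> 0" using q(2) by (simp add: dvd_iff_poly_eq_0)
  have "poly q x \<noteq> 0" if "a \<le> x" "x \<le> b" for x
    using that qa qb no[of x] pe by (cases "x = a"; cases "x = b"; auto)
  then have qs: "isgn (poly q a) = isgn (poly q b)" using isgn_poly_constant[of a b q] \<open>a < b\<close> by simp
  define s where "s = smult (of_nat (Suc m)) (?B * q) + smult (of_nat (Suc n)) (?A * q) + ?A * ?B * pderiv q"
  have gen: "pderiv (A ^ Suc m * (B ^ Suc n * q)) =
      A ^ m * B ^ n * (smult (of_nat (Suc m)) (B * q) + smult (of_nat (Suc n)) (A * q) + A * B * pderiv q)"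
    if "pderiv A = 1" "pderiv B = 1" for A B :: "'a poly"
    unfolding pderiv_mult pderiv_power_Suc that by (simp add: algebra_simps)
  have "pderiv p = ?A ^ m * ?B ^ n * s"
    unfolding pe s_def by (rule gen) (simp_all add: pderiv_pCons)
  moreover have "poly s a * poly s b < 0"
  proof -
    have pos: "isgn (of_nat (Suc k) :: 'a) = 1" for k
      by (simp only: isgn_simps of_nat_0_less_iff zero_less_Suc)
    have "isgn (a - b) = -1" "isgn (b - a) = 1" using \<open>a < b\<close> by simp_all
    note signs = pos this
    have "poly s a = of_nat (Suc m) * ((a - b) * poly q a)"
      by (simp add: s_def algebra_simps)
    then have "isgn (poly s a) = - isgn (poly q a)"
      by (simp only: isgn_mult signs)
    moreover have "poly s b = of_nat (Suc n) * ((b - a) * poly q b)"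
      by (simp add: s_def algebra_simps)
    then have "isgn (poly s b) = isgn (poly q b)"
      by (simp only: isgn_mult signs)
    ultimately have "isgn (poly s a * poly s b) = - ((isgn (poly q a))^2)"
      using qs by (simp add: isgn_mult power2_eq_square)
    also have "\<dots> < 0" using qa by (simp add: isgn_def)
    finally show ?thesis by simp
  qed
  ultimately show ?thesis using sign_change_imp_root[OF \<open>a < b\<close>] that by (metis mult_zero_right poly_mult)
qed

lemma poly_Rolle:
  fixes p :: "'a::real_closed_field poly"
  assumes "a < b" "poly p a = 0" "poly p b = 0"
  obtains c where "a < c" "c < b" "poly (pderiv p) c = 0"
proof (cases "p = 0")
  case True
  then show ?thesis using that[of "(a + b) / 2"] assms by simp
next
  case False
  define R where "R = {x. poly p x = 0 \<and> a < x \<and> x \<le> b}"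
  have "finite R" using poly_roots_finite[OF False] by (rule finite_subset[rotated]) (auto simp: R_def)
  moreover have "b \<in> R" using assms by (auto simp: R_def)
  ultimately have M: "Min R \<in> R" "\<And>x. x \<in> R \<Longrightarrow> Min R \<le> x" by (auto intro: Min_in)
  then have "poly p x \<noteq> 0" if "a < x" "x < Min R" for x
    using that by (force simp: R_def)
  then obtain c where "a < c" "c < Min R" "poly (pderiv p) c = 0"
    using Rolle_consecutive[of a "Min R" p] M(1) False assms by (auto simp: R_def)
  moreover have "Min R \<le> b" using M(1) by (auto simp: R_def)
  ultimately show ?thesis using that by force
qed

lemma poly_MVT_rcf:
  fixes p :: "'a::real_closed_field poly"
  assumes "a < b"
  obtains c where "a < c" "c < b" "poly p b - poly p a = (b - a) * poly (pderiv p) c"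
proof -
  define g where "g = smult (b - a) (p - [:poly p a:]) - smult (poly p b - poly p a) [:-a,1:]"
  have "poly g a = 0" "poly g b = 0" by (auto simp: g_def algebra_simps)
  then obtain c where "a < c" "c < b" "poly (pderiv g) c = 0" using poly_Rolle[OF assms] by blast
  moreover have "poly (pderiv g) c = (b - a) * poly (pderiv p) c - (poly p b - poly p a)"
    by (simp add: g_def pderiv_diff pderiv_smult pderiv_pCons)
  ultimately show ?thesis using that by auto
qed

lemma isgn_poly_diff:
  fixes p :: "'a::real_closed_field poly"
  assumes "a < b" "\<And>x. a \<le> x \<Longrightarrow> x < b \<Longrightarrow> poly (pderiv p) x \<noteq> 0"
  shows "isgn (poly p b - poly p a) = isgn (poly (pderiv p) a)"
proof -
  obtain c where c: "a < c" "c < b" "poly p b - poly p a = (b - a) * poly (pderiv p) c"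
    using poly_MVT_rcf[OF assms(1)] by blast
  have "isgn (poly (pderiv p) a) = isgn (poly (pderiv p) c)"
    using c assms by (intro isgn_poly_constant) auto
  moreover have "isgn (b - a) = 1" using assms(1) by simp
  ultimately show ?thesis using c(3) by (simp add: isgn_mult del: isgn_simps(5))
qed

lemma poly_eventually_positive:
  fixes p :: "'a::linordered_field poly"
  assumes "lead_coeff p > 0"
  shows "\<exists>B. \<exists>e>0. \<forall>y\<ge>B. e \<le> poly p y"
  using assms
proof (induction p)
  case 0
  then show ?case by simp
next
  case (pCons a q)
  show ?case
  proof (cases "q = 0")
    case True
    then show ?thesis using pCons.prems by (intro exI[of _ 0] exI[of _ a]) auto
  next
    case False
    then obtain B e where B: "e > 0" "\<And>y. y \<ge> B \<Longrightarrow> e \<le> poly q y" using pCons by auto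
    have "1 \<le> poly (pCons a q) y" if y: "y \<ge> max B (max 1 ((1 + \<bar>a\<bar>) / e))" for y
    proof -
      have "(1 + \<bar>a\<bar>) / e \<le> y" "e \<le> poly q y" "y \<ge> 0" using B y by auto
      then have "1 + \<bar>a\<bar> \<le> y * e" using B(1) by (simp add: field_simps)
      also have "\<dots> \<le> y * poly q y" using \<open>e \<le> poly q y\<close> \<open>y \<ge> 0\<close> by (intro mult_left_mono)
      finally show ?thesis using abs_ge_minus_self[of a] by simp
    qed
    then show ?thesis by (meson zero_less_one)
  qed
qed

section \<open>Order-preserving maps that match signs\<close>

text \<open>
  Pairs \<open>(f, g)\<close> stand for the same formal polynomial read in two real closed fields. A map that matches
  signs need not be injective: it may contract intervals on which no sign changes. This makes such maps easy
  to build, while the existence of matching maps in both directions still says that both fields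
  show the same sign patterns in the same order.
\<close>

definition matches :: "('a::real_closed_field poly \<times> 'b::real_closed_field poly) set \<Rightarrow> ('a \<Rightarrow> 'b) \<Rightarrow> bool" where
  "matches I h \<longleftrightarrow> mono h \<and> (\<forall>(f,g)\<in>I. \<forall>y. isgn (poly f y) = isgn (poly g (h y)))"

lemma matchesD:
  assumes "matches I h"
  shows matches_mono: "x \<le> y \<Longrightarrow> h x \<le> h y"
    and matches_isgn: "(f, g) \<in> I \<Longrightarrow> isgn (poly f y) = isgn (poly g (h y))"
  using assms unfolding matches_def mono_def by blast+

text \<open>
  If a root \<open>x\<close> of \<open>f\<close> were not separated from \<open>y\<close>, then \<open>h\<close> would be constant between them, so \<open>f\<close>
  would have infinitely many roots.
\<close>

lemma matches_strict_at_root: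
  assumes "matches I h" "(f, g) \<in> I" "f \<noteq> 0" "x < y" "poly f x = 0 \<or> poly f y = 0"
  shows "h x < h y"
proof (rule ccontr)
  assume "\<not> h x < h y"
  then have eq: "h x = h y" using matches_mono[OF assms(1), of x y] \<open>x < y\<close> by simp
  have "poly f t = 0" if "x \<le> t" "t \<le> y" for t
  proof -
    have "h t = h x" using matches_mono[OF assms(1), of x t] matches_mono[OF assms(1), of t y] that eq by simp
    then have "isgn (poly f t) = isgn (poly f x)" "isgn (poly f t) = isgn (poly f y)"
      using matches_isgn[OF assms(1,2)] eq by metis+
    then show ?thesis using assms(5) by auto
  qed
  then have "{x..y} \<subseteq> {t. poly f t = 0}" by auto
  then have "finite {x..y}" using poly_roots_finite[OF \<open>f \<noteq> 0\<close>] finite_subset by blast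
  then show False using \<open>x < y\<close> infinite_Icc by blast
qed

text \<open>
  Two increasing polynomials, \<open>p\<close> to the right of \<open>y\<close> and \<open>q\<close> to the right of \<open>u\<close>, both up to an
  endpoint where their signs agree (\<open>W\<close> holds the pair of endpoints) or on an unbounded interval (\<open>W = {}\<close>).
  If \<open>q\<close> is too small at \<open>u\<close>, the sign of \<open>p\<close> at \<open>y\<close> is found further to the right: the sign of \<open>q\<close> at the
  endpoint is that of \<open>p\<close>, which is positive, and an increasing polynomial on an unbounded interval
  becomes positive.
\<close>

lemma increasing_realize_sign_above:
  fixes p :: "'a::real_closed_field poly" and q :: "'b::real_closed_field poly"
  assumes W: "W = {} \<or> (\<exists>w w'. W = {(w, w')})"
    and sides: "\<forall>(w,w')\<in>W. y < w \<and> u < w' \<and> isgn (poly p w) = isgn (poly q w')"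
    and pinc: "\<And>x. y \<le> x \<Longrightarrow> \<forall>(w,w')\<in>W. x < w \<Longrightarrow> poly (pderiv p) x > 0"
    and qinc: "\<And>x. u \<le> x \<Longrightarrow> \<forall>(w,w')\<in>W. x < w' \<Longrightarrow> poly (pderiv q) x > 0"
    and less: "isgn (poly q u) < isgn (poly p y)"
  shows "\<exists>v>u. (\<forall>(w,w')\<in>W. v < w') \<and> isgn (poly q v) = isgn (poly p y)"
proof -
  have qu: "poly q u \<le> 0" and py: "poly p y \<ge> 0"
    using less by (auto simp: isgn_def split: if_splits)
  have "\<exists>v>u. (\<forall>(w,w')\<in>W. v < w') \<and> poly q v > 0"
    using W
  proof (elim disjE exE)
    assume "W = {}"
    then have inc: "poly (pderiv q) x > 0" if "u \<le> x" for x using qinc that by simp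
    have "degree q \<noteq> 0"
    proof
      assume "degree q = 0"
      then have "pderiv q = 0" by (simp add: pderiv_eq_0_iff)
      then show False using inc[of u] by simp
    qed
    then obtain n where n: "degree q = Suc n" by (cases "degree q") auto
    then have deg: "degree (pderiv q) = n" by (simp add: degree_pderiv)
    then have lc: "lead_coeff (pderiv q) = of_nat (Suc n) * lead_coeff q" using n by (simp add: coeff_pderiv)
    have "lead_coeff q > 0"
    proof (rule ccontr)
      assume "\<not> ?thesis"
      moreover have "lead_coeff q \<noteq> 0" using n by (metis degree_0 leading_coeff_0_iff nat.distinct(1))
      ultimately have "lead_coeff q < 0" by (metis linorder_neqE)
      then have "of_nat (Suc n) * lead_coeff q < 0"
        using mult_pos_neg of_nat_0_less_iff zero_less_Suc by metis
      then have "lead_coeff (- pderiv q) > 0" using lc by simp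
      then obtain B e where "e > 0" "\<And>x. x \<ge> B \<Longrightarrow> e \<le> poly (- pderiv q) x"
        using poly_eventually_positive by blast
      from this(1) this(2)[of "max B u"] inc[of "max B u"] show False by simp
    qed
    then obtain B e where "e > 0" "\<And>x. x \<ge> B \<Longrightarrow> e \<le> poly q x" using poly_eventually_positive by blast
    from this(1) this(2)[of "max B (u + 1)"] have "poly q (max B (u + 1)) > 0" by simp
    moreover have "max B (u + 1) > u" using less_add_one[of u] by (metis less_max_iff_disj)
    ultimately show ?thesis using \<open>W = {}\<close> by auto
  next
    fix w w' assume Ww: "W = {(w, w')}"
    then have *: "y < w" "u < w'" "isgn (poly p w) = isgn (poly q w')" using sides by auto
    have "isgn (poly p w - poly p y) = isgn (poly (pderiv p) y)"
      using isgn_poly_diff[OF \<open>y < w\<close>] pinc Ww by (metis case_prodI order_less_irrefl prod.case singletonD)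
    also have "\<dots> = 1" using pinc[of y] Ww *(1) by simp
    finally have "poly q w' > 0" using py *(3) by (simp add: isgn_eq_iff)
    obtain r where r: "u \<le> r" "r < w'" "poly q r = 0"
    proof (cases "poly q u = 0")
      case True
      then show ?thesis using that[of u] * by simp
    next
      case False
      then have "poly q u * poly q w' < 0" using qu \<open>poly q w' > 0\<close> by (simp add: mult_less_0_iff)
      then show ?thesis using sign_change_imp_root[OF *(2)] that by (metis less_imp_le)
    qed
    define v where "v = (r + w') / 2"
    have v: "r < v" "v < w'" using r by (auto simp: v_def field_simps)
    have "isgn (poly q v - poly q r) = isgn (poly (pderiv q) r)"
      using isgn_poly_diff[OF v(1), of q] qinc Ww v r(1)
      by (metis (no_types, lifting) case_prodI order_less_irrefl order_less_trans order_trans prod.case singletonD)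
    also have "\<dots> = 1" using qinc[of r] Ww r by simp
    finally have "poly q v > 0" using r by simp
    then show ?thesis using Ww v r by (intro exI[of _ v]) auto
  qed
  then obtain v where v: "v > u" "\<forall>(w,w')\<in>W. v < w'" "poly q v > 0" by blast
  show ?thesis
  proof (cases "poly p y = 0")
    case True
    then have "poly q u * poly q v < 0" using less v by (simp add: mult_less_0_iff)
    then obtain x where "u < x" "x < v" "poly q x = 0" using sign_change_imp_root[OF v(1)] by blast
    then show ?thesis using v True by (intro exI[of _ x]) auto
  next
    case False
    then show ?thesis using py v by (intro exI[of _ v]) (auto simp: isgn_eq_iff)
  qed
qed

text \<open>
  The mirror image, obtained by the substitution of \<open>-x\<close> for \<open>x\<close>.
\<close>

lemma increasing_realize_sign_below:
  fixes p :: "'a::real_closed_field poly" and q :: "'b::real_closed_field poly"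
  assumes W: "W = {} \<or> (\<exists>w w'. W = {(w, w')})"
    and sides: "\<forall>(w,w')\<in>W. w < y \<and> w' < u \<and> isgn (poly p w) = isgn (poly q w')"
    and pinc: "\<And>x. x \<le> y \<Longrightarrow> \<forall>(w,w')\<in>W. w < x \<Longrightarrow> poly (pderiv p) x > 0"
    and qinc: "\<And>x. x \<le> u \<Longrightarrow> \<forall>(w,w')\<in>W. w' < x \<Longrightarrow> poly (pderiv q) x > 0"
    and less: "isgn (poly p y) < isgn (poly q u)"
  shows "\<exists>v<u. (\<forall>(w,w')\<in>W. w' < v) \<and> isgn (poly q v) = isgn (poly p y)"
proof -
  let ?p = "- pcompose p [:0,-1:]" and ?q = "- pcompose q [:0,-1:]"
  let ?W = "(\<lambda>(w,w'). (-w,-w')) ` W"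
  have W': "?W = {} \<or> (\<exists>w w'. ?W = {(w, w')})" using W by auto
  have der: "poly (pderiv ?p) x = poly (pderiv p) (-x)" "poly (pderiv ?q) x' = poly (pderiv q) (-x')" for x x'
    by (simp_all add: pderiv_minus pderiv_pcompose pderiv_pCons poly_pcompose)
  have "\<exists>v> -u. (\<forall>(w,w')\<in>?W. v < w') \<and> isgn (poly ?q v) = isgn (poly ?p (-y))"
  proof (rule increasing_realize_sign_above[OF W'])
    show "\<forall>(w,w')\<in>?W. -y < w \<and> -u < w' \<and> isgn (poly ?p w) = isgn (poly ?q w')"
      using sides by (auto simp: poly_pcompose)
    show "poly (pderiv ?p) x > 0" if "-y \<le> x" "\<forall>(w,w')\<in>?W. x < w" for x
      unfolding der using that by (intro pinc) (auto simp: minus_le_iff less_minus_iff)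
    show "poly (pderiv ?q) x > 0" if "-u \<le> x" "\<forall>(w,w')\<in>?W. x < w'" for x
      unfolding der using that by (intro qinc) (auto simp: minus_le_iff less_minus_iff)
    show "isgn (poly ?q (-u)) < isgn (poly ?p (-y))" using less by (simp add: poly_pcompose)
  qed
  then obtain v where "v > -u" "\<forall>(w,w')\<in>?W. v < w'" "isgn (poly ?q v) = isgn (poly ?p (-y))" by blast
  then show ?thesis by (intro exI[of _ "-v"]) (auto simp: poly_pcompose minus_less_iff less_minus_iff)
qed

text \<open>
  The inductive step of the Cohen-Hoermander method. Let \<open>Z\<close> be the finite set of roots of the nonzero \<open>f\<close>
  with \<open>(f, g) \<in> I\<close>. As there are matching maps in both directions, \<open>h\<close> maps \<open>Z\<close> bijectively and in order
  onto the corresponding set \<open>Z'\<close> on the other side. On each interval between neighbouring points of \<open>Z\<close> the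
  derivative of \<open>p\<close> has no root, so \<open>p\<close> is monotone there, in the same direction as \<open>q\<close> on the corresponding
  interval; and the signs at the endpoints agree by assumption. Hence both take the same signs, in the same
  order, and \<open>h\<close> can be corrected inside the intervals.
\<close>

lemma matches_insert:
  fixes I :: "('a::real_closed_field poly \<times> 'b::real_closed_field poly) set"
  assumes fin: "finite I" and h: "matches I h" and k: "matches (I\<inverse>) k"
    and der: "(pderiv p, pderiv q) \<in> I" "pderiv p \<noteq> 0"
    and roots: "\<And>f g z. (f, g) \<in> I \<Longrightarrow> f \<noteq> 0 \<Longrightarrow> poly f z = 0 \<Longrightarrow> isgn (poly p z) = isgn (poly q (h z))"
  shows "\<exists>h'. matches (insert (p, q) I) h'"
proof -
  have k': "isgn (poly g y) = isgn (poly f (k y))" if "(f, g) \<in> I" for f g y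
    using matches_isgn[OF k, of g f] that by auto
  have zero_iff: "f = 0 \<longleftrightarrow> g = 0" if "(f, g) \<in> I" for f g
  proof
    assume "f = 0"
    then have "poly g y = 0" for y using k'[OF that, of y] by simp
    then show "g = 0" using poly_all_0_iff_0 by blast
  next
    assume "g = 0"
    then have "poly f y = 0" for y using matches_isgn[OF h that, of y] by simp
    then show "f = 0" using poly_all_0_iff_0 by blast
  qed
  define Z where "Z = {z. \<exists>f g. (f, g) \<in> I \<and> f \<noteq> 0 \<and> poly f z = 0}"
  define Z' where "Z' = {z. \<exists>f g. (f, g) \<in> I \<and> g \<noteq> 0 \<and> poly g z = 0}"
  have "Z \<subseteq> (\<Union>f\<in>fst ` I - {0}. {z. poly f z = 0})" by (force simp: Z_def)
  then have finZ: "finite Z" using fin poly_roots_finite by (rule_tac finite_subset) auto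
  have "Z' \<subseteq> (\<Union>f\<in>snd ` I - {0}. {z. poly f z = 0})" by (force simp: Z'_def)
  then have finZ': "finite Z'" using fin poly_roots_finite by (rule_tac finite_subset) auto
  have strict: "h x < h y" if "x < y" "x \<in> Z \<or> y \<in> Z" for x y
    using that matches_strict_at_root[OF h] unfolding Z_def by blast
  have strict': "k x < k y" if "x < y" "x \<in> Z' \<or> y \<in> Z'" for x y
  proof -
    from that(2) obtain f g where "(g, f) \<in> I\<inverse>" "g \<noteq> 0" "poly g x = 0 \<or> poly g y = 0"
      unfolding Z'_def by blast
    then show ?thesis using matches_strict_at_root[OF k] that(1) by blast
  qed
  have inj: "inj_on h Z"
  proof (rule inj_onI)
    show "x = y" if "x \<in> Z" "y \<in> Z" "h x = h y" for x y
      using that strict[of x y] strict[of y x] by (cases x y rule: linorder_cases) auto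
  qed
  have inj': "inj_on k Z'"
  proof (rule inj_onI)
    show "x = y" if "x \<in> Z'" "y \<in> Z'" "k x = k y" for x y
      using that strict'[of x y] strict'[of y x] by (cases x y rule: linorder_cases) auto
  qed
  have sub: "h ` Z \<subseteq> Z'"
  proof (rule image_subsetI)
    fix z assume "z \<in> Z"
    then obtain f g where fg: "(f, g) \<in> I" "f \<noteq> 0" "poly f z = 0" unfolding Z_def by blast
    then have "poly g (h z) = 0" using matches_isgn[OF h fg(1), of z] by simp
    then show "h z \<in> Z'" using fg zero_iff[OF fg(1)] unfolding Z'_def by blast
  qed
  have sub': "k ` Z' \<subseteq> Z"
  proof (rule image_subsetI)
    fix z assume "z \<in> Z'"
    then obtain f g where fg: "(f, g) \<in> I" "g \<noteq> 0" "poly g z = 0" unfolding Z'_def by blast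
    then have "poly f (k z) = 0" using k'[OF fg(1), of z] by simp
    then show "k z \<in> Z" using fg zero_iff[OF fg(1)] unfolding Z_def by blast
  qed
  have onto: "h ` Z = Z'"
    using card_inj_on_le[OF inj' sub' finZ] card_image[OF inj] sub finZ' by (intro card_seteq) auto
  define below where "below y = {z \<in> Z. z < y}" for y
  define above where "above y = {z \<in> Z. y < z}" for y
  define cut where "cut y v \<longleftrightarrow> (\<forall>z\<in>below y. h z < v) \<and> (\<forall>z\<in>above y. v < h z)" for y v
  have cut_h: "cut y (h y)" for y using strict by (auto simp: cut_def below_def above_def)
  have I_sign: "isgn (poly f y) = isgn (poly g v)" if y: "y \<notin> Z" and c: "cut y v" and fg: "(f, g) \<in> I" for y v f g
  proof (cases "g = 0")
    case True
    then show ?thesis using zero_iff[OF fg] by simp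
  next
    case False
    have "poly g x \<noteq> 0" if x: "min v (h y) \<le> x" "x \<le> max v (h y)" for x
    proof
      assume "poly g x = 0"
      then have "x \<in> h ` Z" using fg False onto by (auto simp: Z'_def)
      then obtain z where z: "z \<in> Z" "x = h z" by blast
      with y consider "z \<in> below y" | "z \<in> above y" by (force simp: below_def above_def)
      then show False using x z c cut_h[of y] by cases (force simp: cut_def)+
    qed
    then have "isgn (poly g (min v (h y))) = isgn (poly g (max v (h y)))"
      by (intro isgn_poly_constant) auto
    then have "isgn (poly g v) = isgn (poly g (h y))" by (auto simp: min_def max_def split: if_splits)
    then show ?thesis using matches_isgn[OF h fg] by simp
  qed
  \<comment> \<open>Of the pairs \<open>(p, q)\<close> and \<open>(-p, -q)\<close>, one has positive derivatives on the interval of \<open>y\<close>.\<close>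
  have realize_inc: "\<exists>v. cut y v \<and> isgn (poly q1 v) = isgn (poly p1 y)"
    if y: "y \<notin> Z" and pq: "(p1, q1) = (p, q) \<or> (p1, q1) = (-p, -q)" and pos: "poly (pderiv p1) y > 0" for y p1 q1
  proof -
    have roots1: "isgn (poly p1 z) = isgn (poly q1 (h z))" if "z \<in> Z" for z
      using pq roots that unfolding Z_def by auto
    have der_nz: "poly (pderiv p1) x \<noteq> 0" if "x \<notin> Z" for x
      using that pq der by (auto simp: Z_def pderiv_minus)
    have pinc: "poly (pderiv p1) x > 0" if "below y \<subseteq> {..<x}" "above y \<subseteq> {x<..}" for x
    proof -
      have "t \<notin> Z" if t: "min x y \<le> t" "t \<le> max x y" for t
      proof
        assume "t \<in> Z"
        with y consider "t \<in> below y" | "t \<in> above y" by (force simp: below_def above_def)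
        then show False using t \<open>below y \<subseteq> {..<x}\<close> \<open>above y \<subseteq> {x<..}\<close>
          by cases (force simp: below_def above_def)+
      qed
      then have "isgn (poly (pderiv p1) (min x y)) = isgn (poly (pderiv p1) (max x y))"
        using der_nz by (intro isgn_poly_constant) auto
      then have "isgn (poly (pderiv p1) x) = isgn (poly (pderiv p1) y)"
        by (auto simp: min_def max_def split: if_splits)
      then show ?thesis using pos by (simp add: isgn_eq_iff)
    qed
    have qinc: "poly (pderiv q1) v > 0" if "cut y v" for v
    proof -
      have "isgn (poly (pderiv p1) y) = isgn (poly (pderiv q1) v)"
        using I_sign[OF y that der(1)] pq by (auto simp: pderiv_minus)
      then show ?thesis using pos by (simp add: isgn_eq_iff)
    qed
    have finA: "finite (below y)" "finite (above y)" using finZ by (auto simp: below_def above_def)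
    consider "isgn (poly q1 (h y)) = isgn (poly p1 y)" | "isgn (poly q1 (h y)) < isgn (poly p1 y)"
      | "isgn (poly p1 y) < isgn (poly q1 (h y))" by linarith
    then show ?thesis
    proof cases
      case 1
      then show ?thesis using cut_h by blast
    next
      case 2
      define W where "W = (if above y = {} then {} else {(Min (above y), h (Min (above y)))})"
      have Min: "Min (above y) \<in> above y" if "above y \<noteq> {}" using that finA by simp
      have above_iff: "(\<forall>(w,w')\<in>W. x < w) \<longleftrightarrow> above y \<subseteq> {x<..}" for x
        using finA by (auto simp: W_def)
      have above_iff': "(\<forall>(w,w')\<in>W. v < w') \<longleftrightarrow> (\<forall>z\<in>above y. v < h z)" for v
      proof (cases "above y = {}")
        case False
        have le: "h (Min (above y)) \<le> h z" if "z \<in> above y" for z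
          using that finA by (intro matches_mono[OF h]) auto
        have "(\<forall>(w,w')\<in>W. v < w') \<longleftrightarrow> v < h (Min (above y))" using False by (simp add: W_def)
        also have "\<dots> \<longleftrightarrow> (\<forall>z\<in>above y. v < h z)" using le Min[OF False] by (meson less_le_trans)
        finally show ?thesis .
      qed (auto simp: W_def)
      have "\<exists>v>h y. (\<forall>(w,w')\<in>W. v < w') \<and> isgn (poly q1 v) = isgn (poly p1 y)"
      proof (rule increasing_realize_sign_above)
        show "W = {} \<or> (\<exists>w w'. W = {(w, w')})" by (auto simp: W_def)
        show "\<forall>(w,w')\<in>W. y < w \<and> h y < w' \<and> isgn (poly p1 w) = isgn (poly q1 w')"
        proof (cases "above y = {}")
          case False
          then have "Min (above y) \<in> Z" "y < Min (above y)" using Min by (simp_all add: above_def)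
          then show ?thesis using False strict[of y "Min (above y)"] roots1 by (simp add: W_def)
        qed (simp add: W_def)
        show "poly (pderiv p1) x > 0" if "y \<le> x" "\<forall>(w,w')\<in>W. x < w" for x
        proof (rule pinc)
          show "below y \<subseteq> {..<x}" using that(1) by (auto simp: below_def)
          show "above y \<subseteq> {x<..}" using that(2) by (simp only: above_iff)
        qed
        show "poly (pderiv q1) x > 0" if "h y \<le> x" "\<forall>(w,w')\<in>W. x < w'" for x
          using that cut_h[of y] unfolding above_iff' by (intro qinc) (auto simp: cut_def intro: less_le_trans)
      qed (rule 2)
      then obtain v where v: "h y < v" "\<forall>(w,w')\<in>W. v < w'" "isgn (poly q1 v) = isgn (poly p1 y)" by blast
      then have "cut y v" using cut_h[of y] unfolding above_iff' cut_def by (meson less_trans)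
      then show ?thesis using v by blast
    next
      case 3
      define W where "W = (if below y = {} then {} else {(Max (below y), h (Max (below y)))})"
      have Max: "Max (below y) \<in> below y" if "below y \<noteq> {}" using that finA by simp
      have below_iff: "(\<forall>(w,w')\<in>W. w < x) \<longleftrightarrow> below y \<subseteq> {..<x}" for x
        using finA by (auto simp: W_def)
      have below_iff': "(\<forall>(w,w')\<in>W. w' < v) \<longleftrightarrow> (\<forall>z\<in>below y. h z < v)" for v
      proof (cases "below y = {}")
        case False
        have le: "h z \<le> h (Max (below y))" if "z \<in> below y" for z
          using that finA by (intro matches_mono[OF h]) auto
        have "(\<forall>(w,w')\<in>W. w' < v) \<longleftrightarrow> h (Max (below y)) < v" using False by (simp add: W_def)
        also have "\<dots> \<longleftrightarrow> (\<forall>z\<in>below y. h z < v)" using le Max[OF False] by (meson le_less_trans)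
        finally show ?thesis .
      qed (auto simp: W_def)
      have "\<exists>v<h y. (\<forall>(w,w')\<in>W. w' < v) \<and> isgn (poly q1 v) = isgn (poly p1 y)"
      proof (rule increasing_realize_sign_below)
        show "W = {} \<or> (\<exists>w w'. W = {(w, w')})" by (auto simp: W_def)
        show "\<forall>(w,w')\<in>W. w < y \<and> w' < h y \<and> isgn (poly p1 w) = isgn (poly q1 w')"
        proof (cases "below y = {}")
          case False
          then have "Max (below y) \<in> Z" "Max (below y) < y" using Max by (simp_all add: below_def)
          then show ?thesis using False strict[of "Max (below y)" y] roots1 by (simp add: W_def)
        qed (simp add: W_def)
        show "poly (pderiv p1) x > 0" if "x \<le> y" "\<forall>(w,w')\<in>W. w < x" for x
        proof (rule pinc)
          show "above y \<subseteq> {x<..}" using that(1) by (auto simp: above_def)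
          show "below y \<subseteq> {..<x}" using that(2) by (simp only: below_iff)
        qed
        show "poly (pderiv q1) x > 0" if "x \<le> h y" "\<forall>(w,w')\<in>W. w' < x" for x
          using that cut_h[of y] unfolding below_iff' by (intro qinc) (auto simp: cut_def intro: le_less_trans)
      qed (rule 3)
      then obtain v where v: "v < h y" "\<forall>(w,w')\<in>W. w' < v" "isgn (poly q1 v) = isgn (poly p1 y)" by blast
      then have "cut y v" using cut_h[of y] unfolding below_iff' cut_def by (meson less_trans)
      then show ?thesis using v by blast
    qed
  qed
  have realize: "\<exists>v. cut y v \<and> isgn (poly q v) = isgn (poly p y)" if y: "y \<notin> Z" for y
  proof -
    have "poly (pderiv p) y \<noteq> 0" using y der by (auto simp: Z_def)
    then consider "poly (pderiv p) y > 0" | "poly (pderiv (-p)) y > 0"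
      by (auto simp: pderiv_minus neq_iff)
    then show ?thesis using realize_inc[OF y, of p q] realize_inc[OF y, of "-p" "-q"] by cases auto
  qed
  \<comment> \<open>The new value depends only on the interval of \<open>y\<close> and on the sign of \<open>p\<close> at \<open>y\<close>; thus within an
     interval only points with different signs of \<open>p\<close> have to be compared for monotonicity.\<close>
  define pick where "pick A B s = (SOME v. (\<forall>z\<in>A. h z < v) \<and> (\<forall>z\<in>B. v < h z) \<and> isgn (poly q v) = s)"
    for A B s
  define h' where "h' y = (if y \<in> Z then h y else pick (below y) (above y) (isgn (poly p y)))" for y
  have h'_Z: "h' y = h y" if "y \<in> Z" for y using that by (simp add: h'_def)
  have h'_cut: "cut y (h' y)" and h'_q: "isgn (poly q (h' y)) = isgn (poly p y)" if "y \<notin> Z" for y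
    using someI_ex[OF realize[OF that, unfolded cut_def conj_assoc]] that
    unfolding h'_def pick_def cut_def by simp_all
  have "h' x \<le> h' y" if xy: "x < y" for x y
  proof -
    consider (Z) "x \<in> Z" "y \<in> Z" | (x) "x \<in> Z" "y \<notin> Z" | (y) "x \<notin> Z" "y \<in> Z"
      | (between) z where "x \<notin> Z" "y \<notin> Z" "z \<in> Z" "x < z" "z < y"
      | (same) "x \<notin> Z" "y \<notin> Z" "\<And>z. z \<in> Z \<Longrightarrow> x < z \<Longrightarrow> z < y \<Longrightarrow> False" by blast
    then show ?thesis
    proof cases
      case Z
      then show ?thesis using matches_mono[OF h, of x y] xy by (simp add: h'_Z)
    next
      case x
      then show ?thesis using h'_cut[of y] xy by (force simp: h'_Z cut_def below_def)
    next
      case y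
      then show ?thesis using h'_cut[of x] xy by (force simp: h'_Z cut_def above_def)
    next
      case between
      then have "h' x < h z" "h z < h' y"
        using h'_cut[of x] h'_cut[of y] by (auto simp: cut_def below_def above_def)
      then show ?thesis by simp
    next
      case same
      then have noZ: "z \<notin> Z" if "x \<le> z" "z \<le> y" for z
        using that by (metis order.order_iff_strict)
      have eq: "below x = below y" "above x = above y"
        using noZ xy by (auto simp: below_def above_def) (meson linorder_not_le less_trans less_imp_le)+
      show ?thesis
      proof (rule ccontr)
        assume "\<not> ?thesis"
        then have less: "h' y < h' x" by simp
        have cuts: "cut x v" if "h' y \<le> v" "v \<le> h' x" for v
          using that h'_cut[OF same(1)] h'_cut[OF same(2)] eq by (force simp: cut_def)
        have nz: "poly (pderiv q) v \<noteq> 0" if "h' y \<le> v" "v \<le> h' x" for v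
        proof -
          have "isgn (poly (pderiv p) x) = isgn (poly (pderiv q) v)"
            using I_sign[OF same(1) cuts[OF that] der(1)] .
          moreover have "poly (pderiv p) x \<noteq> 0" using same(1) der by (auto simp: Z_def)
          ultimately show ?thesis by auto
        qed
        have "isgn (poly p y - poly p x) = isgn (poly (pderiv p) x)"
        proof (rule isgn_poly_diff[OF xy])
          fix t assume "x \<le> t" "t < y"
          then have "t \<notin> Z" using noZ by simp
          then show "poly (pderiv p) t \<noteq> 0" using der by (auto simp: Z_def)
        qed
        also have "\<dots> = isgn (poly (pderiv q) (h' y))"
          using I_sign[OF same(1) cuts der(1), of "h' y"] less by simp
        also have "\<dots> = isgn (poly q (h' x) - poly q (h' y))"
          using nz by (intro isgn_poly_diff[OF less, symmetric]) auto
        finally have "isgn (poly p y - poly p x) = isgn (poly q (h' x) - poly q (h' y))" .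
        moreover have "isgn (poly q (h' x)) = isgn (poly p x)" "isgn (poly q (h' y)) = isgn (poly p y)"
          using same h'_q by auto
        moreover have "isgn (poly p x) \<noteq> isgn (poly p y)"
          using less same eq by (auto simp: h'_def)
        ultimately show False
          by (auto simp: isgn_def split: if_splits)
      qed
    qed
  qed
  then have "mono h'" by (intro monoI) (metis order.order_iff_strict)
  moreover have "isgn (poly f y) = isgn (poly g (h' y))" if "(f, g) \<in> insert (p, q) I" for f g y
  proof (cases "y \<in> Z")
    case True
    then show ?thesis using that matches_isgn[OF h] roots by (auto simp: h'_Z Z_def)
  next
    case False
    then show ?thesis using that I_sign[OF False h'_cut[OF False]] h'_q by auto
  qed
  ultimately have "matches (insert (p, q) I) h'" unfolding matches_def by blast
  then show ?thesis by blast
qed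

section \<open>Transfer of signs for polynomials in one variable\<close>

definition ring_morphism :: "('a::comm_ring_1 \<Rightarrow> 'b::comm_ring_1) \<Rightarrow> bool" where
  "ring_morphism \<phi> \<longleftrightarrow> \<phi> 1 = 1 \<and> (\<forall>a b. \<phi> (a + b) = \<phi> a + \<phi> b \<and> \<phi> (a * b) = \<phi> a * \<phi> b)"

lemma ring_morphism_simps:
  assumes "ring_morphism \<phi>"
  shows "\<phi> 1 = 1" "\<phi> (a + b) = \<phi> a + \<phi> b" "\<phi> (a * b) = \<phi> a * \<phi> b" "\<phi> 0 = 0" "\<phi> (- a) = - \<phi> a"
    "\<phi> (a - b) = \<phi> a - \<phi> b" "\<phi> (a ^ n) = \<phi> a ^ n" "\<phi> (of_nat n) = of_nat n"
proof -
  show *: "\<phi> 1 = 1" "\<phi> (a + b) = \<phi> a + \<phi> b" "\<phi> (a * b) = \<phi> a * \<phi> b" for a b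
    using assms by (auto simp: ring_morphism_def)
  show **: "\<phi> 0 = 0" using *(2)[of 0 0] by simp
  show ***: "\<phi> (- a) = - \<phi> a" for a using *(2)[of a "-a"] ** by (simp add: eq_neg_iff_add_eq_0 add.commute)
  show "\<phi> (a - b) = \<phi> a - \<phi> b" using *(2)[of a "-b"] *** by simp
  show "\<phi> (a ^ n) = \<phi> a ^ n" by (induction n) (auto simp: *)
  show "\<phi> (of_nat n) = of_nat n" by (induction n) (auto simp: * **)
qed

lemma map_poly_morphism:
  fixes \<phi> :: "'a::idom \<Rightarrow> 'b::idom"
  assumes "ring_morphism \<phi>"
  shows "coeff (map_poly \<phi> p) i = \<phi> (coeff p i)"
    and "map_poly \<phi> (p + q) = map_poly \<phi> p + map_poly \<phi> q"
    and "map_poly \<phi> (p * q) = map_poly \<phi> p * map_poly \<phi> q"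
    and "map_poly \<phi> (smult c p) = smult (\<phi> c) (map_poly \<phi> p)"
    and "map_poly \<phi> (pderiv p) = pderiv (map_poly \<phi> p)"
    and "map_poly \<phi> (pCons c p) = pCons (\<phi> c) (map_poly \<phi> p)"
proof -
  note \<phi> = ring_morphism_simps[OF assms]
  show *: "coeff (map_poly \<phi> p) i = \<phi> (coeff p i)" for p i by (simp add: coeff_map_poly \<phi>)
  have sum: "\<phi> (sum f B) = (\<Sum>b\<in>B. \<phi> (f b))" for f :: "nat \<Rightarrow> 'a" and B
    by (induction B rule: infinite_finite_induct) (auto simp: \<phi>)
  show "map_poly \<phi> (p + q) = map_poly \<phi> p + map_poly \<phi> q"
    "map_poly \<phi> (smult c p) = smult (\<phi> c) (map_poly \<phi> p)"
    "map_poly \<phi> (p * q) = map_poly \<phi> p * map_poly \<phi> q"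
    "map_poly \<phi> (pderiv p) = pderiv (map_poly \<phi> p)"
    by (auto intro!: poly_eqI simp: * \<phi> coeff_mult sum coeff_pderiv simp del: of_nat_Suc)
  show "map_poly \<phi> (pCons c p) = pCons (\<phi> c) (map_poly \<phi> p)"
    by (rule poly_eqI) (simp add: * coeff_pCons split: nat.split)
qed

lemma morphism_poly:
  fixes \<phi> :: "'a::idom \<Rightarrow> 'b::idom"
  assumes "ring_morphism \<phi>"
  shows "\<phi> (poly p x) = poly (map_poly \<phi> p) (\<phi> x)"
  by (induction p) (simp_all add: map_poly_morphism[OF assms] ring_morphism_simps[OF assms])

text \<open>
  Coefficients range over a subring \<open>A\<close>, later the polynomials in the first \<open>n\<close> variables, so that the
  elimination of a variable yields conditions on the remaining ones.
\<close>

definition subring_of :: "'a::comm_ring_1 set \<Rightarrow> bool" where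
  "subring_of A \<longleftrightarrow> 0 \<in> A \<and> 1 \<in> A \<and> (\<forall>a\<in>A. \<forall>b\<in>A. a + b \<in> A \<and> a - b \<in> A \<and> a * b \<in> A)"

definition polys_over :: "'a::idom set \<Rightarrow> 'a poly set" where
  "polys_over A = {p. \<forall>i. coeff p i \<in> A}"

lemma subring_ofD:
  assumes "subring_of A"
  shows "0 \<in> A" "1 \<in> A" "a \<in> A \<Longrightarrow> b \<in> A \<Longrightarrow> a + b \<in> A" "a \<in> A \<Longrightarrow> b \<in> A \<Longrightarrow> a - b \<in> A"
    "a \<in> A \<Longrightarrow> b \<in> A \<Longrightarrow> a * b \<in> A"
  using assms by (auto simp: subring_of_def)

lemma subring_of_of_nat: "subring_of A \<Longrightarrow> of_nat n \<in> A"
  by (induction n) (auto simp: subring_of_def)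

lemma subring_of_sum: "subring_of A \<Longrightarrow> (\<And>i. i \<in> I \<Longrightarrow> f i \<in> A) \<Longrightarrow> sum f I \<in> A"
  by (induction I rule: infinite_finite_induct) (auto simp: subring_of_def)

lemma subring_of_polys_over:
  assumes A: "subring_of (A :: 'a::idom set)"
  shows "subring_of (polys_over A)"
  unfolding subring_of_def polys_over_def
  using subring_ofD[OF A]
  by (auto simp: coeff_mult coeff_pCons split: nat.splits intro!: subring_of_sum[OF A])

lemma polys_over_simps:
  fixes A :: "'a::idom set"
  assumes A: "subring_of A"
  shows "c \<in> A \<Longrightarrow> p \<in> polys_over A \<Longrightarrow> smult c p \<in> polys_over A"
    and "c \<in> A \<Longrightarrow> monom c n \<in> polys_over A"
    and "p \<in> polys_over A \<Longrightarrow> pderiv p \<in> polys_over A"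
    and "p \<in> polys_over A \<Longrightarrow> lead_coeff p \<in> A"
  using subring_ofD[OF A] subring_of_of_nat[OF A]
  by (auto simp: polys_over_def coeff_pderiv simp del: of_nat_Suc)

lemma pseudo_remainder_exists:
  fixes p q :: "'a::idom poly"
  assumes A: "subring_of A" and q: "q \<in> polys_over A" "degree q > 0"
    and p: "p \<in> polys_over A"
  shows "\<exists>t. t \<in> polys_over A \<and> degree t < degree q \<and> (\<exists>m s. smult (lead_coeff q ^ m) p = q * s + t)"
  using p
proof (induction "degree p" arbitrary: p rule: less_induct)
  case less
  show ?case
  proof (cases "degree p < degree q")
    case True
    have "smult (lead_coeff q ^ 0) p = q * 0 + p" by simp
    then have "\<exists>m s. smult (lead_coeff q ^ m) p = q * s + p" by (intro exI)
    then show ?thesis using True less.prems by (intro exI[of _ p] conjI)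
  next
    case False
    note P = subring_ofD[OF subring_of_polys_over[OF A]] polys_over_simps[OF A]
    define k where "k = degree p - degree q"
    have k: "degree p = k + degree q" using False by (simp add: k_def)
    define p1 where "p1 = smult (lead_coeff q) p - monom (lead_coeff p) k * q"
    have "degree (monom (lead_coeff p) k * q) \<le> degree p"
      using degree_mult_le[of "monom (lead_coeff p) k" q] degree_monom_le[of "lead_coeff p" k] k by linarith
    moreover have "degree (smult (lead_coeff q) p) \<le> degree p" by (rule degree_smult_le)
    ultimately have "degree p1 \<le> degree p" unfolding p1_def by (intro degree_diff_le)
    moreover have "coeff p1 (degree p) = 0"
    proof -
      have "coeff (monom (lead_coeff p) k * q) (k + degree q) = lead_coeff p * lead_coeff q"
        by (simp add: coeff_monom_mult)
      then show ?thesis unfolding p1_def using k by (simp add: mult.commute)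
    qed
    ultimately have "degree p1 < degree p"
      using eq_zero_or_degree_less[of p1 "degree p"] k q by auto
    moreover have "p1 \<in> polys_over A" unfolding p1_def using less.prems q by (intro P)
    ultimately obtain t m s where t: "t \<in> polys_over A" "degree t < degree q"
      "smult (lead_coeff q ^ m) p1 = q * s + t" using less.hyps by blast
    have "smult (lead_coeff q ^ Suc m) p = smult (lead_coeff q ^ m) (p1 + monom (lead_coeff p) k * q)"
      by (simp add: p1_def mult.commute)
    also have "\<dots> = q * (s + smult (lead_coeff q ^ m) (monom (lead_coeff p) k)) + t"
      by (simp only: smult_add_right t(3)) (simp add: ring_distribs mult.commute)
    finally have "\<exists>m s. smult (lead_coeff q ^ m) p = q * s + t" by (intro exI)
    then show ?thesis using t(1,2) by (intro exI[of _ t] conjI)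
  qed
qed

text \<open>
  Closing a finite set under operations that lower the degree of each operand adds finitely many elements:
  once all results of degree at least \<open>Suc m\<close> are present, one more round supplies all results of degree at
  least \<open>m\<close>, because a new element has degree at most \<open>m\<close> and operations on it only give degrees below \<open>m\<close>.
\<close>

lemma finite_graded_closure:
  fixes deg :: "'x \<Rightarrow> nat" and F :: "'x \<Rightarrow> 'x \<Rightarrow> 'x set"
  assumes F: "\<And>p q r. p \<in> V \<Longrightarrow> q \<in> V \<Longrightarrow> r \<in> F p q \<Longrightarrow> r \<in> V \<and> deg r < deg p \<and> deg r < deg q"
    and finF: "\<And>p q. finite (F p q)" and "finite Q" "Q \<subseteq> V"
  obtains C where "finite C" "Q \<subseteq> C" "C \<subseteq> V" "\<And>p q. p \<in> C \<Longrightarrow> q \<in> C \<Longrightarrow> F p q \<subseteq> C"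
proof -
  have claim: "\<exists>C. finite C \<and> Q \<subseteq> C \<and> C \<subseteq> V \<and> (\<forall>p\<in>C. \<forall>q\<in>C. F p q \<subseteq> C)"
    if "finite Q" "Q \<subseteq> V" "\<And>p q r. p \<in> Q \<Longrightarrow> q \<in> Q \<Longrightarrow> r \<in> F p q \<Longrightarrow> m \<le> deg r \<Longrightarrow> r \<in> Q" for m Q
    using that
  proof (induction m arbitrary: Q)
    case 0
    have "F p q \<subseteq> Q" if "p \<in> Q" "q \<in> Q" for p q using 0(3)[OF that] by blast
    then show ?case using 0(1,2) by (intro exI[of _ Q] conjI ballI) simp_all
  next
    case (Suc m)
    define R where "R = Q \<union> (\<Union>p\<in>Q. \<Union>q\<in>Q. F p q)"
    have low: "x \<in> Q \<or> deg x \<le> m" if "x \<in> R" for x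
    proof (cases "x \<in> Q")
      case False
      with that obtain p q where "p \<in> Q" "q \<in> Q" "x \<in> F p q" unfolding R_def by blast
      then have "\<not> Suc m \<le> deg x" using Suc.prems(3) False by blast
      then show ?thesis by simp
    qed simp
    have RV: "R \<subseteq> V" using Suc.prems(2) F unfolding R_def by blast
    have "\<exists>C. finite C \<and> R \<subseteq> C \<and> C \<subseteq> V \<and> (\<forall>p\<in>C. \<forall>q\<in>C. F p q \<subseteq> C)"
    proof (rule Suc.IH[OF _ RV])
      show "finite R" using Suc.prems(1) finF by (auto simp: R_def)
      fix p q r assume *: "p \<in> R" "q \<in> R" "r \<in> F p q" "m \<le> deg r"
      then have "deg r < deg p" "deg r < deg q" using F RV by blast+
      then have "p \<in> Q" "q \<in> Q" using low[OF *(1)] low[OF *(2)] *(4) by linarith+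
      then show "r \<in> R" using *(3) by (auto simp: R_def)
    qed
    then show ?case by (auto simp: R_def)
  qed
  have "\<exists>C. finite C \<and> Q \<subseteq> C \<and> C \<subseteq> V \<and> (\<forall>p\<in>C. \<forall>q\<in>C. F p q \<subseteq> C)"
  proof (rule claim[where m = "Max (insert 0 (deg ` Q))", OF \<open>finite Q\<close> \<open>Q \<subseteq> V\<close>])
    fix p q r assume *: "p \<in> Q" "q \<in> Q" "r \<in> F p q" "Max (insert 0 (deg ` Q)) \<le> deg r"
    then have "deg r < deg p" using F \<open>Q \<subseteq> V\<close> by blast
    also have "deg p \<le> Max (insert 0 (deg ` Q))" using *(1) \<open>finite Q\<close> by simp
    finally show "r \<in> Q" using *(4) by simp
  qed
  then show ?thesis using that by blast
qed

text \<open>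
  When the leading coefficient vanishes under a ring morphism, the polynomial may be replaced by its tail.
\<close>

definition tail_poly :: "'a::idom poly \<Rightarrow> 'a poly" where
  "tail_poly p = p - monom (lead_coeff p) (degree p)"

lemma degree_tail_poly:
  assumes "degree p > 0"
  shows "degree (tail_poly p) < degree p"
proof -
  have "degree (tail_poly p) \<le> degree p" unfolding tail_poly_def
    by (intro degree_diff_le) (auto intro: degree_monom_le)
  moreover have "coeff (tail_poly p) (degree p) = 0" by (simp add: tail_poly_def)
  ultimately show ?thesis using eq_zero_or_degree_less[of "tail_poly p" "degree p"] assms by auto
qed

lemma map_poly_tail:
  fixes \<phi> :: "'a::idom \<Rightarrow> 'b::idom"
  assumes "ring_morphism \<phi>" "\<phi> (lead_coeff p) = 0"
  shows "map_poly \<phi> (tail_poly p) = map_poly \<phi> p"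
proof (rule poly_eqI)
  show "coeff (map_poly \<phi> (tail_poly p)) n = coeff (map_poly \<phi> p) n" for n
    using assms by (cases "n = degree p") (simp_all add: map_poly_morphism tail_poly_def ring_morphism_simps)
qed

definition image_pairs :: "('d \<Rightarrow> 'a::zero) \<Rightarrow> ('d \<Rightarrow> 'b::zero) \<Rightarrow> 'd::zero poly set \<Rightarrow> ('a poly \<times> 'b poly) set" where
  "image_pairs \<phi> \<psi> B = (\<lambda>p. (map_poly \<phi> p, map_poly \<psi> p)) ` B"

text \<open>
  For \<open>matches_insert\<close> the sign of \<open>p\<close> at a root \<open>z\<close> of another polynomial \<open>q\<close> is needed. It is that of a
  pseudo-remainder \<open>t\<close> of \<open>p\<close> modulo \<open>q\<close>, because \<open>lead_coeff q ^ m * p\<close> and \<open>t\<close> agree at \<open>z\<close>; and \<open>t\<close> has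
  smaller degree, so its signs are matched already. This requires that the leading coefficient of \<open>q\<close> does
  not vanish under \<open>\<phi>\<close>, which is achieved by passing to tails.
\<close>

lemma matches_insert_image:
  fixes \<phi> :: "'d::idom \<Rightarrow> 'a::real_closed_field" and \<psi> :: "'d \<Rightarrow> 'b::real_closed_field"
  assumes \<phi>: "ring_morphism \<phi>" and \<psi>: "ring_morphism \<psi>" and fin: "finite B"
    and h: "matches (image_pairs \<phi> \<psi> B) h" and k: "matches (image_pairs \<psi> \<phi> B) k"
    and sg: "\<And>q. q \<in> insert p B \<Longrightarrow> isgn (\<phi> (lead_coeff q)) = isgn (\<psi> (lead_coeff q))"
    and tail: "\<And>q. q \<in> insert p B \<Longrightarrow> degree q > 0 \<Longrightarrow> tail_poly q \<in> B"
    and der: "degree p > 0 \<Longrightarrow> pderiv p \<in> B"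
    and rem: "\<And>q. q \<in> B \<Longrightarrow> degree q > 0 \<Longrightarrow> degree p > 0 \<Longrightarrow>
        \<exists>t\<in>B. \<exists>m s. smult (lead_coeff q ^ m) p = q * s + t"
  shows "\<exists>h. matches (image_pairs \<phi> \<psi> (insert p B)) h"
proof -
  have sg0: "\<phi> (lead_coeff q) = 0 \<longleftrightarrow> \<psi> (lead_coeff q) = 0" if "q \<in> insert p B" for q
    using sg[OF that] by (metis isgn_simps(4))
  consider "degree p = 0" | "degree p > 0" "\<phi> (lead_coeff p) = 0" | "degree p > 0" "\<phi> (lead_coeff p) \<noteq> 0"
    by blast
  then show ?thesis
  proof cases
    case 1
    then obtain c where c: "p = [:c:]" using degree_eq_zeroE by blast
    have "map_poly \<phi> p = [:\<phi> c:]" "map_poly \<psi> p = [:\<psi> c:]"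
      by (simp_all add: c map_poly_morphism \<phi> \<psi>)
    moreover have "isgn (\<phi> c) = isgn (\<psi> c)" using sg[of p] c by simp
    ultimately have "matches (image_pairs \<phi> \<psi> (insert p B)) h"
      using h by (auto simp: matches_def image_pairs_def)
    then show ?thesis by blast
  next
    case 2
    then have "(map_poly \<phi> p, map_poly \<psi> p) = (map_poly \<phi> (tail_poly p), map_poly \<psi> (tail_poly p))"
      using sg0[of p] by (simp add: map_poly_tail \<phi> \<psi>)
    also have "\<dots> \<in> image_pairs \<phi> \<psi> B" using tail[of p] 2 by (auto simp: image_pairs_def)
    finally have "image_pairs \<phi> \<psi> (insert p B) = image_pairs \<phi> \<psi> B"
      unfolding image_pairs_def by blast
    then show ?thesis using h by auto
  next
    case 3
    have proper: "\<exists>q'\<in>B. map_poly \<phi> q' = map_poly \<phi> q \<and> map_poly \<psi> q' = map_poly \<psi> q \<and> \<phi> (lead_coeff q') \<noteq> 0"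
      if "q \<in> B" "map_poly \<phi> q \<noteq> 0" for q
      using that
    proof (induction "degree q" arbitrary: q rule: less_induct)
      case less
      show ?case
      proof (cases "\<phi> (lead_coeff q) = 0")
        case True
        have "degree q > 0"
        proof (rule ccontr)
          assume "\<not> degree q > 0"
          then obtain c where "q = [:c:]" using degree_eq_zeroE by blast
          then have "map_poly \<phi> q = 0" using True by (simp add: map_poly_morphism \<phi>)
          then show False using less.prems by simp
        qed
        moreover have "map_poly \<phi> (tail_poly q) = map_poly \<phi> q" "map_poly \<psi> (tail_poly q) = map_poly \<psi> q"
          using True sg0[of q] less.prems by (simp_all add: map_poly_tail \<phi> \<psi>)
        ultimately show ?thesis
          using less.hyps[of "tail_poly q"] degree_tail_poly[of q] tail[of q] less.prems by auto
      qed (use less.prems in blast)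
    qed
    have ins: "image_pairs \<phi> \<psi> (insert p B) = insert (map_poly \<phi> p, map_poly \<psi> p) (image_pairs \<phi> \<psi> B)"
      by (simp add: image_pairs_def)
    show ?thesis unfolding ins
    proof (rule matches_insert)
      show "finite (image_pairs \<phi> \<psi> B)" using fin by (simp add: image_pairs_def)
      show "matches (image_pairs \<phi> \<psi> B) h" by (rule h)
      have "(image_pairs \<phi> \<psi> B)\<inverse> = image_pairs \<psi> \<phi> B" by (auto simp: image_pairs_def)
      then show "matches ((image_pairs \<phi> \<psi> B)\<inverse>) k" using k by simp
      show "(pderiv (map_poly \<phi> p), pderiv (map_poly \<psi> p)) \<in> image_pairs \<phi> \<psi> B"
        using der 3 by (auto simp: image_pairs_def map_poly_morphism[OF \<phi>, symmetric] map_poly_morphism[OF \<psi>, symmetric])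
      have "coeff (map_poly \<phi> p) (degree p) \<noteq> 0" using 3 by (simp add: map_poly_morphism \<phi>)
      then have "degree (map_poly \<phi> p) > 0" using le_degree 3(1) by (metis gr_zeroI le_zero_eq not_gr_zero)
      then show "pderiv (map_poly \<phi> p) \<noteq> 0" by (simp add: pderiv_eq_0_iff)
    next
      fix f g z
      assume fg: "(f, g) \<in> image_pairs \<phi> \<psi> B" and f0: "f \<noteq> 0" and fz: "poly f z = 0"
      then obtain q where q: "q \<in> B" "f = map_poly \<phi> q" "g = map_poly \<psi> q" "\<phi> (lead_coeff q) \<noteq> 0"
        using proper unfolding image_pairs_def by fastforce
      have gz: "poly g (h z) = 0" using matches_isgn[OF h fg, of z] fz by simp
      have "degree q > 0"
      proof (rule ccontr)
        assume "\<not> degree q > 0"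
        then obtain c where "q = [:c:]" using degree_eq_zeroE by blast
        then show False using q fz by (simp add: map_poly_morphism \<phi>)
      qed
      then obtain t m s where t: "t \<in> B" "smult (lead_coeff q ^ m) p = q * s + t" using rem q 3 by blast
      have eq: "smult (\<theta> (lead_coeff q) ^ m) (map_poly \<theta> p) = map_poly \<theta> q * map_poly \<theta> s + map_poly \<theta> t"
        if "ring_morphism \<theta>" for \<theta> :: "'d \<Rightarrow> 'c::idom"
        using arg_cong[OF t(2), of "map_poly \<theta>"] by (simp add: map_poly_morphism that ring_morphism_simps)
      have "\<phi> (lead_coeff q) ^ m * poly (map_poly \<phi> p) z = poly (map_poly \<phi> t) z"
        using arg_cong[OF eq[OF \<phi>], of "\<lambda>f. poly f z"] fz q by simp
      then have "isgn (\<phi> (lead_coeff q)) ^ m * isgn (poly (map_poly \<phi> p) z) = isgn (poly (map_poly \<phi> t) z)"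
        by (simp only: isgn_mult[symmetric] isgn_power[symmetric])
      also have "\<dots> = isgn (poly (map_poly \<psi> t) (h z))"
        using matches_isgn[OF h, of "map_poly \<phi> t" "map_poly \<psi> t"] t(1) by (simp add: image_pairs_def)
      also have "\<psi> (lead_coeff q) ^ m * poly (map_poly \<psi> p) (h z) = poly (map_poly \<psi> t) (h z)"
        using arg_cong[OF eq[OF \<psi>], of "\<lambda>f. poly f (h z)"] gz q by simp
      then have "isgn (poly (map_poly \<psi> t) (h z)) = isgn (\<psi> (lead_coeff q)) ^ m * isgn (poly (map_poly \<psi> p) (h z))"
        by (simp only: isgn_mult[symmetric] isgn_power[symmetric])
      also have "isgn (\<psi> (lead_coeff q)) = isgn (\<phi> (lead_coeff q))" using sg[of q] q by simp
      finally have "isgn (\<phi> (lead_coeff q)) ^ m * isgn (poly (map_poly \<phi> p) z) =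
          isgn (\<phi> (lead_coeff q)) ^ m * isgn (poly (map_poly \<psi> p) (h z))" .
      moreover have "isgn (\<phi> (lead_coeff q)) ^ m \<noteq> 0" using q(4) by simp
      ultimately show "isgn (poly (map_poly \<phi> p) z) = isgn (poly (map_poly \<psi> p) (h z))"
        using mult_left_cancel by blast
    qed
  qed
qed

text \<open>
  Close \<open>Q\<close> under tails, derivatives and pseudo-remainders, and let \<open>E\<close> be the set of leading coefficients. If
  \<open>\<phi>\<close> and \<open>\<psi>\<close> give them the same signs, the polynomials of the closure can be added one by one, ordered
  by degree, to a set with matching maps in both directions.
\<close>

theorem univariate_sign_transfer:
  fixes Q :: "'d::idom poly set"
  assumes A: "subring_of A" and "finite Q" "Q \<subseteq> polys_over A"
  obtains E where "finite E" "E \<subseteq> A"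
    "\<And>(\<phi> :: 'd \<Rightarrow> 'a::real_closed_field) (\<psi> :: 'd \<Rightarrow> 'b::real_closed_field) y.
       ring_morphism \<phi> \<Longrightarrow> ring_morphism \<psi> \<Longrightarrow> (\<And>e. e \<in> E \<Longrightarrow> isgn (\<phi> e) = isgn (\<psi> e)) \<Longrightarrow>
       \<exists>y'. \<forall>q\<in>Q. isgn (poly (map_poly \<phi> q) y) = isgn (poly (map_poly \<psi> q) y')"
proof -
  define V where "V = polys_over A"
  define rem where "rem p q = (SOME t. t \<in> V \<and> degree t < degree q \<and>
      (\<exists>m s. smult (lead_coeff q ^ m) p = q * s + t))" for p q
  have rem: "rem p q \<in> V \<and> degree (rem p q) < degree q \<and>
      (\<exists>m s. smult (lead_coeff q ^ m) p = q * s + rem p q)"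
    if "p \<in> V" "q \<in> V" "degree q > 0" for p q
    using someI_ex[OF pseudo_remainder_exists[OF A, of q p]] that unfolding rem_def V_def by simp
  define F where "F p q = (if p = q \<and> degree p > 0 then {tail_poly p, pderiv p} else {}) \<union>
      (if degree p \<ge> degree q \<and> degree q > 0 then {rem p q} else {})" for p q
  obtain C where C: "finite C" "Q \<subseteq> C" "C \<subseteq> V" "\<And>p q. p \<in> C \<Longrightarrow> q \<in> C \<Longrightarrow> F p q \<subseteq> C"
  proof (rule finite_graded_closure[of V F degree Q])
    show "finite (F p q)" for p q by (simp add: F_def)
    show "finite Q" "Q \<subseteq> V" using assms by (auto simp: V_def)
    fix p q r assume *: "p \<in> V" "q \<in> V" "r \<in> F p q"
    have "tail_poly p \<in> V" "pderiv p \<in> V"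
      unfolding tail_poly_def V_def using *(1)
      by (auto simp: V_def intro!: polys_over_simps[OF A] subring_ofD[OF subring_of_polys_over[OF A]])
    moreover have "degree (tail_poly p) < degree p" "degree (pderiv p) < degree p" if "degree p > 0"
    proof -
      show "degree (tail_poly p) < degree p" using degree_tail_poly that by blast
      have "degree (pderiv p) \<le> degree p - 1"
        by (rule degree_le) (auto simp: coeff_pderiv coeff_eq_0)
      then show "degree (pderiv p) < degree p" using that by simp
    qed
    moreover have "rem p q \<in> V \<and> degree (rem p q) < degree q" if "degree q > 0"
      using rem[OF *(1,2) that] by blast
    ultimately show "r \<in> V \<and> degree r < degree p \<and> degree r < degree q"
      using *(3) by (auto simp: F_def split: if_splits)
  qed (rule that)
  define E where "E = lead_coeff ` C"
  have "\<exists>y'. \<forall>q\<in>Q. isgn (poly (map_poly \<phi> q) y) = isgn (poly (map_poly \<psi> q) y')"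
    if \<phi>: "ring_morphism \<phi>" and \<psi>: "ring_morphism \<psi>" and sg: "\<And>e. e \<in> E \<Longrightarrow> isgn (\<phi> e) = isgn (\<psi> e)"
    for \<phi> :: "'d \<Rightarrow> 'a" and \<psi> :: "'d \<Rightarrow> 'b" and y
  proof -
    define good where "good B \<longleftrightarrow> (\<exists>h. matches (image_pairs \<phi> \<psi> B) h) \<and> (\<exists>k. matches (image_pairs \<psi> \<phi> B) k)" for B
    define L where "L n = {p \<in> C. degree p < n}" for n
    have step: "good (insert p (L n \<union> B))" if B: "B \<subseteq> C" "B \<subseteq> {p. degree p = n}"
      and p: "p \<in> C" "degree p = n" and g: "good (L n \<union> B)" for n p B
    proof -
      have fin: "finite (L n \<union> B)" using B C(1) by (auto simp: L_def intro: finite_subset)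
      have sub: "insert p (L n \<union> B) \<subseteq> C" using B p by (auto simp: L_def)
      have sgE: "isgn (\<phi> (lead_coeff q)) = isgn (\<psi> (lead_coeff q))" if "q \<in> insert p (L n \<union> B)" for q
        using that sub by (intro sg) (auto simp: E_def)
      have deg: "degree q \<le> n" if "q \<in> insert p (L n \<union> B)" for q
        using that B p by (auto simp: L_def)
      have tail: "tail_poly q \<in> L n \<union> B" if "q \<in> insert p (L n \<union> B)" "degree q > 0" for q
        using C(4)[of q q] sub that degree_tail_poly[of q] deg[of q] by (auto simp: F_def L_def)
      have der: "pderiv p \<in> L n \<union> B" if "degree p > 0"
      proof -
        have "degree (pderiv p) \<le> degree p - 1"
          by (rule degree_le) (auto simp: coeff_pderiv coeff_eq_0)
        then show ?thesis using C(4)[of p p] p that by (auto simp: F_def L_def)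
      qed
      have rm: "\<exists>t\<in>L n \<union> B. \<exists>m s. smult (lead_coeff q ^ m) p = q * s + t"
        if "q \<in> L n \<union> B" "degree q > 0" "degree p > 0" for q
      proof -
        have "q \<in> C" "p \<in> V" "q \<in> V" using that sub C(3) p by auto
        then have "rem p q \<in> C" using C(4)[of p q] p deg[of q] that by (auto simp: F_def)
        moreover have "degree (rem p q) < degree q" using rem[OF \<open>p \<in> V\<close> \<open>q \<in> V\<close> that(2)] by blast
        moreover have "degree q \<le> n" using deg that by blast
        ultimately have "rem p q \<in> L n" by (simp add: L_def)
        then show ?thesis using rem[OF \<open>p \<in> V\<close> \<open>q \<in> V\<close> that(2)] by blast
      qed
      from g obtain h k where hk: "matches (image_pairs \<phi> \<psi> (L n \<union> B)) h" "matches (image_pairs \<psi> \<phi> (L n \<union> B)) k"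
        unfolding good_def by blast
      have "\<exists>h. matches (image_pairs \<phi> \<psi> (insert p (L n \<union> B))) h"
        by (rule matches_insert_image[OF \<phi> \<psi> fin hk]) (fact sgE tail der rm)+
      moreover have "\<exists>k. matches (image_pairs \<psi> \<phi> (insert p (L n \<union> B))) k"
        by (rule matches_insert_image[OF \<psi> \<phi> fin hk(2,1)]) (fact sgE[symmetric] tail der rm)+
      ultimately show ?thesis unfolding good_def ..
    qed
    have "good (L n)" for n
    proof (induction n)
      case 0
      have "matches {} (\<lambda>_. 0 :: 'b)" "matches {} (\<lambda>_. 0 :: 'a)" by (auto simp: matches_def mono_def)
      then show ?case by (auto simp: good_def L_def image_pairs_def)
    next
      case (Suc n)
      have "good (L n \<union> B)" if "finite B" "B \<subseteq> {p \<in> C. degree p = n}" for B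
        using that
      proof (induction B rule: finite_induct)
        case empty
        then show ?case using Suc by simp
      next
        case (insert p B)
        then show ?case using step[of B n p] by auto
      qed
      moreover have "L (Suc n) = L n \<union> {p \<in> C. degree p = n}" by (auto simp: L_def)
      ultimately show ?case using C(1) by simp
    qed
    moreover have "L (Suc (Max (insert 0 (degree ` C)))) = C"
      using C(1) by (auto simp: L_def le_imp_less_Suc)
    ultimately have "good C" by metis
    then obtain h where h: "matches (image_pairs \<phi> \<psi> C) h" unfolding good_def by blast
    have "isgn (poly (map_poly \<phi> q) y) = isgn (poly (map_poly \<psi> q) (h y))" if "q \<in> Q" for q
      using that C(2) by (intro matches_isgn[OF h]) (auto simp: image_pairs_def)
    then show ?thesis by blast
  qed
  moreover have "finite E" "E \<subseteq> A"
    using C polys_over_simps(4)[OF A] by (auto simp: E_def V_def)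
  ultimately show ?thesis using that by blast
qed

section \<open>The real closure of an ordered field\<close>

text \<open>
  An ordered field \<open>'a\<close> is extended inside its algebraic closure to a subfield with a maximal order. That
  subfield together with its order is encoded by the single set \<open>C\<close> of its nonnegative elements: the
  subfield is \<open>C \<union> -C\<close>, and \<open>x \<le> y\<close> means \<open>y - x \<in> C\<close>.
\<close>

definition field_cone :: "'k::field set \<Rightarrow> bool" where
  "field_cone C \<longleftrightarrow> 1 \<in> C \<and>
     (\<forall>a\<in>C. \<forall>b\<in>C. a + b \<in> C \<and> a * b \<in> C \<and> (a - b \<in> C \<or> b - a \<in> C)) \<and>
     (\<forall>a\<in>C. inverse a \<in> C \<and> (-a \<in> C \<longrightarrow> a = 0))"

lemma field_coneD:
  assumes "field_cone C"
  shows "1 \<in> C" "a \<in> C \<Longrightarrow> b \<in> C \<Longrightarrow> a + b \<in> C" "a \<in> C \<Longrightarrow> b \<in> C \<Longrightarrow> a * b \<in> C"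
    "a \<in> C \<Longrightarrow> b \<in> C \<Longrightarrow> a - b \<in> C \<or> b - a \<in> C" "a \<in> C \<Longrightarrow> inverse a \<in> C"
    "a \<in> C \<Longrightarrow> -a \<in> C \<Longrightarrow> a = 0"
  using assms unfolding field_cone_def by blast+

lemma field_cone_0: "field_cone C \<Longrightarrow> 0 \<in> C"
  using field_coneD(4)[of C 1 1] field_coneD(1)[of C] by simp

lemma field_cone_to_ac: "field_cone (to_ac ` {0::'a::linordered_field..})"
  unfolding field_cone_def
proof (intro conjI ballI)
  show "1 \<in> to_ac ` {0::'a..}" by (rule image_eqI[of _ _ 1]) auto
next
  fix a b :: "'a alg_closure"
  assume "a \<in> to_ac ` {0..}" "b \<in> to_ac ` {0..}"
  then obtain x y where xy: "a = to_ac x" "b = to_ac y" "x \<ge> 0" "y \<ge> 0" by auto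
  show "a + b \<in> to_ac ` {0..}" using xy by (intro image_eqI[of _ _ "x + y"]) auto
  show "a * b \<in> to_ac ` {0..}" using xy by (intro image_eqI[of _ _ "x * y"]) auto
  show "a - b \<in> to_ac ` {0..} \<or> b - a \<in> to_ac ` {0..}"
    using xy linear[of x y] by (auto simp flip: to_ac_diff)
next
  fix a :: "'a alg_closure"
  assume "a \<in> to_ac ` {0..}"
  then obtain x where x: "a = to_ac x" "x \<ge> 0" by auto
  show "inverse a \<in> to_ac ` {0..}" using x by (intro image_eqI[of _ _ "inverse x"]) auto
  show "-a \<in> to_ac ` {0..} \<longrightarrow> a = 0" using x by (auto simp flip: to_ac_minus)
qed

lemma maximal_field_cone_exists:
  assumes "field_cone (B :: 'k::field set)"
  shows "\<exists>C. field_cone C \<and> B \<subseteq> C \<and> (\<forall>D. field_cone D \<longrightarrow> C \<subseteq> D \<longrightarrow> D = C)"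
proof -
  define F where "F = {C. field_cone C \<and> B \<subseteq> C}"
  have "\<Union>Ch \<in> F" if "Ch \<noteq> {}" and Ch: "subset.chain F Ch" for Ch
  proof -
    have CF: "\<And>Z. Z \<in> Ch \<Longrightarrow> field_cone Z \<and> B \<subseteq> Z"
      and tot: "\<And>Y Z. Y \<in> Ch \<Longrightarrow> Z \<in> Ch \<Longrightarrow> Y \<subseteq> Z \<or> Z \<subseteq> Y"
      using Ch unfolding subset_chain_def F_def by blast+
    have common: "\<exists>Z\<in>Ch. field_cone Z \<and> a \<in> Z \<and> b \<in> Z" if "a \<in> \<Union>Ch" "b \<in> \<Union>Ch" for a b
    proof -
      from that obtain Y Z where "Y \<in> Ch" "a \<in> Y" "Z \<in> Ch" "b \<in> Z" by blast
      then show ?thesis using tot[of Y Z] CF[of Y] CF[of Z] by blast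
    qed
    have "field_cone (\<Union>Ch)"
      unfolding field_cone_def
    proof (intro conjI ballI impI)
      show "1 \<in> \<Union>Ch" using \<open>Ch \<noteq> {}\<close> CF field_coneD(1) by blast
    next
      fix a b assume "a \<in> \<Union>Ch" "b \<in> \<Union>Ch"
      then obtain Z where "Z \<in> Ch" "field_cone Z" "a \<in> Z" "b \<in> Z" using common by blast
      then show "a + b \<in> \<Union>Ch" "a * b \<in> \<Union>Ch" "a - b \<in> \<Union>Ch \<or> b - a \<in> \<Union>Ch"
        using field_coneD(2-4)[of Z a b] by blast+
    next
      fix a assume a: "a \<in> \<Union>Ch"
      then show "inverse a \<in> \<Union>Ch" using CF field_coneD(5) by blast
      assume "-a \<in> \<Union>Ch"
      then show "a = 0" using common[OF a] field_coneD(6) by blast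
    qed
    then show ?thesis using CF \<open>Ch \<noteq> {}\<close> unfolding F_def by blast
  qed
  moreover have "F \<noteq> {}" using assms by (auto simp: F_def)
  ultimately obtain C where "C \<in> F" and max: "\<forall>Z\<in>F. C \<subseteq> Z \<longrightarrow> Z = C"
    using subset_Zorn_nonempty[of F] by blast
  have "D = C" if "field_cone D" "C \<subseteq> D" for D
    using that max \<open>C \<in> F\<close> unfolding F_def by blast
  then show ?thesis using \<open>C \<in> F\<close> unfolding F_def by blast
qed

definition closure_cone :: "'a::linordered_field alg_closure set" where
  "closure_cone = (SOME C. field_cone C \<and> to_ac ` {0..} \<subseteq> C \<and> (\<forall>D. field_cone D \<longrightarrow> C \<subseteq> D \<longrightarrow> D = C))"

lemma closure_cone:
  shows field_cone_closure_cone: "field_cone (closure_cone :: 'a::linordered_field alg_closure set)"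
    and to_ac_in_closure_cone: "0 \<le> x \<Longrightarrow> to_ac (x :: 'a) \<in> closure_cone"
    and closure_cone_maximal: "field_cone D \<Longrightarrow> closure_cone \<subseteq> D \<Longrightarrow> D = (closure_cone :: 'a alg_closure set)"
  using someI_ex[OF maximal_field_cone_exists[OF field_cone_to_ac[where 'a='a]]]
  unfolding closure_cone_def[symmetric] by blast+

lemmas closure_cone_rules = field_coneD[OF field_cone_closure_cone] field_cone_0[OF field_cone_closure_cone]

typedef (overloaded) 'a real_closure =
  "{x :: 'a::linordered_field alg_closure. x \<in> closure_cone \<or> -x \<in> closure_cone}"
  using closure_cone_rules(1) by blast

setup_lifting type_definition_real_closure

lemma closure_carrier:
  fixes x y :: "'a::linordered_field alg_closure"
  assumes "x \<in> closure_cone \<or> -x \<in> closure_cone" "y \<in> closure_cone \<or> -y \<in> closure_cone"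
  shows "x + y \<in> closure_cone \<or> -(x + y) \<in> closure_cone"
    and "x * y \<in> closure_cone \<or> -(x * y) \<in> closure_cone"
    and "x - y \<in> closure_cone \<or> -(x - y) \<in> closure_cone"
    and "inverse x \<in> closure_cone \<or> - inverse x \<in> closure_cone"
proof -
  have sum: "x + y \<in> closure_cone \<or> -(x + y) \<in> closure_cone"
    if "x \<in> closure_cone \<or> -x \<in> closure_cone" "y \<in> closure_cone \<or> -y \<in> closure_cone"
    for x y :: "'a alg_closure"
  proof -
    have eqs: "x - (- y) = x + y" "- y - x = - (x + y)" "- x - y = - (x + y)" "y - (- x) = x + y" "- x + - y = - (x + y)"
      by simp_all
    show ?thesis
      using that closure_cone_rules(2)[of x y] closure_cone_rules(4)[of x "-y"] closure_cone_rules(4)[of "-x" y] closure_cone_rules(2)[of "-x" "-y"]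
      unfolding eqs by blast
  qed
  show "x + y \<in> closure_cone \<or> -(x + y) \<in> closure_cone" using sum assms by blast
  show "x - y \<in> closure_cone \<or> -(x - y) \<in> closure_cone" using sum[of x "-y"] assms by auto
  show "x * y \<in> closure_cone \<or> -(x * y) \<in> closure_cone"
    using assms closure_cone_rules(3)[of x y] closure_cone_rules(3)[of x "-y"] closure_cone_rules(3)[of "-x" y] closure_cone_rules(3)[of "-x" "-y"] by auto
  show "inverse x \<in> closure_cone \<or> - inverse x \<in> closure_cone"
    using assms closure_cone_rules(5)[of x] closure_cone_rules(5)[of "-x"] by (auto simp: inverse_minus_eq)
qed

instantiation real_closure :: (linordered_field) linordered_field
begin

lift_definition zero_real_closure :: "'a real_closure" is 0 by (simp add: closure_cone_rules(7))
lift_definition one_real_closure :: "'a real_closure" is 1 by (simp add: closure_cone_rules(1))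
lift_definition plus_real_closure :: "'a real_closure \<Rightarrow> 'a real_closure \<Rightarrow> 'a real_closure" is "(+)"
  by (rule closure_carrier(1))
lift_definition minus_real_closure :: "'a real_closure \<Rightarrow> 'a real_closure \<Rightarrow> 'a real_closure" is "(-)"
  by (rule closure_carrier(3))
lift_definition uminus_real_closure :: "'a real_closure \<Rightarrow> 'a real_closure" is uminus
  by auto
lift_definition times_real_closure :: "'a real_closure \<Rightarrow> 'a real_closure \<Rightarrow> 'a real_closure" is "(*)"
  by (rule closure_carrier(2))
lift_definition inverse_real_closure :: "'a real_closure \<Rightarrow> 'a real_closure" is inverse
  by (rule closure_carrier(4))
lift_definition less_eq_real_closure :: "'a real_closure \<Rightarrow> 'a real_closure \<Rightarrow> bool"
  is "\<lambda>x y. y - x \<in> closure_cone" .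
definition less_real_closure :: "'a real_closure \<Rightarrow> 'a real_closure \<Rightarrow> bool" where
  "less_real_closure x y \<longleftrightarrow> x \<le> y \<and> \<not> y \<le> x"
definition divide_real_closure :: "'a real_closure \<Rightarrow> 'a real_closure \<Rightarrow> 'a real_closure" where
  "divide_real_closure x y = x * inverse y"
definition abs_real_closure :: "'a real_closure \<Rightarrow> 'a real_closure" where
  "abs_real_closure x = (if x < 0 then - x else x)"
definition sgn_real_closure :: "'a real_closure \<Rightarrow> 'a real_closure" where
  "sgn_real_closure x = (if x = 0 then 0 else if 0 < x then 1 else - 1)"

instance
proof
  fix x y z :: "'a real_closure"
  show "x + y + z = x + (y + z)" "x + y = y + x" "0 + x = x" "x * y * z = x * (y * z)" "x * y = y * x"
    "1 * x = x" "(x + y) * z = x * z + y * z" "x + y - x = y" "x - y - z = x - (y + z)" "0 * x = 0" "x * 0 = 0"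
    by (transfer; simp add: algebra_simps)+
  show "(0::'a real_closure) \<noteq> 1" by transfer simp
  show "- x + x = 0" "x - y = x + - y" by (transfer; simp)+
  show "x \<noteq> 0 \<Longrightarrow> inverse x * x = 1" by transfer simp
  show "x div y = x * inverse y" by (rule divide_real_closure_def)
  show "inverse (0 :: 'a real_closure) = 0" by transfer simp
  show "x < y \<longleftrightarrow> x \<le> y \<and> \<not> y \<le> x" by (rule less_real_closure_def)
  show "x \<le> x" by transfer (simp add: closure_cone_rules(7))
  show "x \<le> z" if "x \<le> y" "y \<le> z"
    using that by transfer (metis (no_types, lifting) closure_cone_rules(2) diff_add_cancel add_diff_eq add.commute)
  have antisym: "x = y" if "x \<le> y" "y \<le> x" for x y :: "'a real_closure"
    using that by transfer (metis closure_cone_rules(6) minus_diff_eq eq_iff_diff_eq_0)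
  then show "x \<le> y \<Longrightarrow> y \<le> x \<Longrightarrow> x = y" .
  show "x \<le> y \<or> y \<le> x"
    by transfer (metis closure_carrier(3) minus_diff_eq)
  show "z + x \<le> z + y" if "x \<le> y" using that by transfer simp
  show "z * x < z * y" if "x < y" "0 < z"
  proof -
    have "x \<le> y" "x \<noteq> y" "0 \<le> z" "z \<noteq> 0" using that antisym[of x y] by (auto simp: less_real_closure_def)
    then have "z * x \<le> z * y" "z * x \<noteq> z * y"
      by (transfer; simp add: closure_cone_rules(3) flip: right_diff_distrib)+
    then show ?thesis using antisym by (auto simp: less_real_closure_def)
  qed
  show "\<bar>x\<bar> = (if x < 0 then - x else x)" by (rule abs_real_closure_def)
  show "sgn x = (if x = 0 then 0 else if 0 < x then 1 else - 1)" by (rule sgn_real_closure_def)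
qed
end

definition of_base :: "'a::linordered_field \<Rightarrow> 'a real_closure" where
  "of_base x = Abs_real_closure (to_ac x)"

lemma Rep_of_base: "Rep_real_closure (of_base x) = to_ac x"
proof -
  have "to_ac x \<in> closure_cone \<or> - to_ac x \<in> closure_cone"
    using to_ac_in_closure_cone[of x] to_ac_in_closure_cone[of "-x"] by (cases "x \<ge> 0") auto
  then show ?thesis by (simp add: of_base_def Abs_real_closure_inverse)
qed

lemma ring_morphism_of_base: "ring_morphism of_base"
  unfolding ring_morphism_def
  by (auto simp flip: Rep_real_closure_inject
      simp: Rep_of_base plus_real_closure.rep_eq times_real_closure.rep_eq one_real_closure.rep_eq)

lemma of_base_nonneg: "0 \<le> x \<Longrightarrow> 0 \<le> of_base x"
  by (simp add: less_eq_real_closure.rep_eq Rep_of_base zero_real_closure.rep_eq to_ac_in_closure_cone)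

lemma ring_morphism_Rep: "ring_morphism Rep_real_closure"
  by (simp add: ring_morphism_def plus_real_closure.rep_eq times_real_closure.rep_eq one_real_closure.rep_eq)

text \<open>
  Sums of squares of polynomials with nonnegative weights from the ground field. They are nonnegative
  in every order that extends the one of the ground field.
\<close>

inductive_set weighted_squares :: "'r::linordered_field poly set" where
  zero: "0 \<in> weighted_squares"
| add_square: "c \<ge> 0 \<Longrightarrow> p \<in> weighted_squares \<Longrightarrow> p + smult c (h^2) \<in> weighted_squares"

lemma weighted_squares_add:
  assumes "p \<in> weighted_squares" "q \<in> weighted_squares"
  shows "p + q \<in> weighted_squares"
  using assms(2,1)
  by induction (auto simp: add.assoc[symmetric] intro: weighted_squares.intros)

lemma weighted_squares_single: "c \<ge> 0 \<Longrightarrow> smult c (h^2) \<in> weighted_squares"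
  using weighted_squares.add_square[OF _ weighted_squares.zero, of c h] by simp

lemma weighted_squares_mult:
  assumes "p \<in> weighted_squares" "q \<in> weighted_squares"
  shows "p * q \<in> weighted_squares"
  using assms(2)
proof induction
  case zero
  then show ?case by (simp add: weighted_squares.zero)
next
  case (add_square c q h)
  have "p * smult c (h^2) \<in> weighted_squares" using assms(1)
  proof induction
    case zero
    then show ?case by (simp add: weighted_squares.zero)
  next
    case (add_square d p k)
    have "(p + smult d (k^2)) * smult c (h^2) = p * smult c (h^2) + smult (d * c) ((k * h)^2)"
      by (simp add: algebra_simps power_mult_distrib)
    then show ?case using add_square \<open>c \<ge> 0\<close> by (auto intro!: weighted_squares.add_square)
  qed
  then show ?case using add_square weighted_squares_add by (simp add: distrib_left)
qed

lemma weighted_squares_nonneg: "p \<in> weighted_squares \<Longrightarrow> 0 \<le> poly p x"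
  by (induction rule: weighted_squares.induct) simp_all

text \<open>
  Reducing the squared polynomials modulo \<open>f\<close> bounds the degree by \<open>2 * degree f - 2\<close>. In a relation \<open>1 + p' = f * q\<close>
  the cofactor \<open>q\<close> then has smaller degree than \<open>f\<close>, which drives the induction below.
\<close>

lemma weighted_squares_reduce:
  fixes f :: "'r::linordered_field poly"
  assumes "degree f > 0" "p \<in> weighted_squares"
  shows "\<exists>p'\<in>weighted_squares. f dvd p - p' \<and> degree p' \<le> 2 * (degree f - 1)"
  using assms(2)
proof induction
  case zero
  then show ?case by (intro bexI[of _ 0]) (auto intro: weighted_squares.zero)
next
  case (add_square c p h)
  then obtain p' where p': "p' \<in> weighted_squares" "f dvd p - p'" "degree p' \<le> 2 * (degree f - 1)" by blast
  have "f \<noteq> 0" using assms(1) by auto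
  then have "degree (h mod f) \<le> degree f - 1"
    using degree_mod_less[of f h] assms(1) by (cases "h mod f = 0") auto
  then have "degree (smult c ((h mod f)^2)) \<le> 2 * (degree f - 1)"
    using degree_power_le[of "h mod f" 2] degree_smult_le[of c "(h mod f)^2"] by linarith
  then have "degree (p' + smult c ((h mod f)^2)) \<le> 2 * (degree f - 1)"
    using p'(3) by (rule degree_add_le[rotated])
  moreover have "f dvd h^2 - (h mod f)^2"
    by (simp add: power2_eq_square square_diff_square_factored dvd_minus_mod)
  then have "f dvd (p - p') + smult c (h^2 - (h mod f)^2)" using p'(2) by (intro dvd_add dvd_smult)
  then have "f dvd (p + smult c (h^2)) - (p' + smult c ((h mod f)^2))"
    by (simp add: smult_diff_right algebra_simps)
  ultimately show ?case using p'(1) add_square(1) weighted_squares.add_square by blast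
qed

lemma poly_irreducible_bezout:
  fixes f g :: "'r::field poly"
  assumes "f \<noteq> 0" and irr: "\<And>q r. f = q * r \<Longrightarrow> degree q = 0 \<or> degree r = 0" and ndvd: "\<not> f dvd g"
  obtains u v where "u * f + v * g = 1"
proof -
  define J where "J = {u * f + v * g | u v. True}"
  have J_mult: "x * p \<in> J" if "p \<in> J" for x p
  proof -
    from that obtain u v where "p = u * f + v * g" unfolding J_def by blast
    then have "x * p = (x * u) * f + (x * v) * g" by (simp add: algebra_simps)
    then show ?thesis unfolding J_def by blast
  qed
  have J_diff: "p - q \<in> J" if "p \<in> J" "q \<in> J" for p q
  proof -
    from that obtain u v u' v' where "p = u * f + v * g" "q = u' * f + v' * g" unfolding J_def by blast
    then have "p - q = (u - u') * f + (v - v') * g" by (simp add: algebra_simps)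
    then show ?thesis unfolding J_def by blast
  qed
  have "f = 1 * f + 0 * g" "g = 0 * f + 1 * g" by simp_all
  then have fg: "f \<in> J" "g \<in> J" unfolding J_def by blast+
  have "g \<noteq> 0" using ndvd by auto
  then obtain r where r: "r \<in> J" "r \<noteq> 0" and min: "\<And>p. p \<in> J \<Longrightarrow> p \<noteq> 0 \<Longrightarrow> degree r \<le> degree p"
    using ex_has_least_nat[of "\<lambda>p. p \<in> J \<and> p \<noteq> 0" g degree] fg by blast
  have dvd: "r dvd p" if "p \<in> J" for p
  proof -
    have "p mod r = p - (p div r) * r" by (simp add: minus_div_mult_eq_mod)
    then have "p mod r \<in> J" using J_diff[OF that J_mult[OF r(1)]] by simp
    then have "p mod r = 0" using min degree_mod_less[OF r(2), of p] by (meson linorder_not_le)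
    then show ?thesis by (simp add: mod_eq_0_iff_dvd)
  qed
  then obtain s where s: "f = r * s" using fg by (auto elim: dvdE)
  have "degree r = 0"
  proof (rule ccontr)
    assume "degree r \<noteq> 0"
    then have "degree s = 0" using irr[OF s] by simp
    then obtain c where c: "s = [:c:]" by (rule degree_eq_zeroE)
    then have "c \<noteq> 0" using s \<open>f \<noteq> 0\<close> by auto
    then have "f dvd g" using s c dvd[OF fg(2)] by (simp add: smult_dvd_iff)
    then show False using ndvd by simp
  qed
  then obtain c where c: "r = [:c:]" by (rule degree_eq_zeroE)
  then have "c \<noteq> 0" using r by auto
  have "[:inverse c:] * r = 1" using c \<open>c \<noteq> 0\<close> by (simp add: one_pCons)
  then have "1 \<in> J" using J_mult[OF r(1), of "[:inverse c:]"] by simp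
  then obtain u v where "1 = u * f + v * g" unfolding J_def by blast
  then show ?thesis using that[of u v] by simp
qed


lemma closure_cone_eq: "closure_cone = Rep_real_closure ` {0::'a::linordered_field real_closure..}"
proof (intro equalityI subsetI)
  fix x :: "'a alg_closure" assume x: "x \<in> closure_cone"
  then have "Rep_real_closure (Abs_real_closure x) = x" by (simp add: Abs_real_closure_inverse)
  then show "x \<in> Rep_real_closure ` {0..}"
    using x by (intro image_eqI[of _ _ "Abs_real_closure x"]) (auto simp: less_eq_real_closure.rep_eq zero_real_closure.rep_eq)
qed (auto simp: less_eq_real_closure.rep_eq zero_real_closure.rep_eq)

text \<open>
  Induction on the degree. A polynomial \<open>f\<close> that changes sign without a root between \<open>a\<close> and \<open>b\<close> is irreducible,
  as one of two proper factors would change sign and have a root; hence it has no root at all in the real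
  closure, and a root \<open>w\<close> in the algebraic closure generates a proper extension. This extension can
  be ordered: otherwise \<open>1 + p' = f * q'\<close> for some weighted sum of squares \<open>p'\<close> of degree less than
  \<open>2 * degree f - 1\<close>. The left-hand side is positive everywhere, so \<open>q'\<close> changes sign together with \<open>f\<close>; having smaller
  degree it has a root, where the left-hand side would vanish. But an ordered proper extension
  contradicts the maximality of the order.
\<close>

lemma real_closure_sign_change_root:
  fixes f :: "'a::linordered_field real_closure poly"
  assumes "a < b" "poly f a * poly f b < 0"
  shows "\<exists>x. a < x \<and> x < b \<and> poly f x = 0"
  using assms(2)
proof (induction "degree f" arbitrary: f rule: less_induct)
  case less
  show ?case
  proof (rule ccontr)
    assume no_root: "\<not> ?case"
    have "f \<noteq> 0" using less.prems by auto
    have irr: "degree q = 0 \<or> degree r = 0" if qr: "f = q * r" for q r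
    proof (rule ccontr)
      assume nz: "\<not> (degree q = 0 \<or> degree r = 0)"
      have "q \<noteq> 0" "r \<noteq> 0" using qr \<open>f \<noteq> 0\<close> by auto
      then have "degree q < degree f" "degree r < degree f" using nz qr by (auto simp: degree_mult_eq)
      moreover have "(poly q a * poly q b) * (poly r a * poly r b) < 0"
        using less.prems qr by (simp add: ac_simps)
      then have "poly q a * poly q b < 0 \<or> poly r a * poly r b < 0"
        by (meson linorder_not_less zero_le_mult_iff)
      ultimately have "(\<exists>x>a. x < b \<and> poly q x = 0) \<or> (\<exists>x>a. x < b \<and> poly r x = 0)"
        using less.hyps by blast
      then show False using no_root qr by auto
    qed
    have "degree f > 0"
    proof (rule ccontr)
      assume "\<not> degree f > 0"
      then obtain c where "f = [:c:]" using degree_eq_zeroE by blast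
      then show False using less.prems by (simp add: not_less[symmetric])
    qed
    have no_root': "poly f \<rho> \<noteq> 0" for \<rho>
    proof
      assume \<rho>: "poly f \<rho> = 0"
      then obtain q where q: "f = [:-\<rho>, 1:] * q" by (auto simp: poly_eq_0_iff_dvd elim: dvdE)
      then have "degree q = 0" using irr[OF q] by simp
      then obtain c where "q = [:c:]" by (rule degree_eq_zeroE)
      then have "(c * c) * ((a - \<rho>) * (b - \<rho>)) < 0" using less.prems q by (simp add: algebra_simps)
      then have "(a - \<rho>) * (b - \<rho>) < 0" by (simp add: mult_less_0_iff not_less[symmetric])
      then have "a < \<rho>" "\<rho> < b" using \<open>a < b\<close> by (auto simp: mult_less_0_iff)
      then show False using no_root \<rho> by blast
    qed
    let ?\<iota> = "Rep_real_closure :: 'a real_closure \<Rightarrow> _"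
    note \<iota> = ring_morphism_Rep[where 'a='a]
    have "coeff (map_poly ?\<iota> f) (degree f) \<noteq> 0"
      using \<open>f \<noteq> 0\<close> by (simp add: map_poly_morphism(1)[OF \<iota>] Rep_real_closure_inject flip: zero_real_closure.rep_eq)
    then have "degree (map_poly ?\<iota> f) > 0" using le_degree \<open>degree f > 0\<close> by (metis less_le_trans)
    then obtain w where w: "poly (map_poly ?\<iota> f) w = 0" using alg_closed_imp_poly_has_root by blast
    define ev where "ev p = poly (map_poly ?\<iota> p) w" for p
    have ev: "ring_morphism ev"
      by (simp add: ring_morphism_def ev_def map_poly_morphism[OF \<iota>] one_pCons ring_morphism_simps[OF \<iota>])
    note ev_simps = ring_morphism_simps[OF ev]
    have ev_f: "ev f = 0" by (simp add: ev_def w)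
    \<comment> \<open>Orders of the extension generated by \<open>w\<close> are prime cones of the polynomial ring that contain \<open>T\<close>.\<close>
    define T where "T = {p + f * q | p q. p \<in> weighted_squares}"
    have T: "ring_preordering T"
      unfolding ring_preordering_def
    proof (intro conjI allI ballI)
      fix p have "p^2 = smult 1 (p^2) + f * 0" by simp
      then show "p^2 \<in> T" unfolding T_def using weighted_squares_single[of 1 p] zero_le_one by blast
    next
      fix x y assume "x \<in> T" "y \<in> T"
      then obtain p q p' q' where *: "x = p + f * q" "y = p' + f * q'" "p \<in> weighted_squares" "p' \<in> weighted_squares"
        unfolding T_def by blast
      have "x + y = (p + p') + f * (q + q')" "x * y = p * p' + f * (q * p' + p * q' + f * q * q')"
        using * by (simp_all add: algebra_simps)
      then show "x + y \<in> T" "x * y \<in> T"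
        unfolding T_def using weighted_squares_add[OF *(3,4)] weighted_squares_mult[OF *(3,4)] by blast+
    qed
    have "-1 \<notin> T"
    proof
      assume "-1 \<in> T"
      then obtain p q where pq: "p \<in> weighted_squares" "-1 = p + f * q" unfolding T_def by blast
      obtain p' where p': "p' \<in> weighted_squares" "f dvd p - p'" "degree p' \<le> 2 * (degree f - 1)"
        using weighted_squares_reduce[OF \<open>degree f > 0\<close> pq(1)] by blast
      have "1 + p = f * (- q)" using pq(2) by (simp add: eq_neg_iff_add_eq_0 add.assoc flip: pq(2))
      then have "f dvd 1 + p" by (rule dvdI)
      then have "f dvd (1 + p) - (p - p')" using p'(2) by (rule dvd_diff)
      then obtain q' where q': "1 + p' = f * q'" by (auto elim: dvdE)
      have pos: "0 < poly f x * poly q' x" for x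
      proof -
        have "poly f x * poly q' x = 1 + poly p' x" using arg_cong[OF q', of "\<lambda>p. poly p x"] by simp
        then show ?thesis using weighted_squares_nonneg[OF p'(1), of x] by (simp add: add_pos_nonneg)
      qed
      then have "q' \<noteq> 0" by force
      have "degree f + degree q' = degree (1 + p')" using q' \<open>q' \<noteq> 0\<close> \<open>f \<noteq> 0\<close> by (simp add: degree_mult_eq)
      also have "\<dots> \<le> 2 * (degree f - 1)" using p'(3) by (intro degree_add_le) auto
      finally have "degree q' < degree f" using \<open>degree f > 0\<close> by linarith
      moreover have "poly q' a * poly q' b < 0"
        using pos[of a] pos[of b] less.prems by (auto simp: mult_less_0_iff zero_less_mult_iff)
      ultimately obtain x where "poly q' x = 0" using less.hyps by blast
      then show False using pos[of x] by simp
    qed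
    then obtain P where "prime_cone P" "T \<subseteq> P" using exists_prime_cone[OF T] by blast
    note P = prime_cone_preordering[OF \<open>prime_cone P\<close>]
    have fT: "f * q \<in> P" for q
      using \<open>T \<subseteq> P\<close> weighted_squares.zero unfolding T_def by force
    \<comment> \<open>The irreducible \<open>f\<close> generates a maximal ideal, and this ideal is \<open>P \<inter> -P\<close>.\<close>
    have not_neg: "f dvd p" if "p \<in> P" "-p \<in> P" for p
    proof (rule ccontr)
      assume "\<not> f dvd p"
      then obtain u v where uv: "u * f + v * p = 1" using poly_irreducible_bezout[OF \<open>f \<noteq> 0\<close> irr] by metis
      have "v * (-p) \<in> P"
        using prime_cone_total[OF \<open>prime_cone P\<close>, of v]
      proof
        assume "-v \<in> P"
        then have "(-v) * p \<in> P" using that P ring_preordering_mult by blast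
        then show ?thesis by simp
      qed (use that P ring_preordering_mult in blast)
      then have "f * (-u) + v * (-p) \<in> P" using fT P ring_preordering_add by blast
      moreover have "f * (-u) + v * (-p) = - (u * f + v * p)" by (simp add: algebra_simps)
      ultimately show False using uv prime_cone_m1[OF \<open>prime_cone P\<close>] by simp
    qed
    have ev_0_iff: "ev p = 0 \<longleftrightarrow> f dvd p" for p
    proof
      assume "ev p = 0"
      show "f dvd p"
      proof (rule ccontr)
        assume "\<not> f dvd p"
        then obtain u v where uv: "u * f + v * p = 1" using poly_irreducible_bezout[OF \<open>f \<noteq> 0\<close> irr] by metis
        then have "ev (u * f + v * p) = 1" by (simp add: ev_simps)
        then show False using \<open>ev p = 0\<close> ev_f by (simp add: ev_simps)
      qed
    qed (auto simp: ev_simps ev_f elim!: dvdE)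
    \<comment> \<open>The values of the members of \<open>P\<close> at \<open>w\<close> are the nonnegative elements of an ordered field.\<close>
    have "field_cone (ev ` P)"
      unfolding field_cone_def
    proof (intro conjI ballI impI)
      show "1 \<in> ev ` P" using P by (intro image_eqI[of _ _ 1]) (simp_all add: ev_simps)
    next
      fix x y assume "x \<in> ev ` P" "y \<in> ev ` P"
      then obtain p q where pq: "x = ev p" "y = ev q" "p \<in> P" "q \<in> P" by blast
      show "x + y \<in> ev ` P"
        using pq P by (intro image_eqI[of _ _ "p + q"]) (simp_all add: ev_simps ring_preordering_add)
      show "x * y \<in> ev ` P"
        using pq P by (intro image_eqI[of _ _ "p * q"]) (simp_all add: ev_simps ring_preordering_mult)
      have "x - y = ev (p - q)" "y - x = ev (-(p - q))" using pq by (simp_all add: ev_simps)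
      then show "x - y \<in> ev ` P \<or> y - x \<in> ev ` P"
        using prime_cone_total[OF \<open>prime_cone P\<close>, of "p - q"] by blast
    next
      fix x assume "x \<in> ev ` P"
      then obtain p where p: "x = ev p" "p \<in> P" by blast
      show "inverse x \<in> ev ` P"
      proof (cases "x = 0")
        case True
        then show ?thesis using \<open>x \<in> ev ` P\<close> by simp
      next
        case False
        then have "\<not> f dvd p" using ev_0_iff p by auto
        then obtain u v where uv: "u * f + v * p = 1" using poly_irreducible_bezout[OF \<open>f \<noteq> 0\<close> irr] by metis
        then have "ev (u * f + v * p) = 1" by (simp add: ev_simps)
        then have "ev v * x = 1" using p ev_f by (simp add: ev_simps)
        then have "inverse x = ev v" by (metis inverse_unique mult.commute)
        moreover have "v \<in> P"
        proof (rule ccontr)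
          assume "v \<notin> P"
          then have "-v \<in> P" using prime_cone_total[OF \<open>prime_cone P\<close>] by blast
          then have "(-v) * p \<in> P" by (rule ring_preordering_mult[OF P _ p(2)])
          then have "f * (-u) + (-v) * p \<in> P" by (rule ring_preordering_add[OF P fT])
          moreover have "f * (-u) + (-v) * p = - (u * f + v * p)" by (simp add: algebra_simps)
          ultimately show False using uv prime_cone_m1[OF \<open>prime_cone P\<close>] by simp
        qed
        ultimately show ?thesis by blast
      qed
      assume "-x \<in> ev ` P"
      then obtain q where q: "-x = ev q" "q \<in> P" by blast
      then have "ev (p + q) = 0" using p by (simp add: ev_simps flip: q(1))
      then obtain r where r: "p + q = f * r" using ev_0_iff by (auto elim: dvdE)
      have "f * (-r) + q \<in> P" using fT q P by (intro ring_preordering_add)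
      also have "f * (-r) + q = -p" using r[symmetric] by simp
      finally show "x = 0" using not_neg[OF p(2)] p(1) ev_0_iff by blast
    qed
    moreover have "closure_cone \<subseteq> ev ` P"
    proof
      fix x :: "'a alg_closure" assume "x \<in> closure_cone"
      then obtain r where r: "x = ?\<iota> r" "r \<ge> 0" using closure_cone_eq by auto
      have "[:r:] = smult r (1^2) + f * 0" by simp
      then have "[:r:] \<in> T" unfolding T_def using weighted_squares_single[OF r(2), of 1] by blast
      then have "[:r:] \<in> P" using \<open>T \<subseteq> P\<close> by blast
      moreover have "ev [:r:] = x" by (simp add: ev_def map_poly_morphism[OF \<iota>] r ring_morphism_simps[OF \<iota>])
      ultimately show "x \<in> ev ` P" by blast
    qed
    ultimately have eq: "ev ` P = closure_cone" by (rule closure_cone_maximal)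
    have ev_var: "ev [:0, 1:] = w" by (simp add: ev_def map_poly_morphism[OF \<iota>] ring_morphism_simps[OF \<iota>])
    have "w \<in> closure_cone \<or> -w \<in> closure_cone"
      using prime_cone_total[OF \<open>prime_cone P\<close>, of "[:0, 1:]"] eq ev_var ev_simps(5)[of "[:0,1:]"] by (metis imageI)
    then have "?\<iota> (Abs_real_closure w) = w" by (simp add: Abs_real_closure_inverse)
    then have "?\<iota> (poly f (Abs_real_closure w)) = 0" using w by (simp add: morphism_poly[OF \<iota>])
    then have "poly f (Abs_real_closure w) = 0"
      by (simp add: Rep_real_closure_inject flip: zero_real_closure.rep_eq)
    then show False using no_root' by blast
  qed
qed

instance real_closure :: (linordered_field) real_closed_field
proof
  fix a b :: "'a real_closure" and c :: "nat \<Rightarrow> 'a real_closure" and n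
  assume *: "a < b" "(\<Sum>i\<le>n. c i * a ^ i) < 0" "0 < (\<Sum>i\<le>n. c i * b ^ i)"
  define f where "f = (\<Sum>i\<le>n. monom (c i) i)"
  have f: "poly f x = (\<Sum>i\<le>n. c i * x ^ i)" for x by (simp add: f_def poly_sum poly_monom)
  have "poly f a * poly f b < 0" using * by (simp add: f mult_neg_pos)
  then show "\<exists>x>a. x < b \<and> (\<Sum>i\<le>n. c i * x ^ i) = 0"
    using real_closure_sign_change_root[OF *(1), of f] by (simp add: f)
qed

section \<open>Polynomials in several variables\<close>

definition mpoly_const :: "rat \<Rightarrow> rat_mpoly" where
  "mpoly_const c = Poly_Mapping.single 0 c"

definition mpoly_var :: "nat \<Rightarrow> rat_mpoly" where
  "mpoly_var i = Poly_Mapping.single (Poly_Mapping.single i 1) 1"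

definition monomial_value :: "(nat \<Rightarrow> 'b::comm_ring_1) \<Rightarrow> (nat \<Rightarrow>\<^sub>0 nat) \<Rightarrow> 'b" where
  "monomial_value x m = (\<Prod>i\<in>Poly_Mapping.keys m. x i ^ Poly_Mapping.lookup m i)"

text \<open>
  Substitution of \<open>x\<close> for the variables and \<open>c\<close> for the coefficients, in an arbitrary commutative ring. The target
  is the real numbers for evaluation at a point, and the polynomial ring itself for the substitution
  of \<open>0\<close> for some variables.
\<close>

definition evaluate :: "(rat \<Rightarrow> 'b::comm_ring_1) \<Rightarrow> (nat \<Rightarrow> 'b) \<Rightarrow> rat_mpoly \<Rightarrow> 'b" where
  "evaluate c x p = (\<Sum>m\<in>Poly_Mapping.keys p. c (Poly_Mapping.lookup p m) * monomial_value x m)"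

lemma monomial_value_superset:
  assumes "finite K" "Poly_Mapping.keys m \<subseteq> K"
  shows "monomial_value x m = (\<Prod>i\<in>K. x i ^ Poly_Mapping.lookup m i)"
  unfolding monomial_value_def using assms
  by (intro prod.mono_neutral_left) (auto simp: in_keys_iff)

lemma monomial_value_add: "monomial_value x (m + m') = monomial_value x m * monomial_value x m'"
proof -
  let ?K = "Poly_Mapping.keys m \<union> Poly_Mapping.keys m'"
  have "monomial_value x m'' = (\<Prod>i\<in>?K. x i ^ Poly_Mapping.lookup m'' i)" if "Poly_Mapping.keys m'' \<subseteq> ?K" for m''
    using that by (intro monomial_value_superset) auto
  then show ?thesis
    using keys_add[of m m'] by (simp add: lookup_add power_add prod.distrib)
qed

lemma sum_singles: "(\<Sum>m\<in>Poly_Mapping.keys p. Poly_Mapping.single m (Poly_Mapping.lookup p m)) = p"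
  by (rule poly_mapping_eqI) (auto simp: lookup_sum lookup_single when_def in_keys_iff)

context
  fixes c :: "rat \<Rightarrow> 'b::comm_ring_1" and x :: "nat \<Rightarrow> 'b"
  assumes c: "ring_morphism c"
begin

lemma evaluate_superset:
  assumes "finite K" "Poly_Mapping.keys p \<subseteq> K"
  shows "evaluate c x p = (\<Sum>m\<in>K. c (Poly_Mapping.lookup p m) * monomial_value x m)"
  unfolding evaluate_def using assms
  by (intro sum.mono_neutral_left) (auto simp: in_keys_iff ring_morphism_simps[OF c])

lemma evaluate_add: "evaluate c x (p + q) = evaluate c x p + evaluate c x q"
proof -
  let ?K = "Poly_Mapping.keys p \<union> Poly_Mapping.keys q"
  have "evaluate c x r = (\<Sum>m\<in>?K. c (Poly_Mapping.lookup r m) * monomial_value x m)"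
    if "Poly_Mapping.keys r \<subseteq> ?K" for r
    using that by (intro evaluate_superset) auto
  then show ?thesis
    using keys_add[of p q] by (simp add: lookup_add ring_morphism_simps[OF c] distrib_right sum.distrib)
qed

lemma evaluate_sum: "evaluate c x (sum p I) = (\<Sum>i\<in>I. evaluate c x (p i))"
proof -
  have "evaluate c x 0 = 0" by (simp add: evaluate_def)
  then show ?thesis by (induction I rule: infinite_finite_induct) (simp_all add: evaluate_add)
qed

lemma evaluate_single: "evaluate c x (Poly_Mapping.single m a) = c a * monomial_value x m"
  using evaluate_superset[of "{m}" "Poly_Mapping.single m a"] by simp

lemma evaluate_mult: "evaluate c x (p * q) = evaluate c x p * evaluate c x q"
proof -
  let ?p = "\<lambda>m. Poly_Mapping.single m (Poly_Mapping.lookup p m)"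
  let ?q = "\<lambda>m. Poly_Mapping.single m (Poly_Mapping.lookup q m)"
  have "p * q = (\<Sum>m\<in>Poly_Mapping.keys p. ?p m) * (\<Sum>m\<in>Poly_Mapping.keys q. ?q m)"
    by (simp only: sum_singles)
  also have "\<dots> = (\<Sum>m\<in>Poly_Mapping.keys p. \<Sum>m'\<in>Poly_Mapping.keys q. ?p m * ?q m')"
    by (rule sum_product)
  finally have "evaluate c x (p * q) = (\<Sum>m\<in>Poly_Mapping.keys p. \<Sum>m'\<in>Poly_Mapping.keys q. evaluate c x (?p m * ?q m'))"
    by (simp add: evaluate_sum)
  also have "\<dots> = (\<Sum>m\<in>Poly_Mapping.keys p. \<Sum>m'\<in>Poly_Mapping.keys q. evaluate c x (?p m) * evaluate c x (?q m'))"
    by (simp add: mult_single evaluate_single monomial_value_add ring_morphism_simps[OF c] ac_simps)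
  also have "\<dots> = (\<Sum>m\<in>Poly_Mapping.keys p. evaluate c x (?p m)) * (\<Sum>m\<in>Poly_Mapping.keys q. evaluate c x (?q m))"
    by (rule sum_product[symmetric])
  also have "\<dots> = evaluate c x p * evaluate c x q"
    by (simp only: evaluate_sum[symmetric] sum_singles)
  finally show ?thesis .
qed

lemma evaluate_const: "evaluate c x (mpoly_const a) = c a"
  by (simp add: mpoly_const_def evaluate_single monomial_value_def)

lemma evaluate_var: "evaluate c x (mpoly_var i) = x i"
  by (simp add: mpoly_var_def evaluate_single monomial_value_def ring_morphism_simps[OF c])

lemma ring_morphism_evaluate: "ring_morphism (evaluate c x)"
  using evaluate_const[of 1]
  by (simp add: ring_morphism_def evaluate_add evaluate_mult mpoly_const_def ring_morphism_simps[OF c])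

end

lemma ring_morphism_mpoly_const: "ring_morphism mpoly_const"
  by (simp add: ring_morphism_def mpoly_const_def single_add mult_single)

lemma ring_morphism_of_rat: "ring_morphism (of_rat :: rat \<Rightarrow> 'a::field_char_0)"
  by (simp add: ring_morphism_def of_rat_add of_rat_mult)

lemma eval_mpoly_eq_evaluate: "eval_mpoly p x = evaluate of_rat x p"
  by (simp add: eval_mpoly_def evaluate_def monomial_value_def)

lemma ring_morphism_eval_mpoly: "ring_morphism (\<lambda>p. eval_mpoly p x)"
  unfolding eval_mpoly_eq_evaluate using ring_morphism_evaluate[OF ring_morphism_of_rat] .

lemma eval_mpoly_const: "eval_mpoly (mpoly_const c) x = of_rat c"
  and eval_mpoly_var: "eval_mpoly (mpoly_var i) x = x i"
  unfolding eval_mpoly_eq_evaluate by (simp_all add: evaluate_const evaluate_var ring_morphism_of_rat)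

lemma subring_of_polys: "subring_of (polys n)"
proof -
  have diff: "Poly_Mapping.keys (a - b) \<subseteq> Poly_Mapping.keys a \<union> Poly_Mapping.keys b" for a b :: rat_mpoly
    by (auto simp: in_keys_iff lookup_minus)
  show ?thesis
    unfolding subring_of_def polys_def
  proof (intro conjI ballI)
    fix a b :: rat_mpoly
    assume ab: "a \<in> {p. \<forall>m\<in>Poly_Mapping.keys p. Poly_Mapping.keys m \<subseteq> {..<n}}"
      "b \<in> {p. \<forall>m\<in>Poly_Mapping.keys p. Poly_Mapping.keys m \<subseteq> {..<n}}"
    show "a + b \<in> {p. \<forall>m\<in>Poly_Mapping.keys p. Poly_Mapping.keys m \<subseteq> {..<n}}"
      using ab keys_add[of a b] by blast
    show "a - b \<in> {p. \<forall>m\<in>Poly_Mapping.keys p. Poly_Mapping.keys m \<subseteq> {..<n}}"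
      using ab diff[of a b] by blast
    show "a * b \<in> {p. \<forall>m\<in>Poly_Mapping.keys p. Poly_Mapping.keys m \<subseteq> {..<n}}"
    proof (intro CollectI ballI)
      fix m assume "m \<in> Poly_Mapping.keys (a * b)"
      then obtain u v where "m = u + v" "u \<in> Poly_Mapping.keys a" "v \<in> Poly_Mapping.keys b"
        using keys_mult[of a b] by blast
      then show "Poly_Mapping.keys m \<subseteq> {..<n}" using ab keys_add[of u v] by blast
    qed
  qed auto
qed

lemma mpoly_const_in_polys: "mpoly_const c \<in> polys n"
  by (auto simp: mpoly_const_def polys_def)

lemma mpoly_var_in_polys: "i < n \<Longrightarrow> mpoly_var i \<in> polys n"
  by (auto simp: mpoly_var_def polys_def)

lemma polys_generated:
  assumes A: "subring_of A" and const: "\<And>c. mpoly_const c \<in> A" and var: "\<And>i. i < n \<Longrightarrow> mpoly_var i \<in> A"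
  shows "polys n \<subseteq> A"
proof
  fix p assume p: "p \<in> polys n"
  have prod: "prod f I \<in> A" if "\<And>i. i \<in> I \<Longrightarrow> f i \<in> A" for f :: "nat \<Rightarrow> rat_mpoly" and I
    using that by (induction I rule: infinite_finite_induct) (auto intro: subring_ofD[OF A])
  have pow: "a ^ k \<in> A" if "a \<in> A" for a k
    using that by (induction k) (auto intro: subring_ofD[OF A])
  have "Poly_Mapping.single m a \<in> A" if m: "Poly_Mapping.keys m \<subseteq> {..<n}" for m a
  proof -
    have var_pow: "mpoly_var i ^ k = Poly_Mapping.single (Poly_Mapping.single i k) 1" for i k
      by (induction k) (auto simp: mpoly_var_def mult_single single_add[symmetric])
    have prods: "(\<Prod>i\<in>I. Poly_Mapping.single (Poly_Mapping.single i (Poly_Mapping.lookup m i)) 1) =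
        Poly_Mapping.single (\<Sum>i\<in>I. Poly_Mapping.single i (Poly_Mapping.lookup m i)) (1::rat)" for I
      by (induction I rule: infinite_finite_induct) (auto simp: mult_single)
    have "(\<Sum>i\<in>Poly_Mapping.keys m. Poly_Mapping.single i (Poly_Mapping.lookup m i)) = m"
      by (rule poly_mapping_eqI) (auto simp: lookup_sum lookup_single when_def in_keys_iff)
    then have "Poly_Mapping.single m a = mpoly_const a * (\<Prod>i\<in>Poly_Mapping.keys m. mpoly_var i ^ Poly_Mapping.lookup m i)"
      by (simp add: var_pow prods mpoly_const_def mult_single)
    also have "\<dots> \<in> A"
      using m const var by (intro subring_ofD[OF A] prod pow) auto
    finally show ?thesis .
  qed
  then have "(\<Sum>m\<in>Poly_Mapping.keys p. Poly_Mapping.single m (Poly_Mapping.lookup p m)) \<in> A"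
    using p by (intro subring_of_sum[OF A]) (auto simp: polys_def)
  then show "p \<in> A" by (simp only: sum_singles)
qed

lemma morphisms_agree_on_polys:
  assumes "ring_morphism \<phi>" "ring_morphism \<psi>"
    and "\<And>c. \<phi> (mpoly_const c) = \<psi> (mpoly_const c)" "\<And>i. i < n \<Longrightarrow> \<phi> (mpoly_var i) = \<psi> (mpoly_var i)"
    and "p \<in> polys n"
  shows "\<phi> p = \<psi> p"
proof -
  have "subring_of {p. \<phi> p = \<psi> p}"
    by (simp add: subring_of_def ring_morphism_simps[OF assms(1)] ring_morphism_simps[OF assms(2)])
  then have "polys n \<subseteq> {p. \<phi> p = \<psi> p}" using assms by (intro polys_generated) auto
  then show ?thesis using assms(5) by blast
qed

lemma eval_mpoly_cong:
  assumes "p \<in> polys n" "\<And>i. i < n \<Longrightarrow> x i = y i"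
  shows "eval_mpoly p x = eval_mpoly p y"
  using morphisms_agree_on_polys[OF ring_morphism_eval_mpoly[of x] ring_morphism_eval_mpoly[of y], of n p] assms
  by (simp add: eval_mpoly_const eval_mpoly_var)

lemma finite_subset_polys:
  assumes "finite Q"
  obtains n where "Q \<subseteq> polys n"
proof -
  define V where "V = (\<Union>p\<in>Q. \<Union>m\<in>Poly_Mapping.keys p. Poly_Mapping.keys m)"
  have "finite V" using assms by (auto simp: V_def)
  then obtain n where "V \<subseteq> {..<n}" using finite_nat_iff_bounded by blast
  then have "Q \<subseteq> polys n" by (force simp: polys_def V_def)
  then show ?thesis using that by blast
qed

lemma morphism_on_rat:
  assumes "ring_morphism (\<theta> :: rat \<Rightarrow> 'a::field_char_0)"
  shows "\<theta> c = of_rat c"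
proof -
  note \<theta> = ring_morphism_simps[OF assms]
  have int: "\<theta> (of_int k) = of_int k" for k
    by (cases k rule: int_cases2) (simp_all add: \<theta>)
  obtain a b where ab: "c = Rat.Fract a b" "b > 0" by (cases c) auto
  then have "c * of_int b = of_int a" by (simp add: Fract_of_int_quotient)
  then have "\<theta> c * of_int b = of_int a" using \<theta>(3)[of c "of_int b"] int by simp
  then show ?thesis using ab by (simp add: of_rat_rat field_simps)
qed

text \<open>
  A ring morphism from the polynomials to a real closed field is a point with coordinates in that field. The
  coordinates are replaced by real numbers one after the other: a polynomial in \<open>Suc n\<close> variables is a
  polynomial in the last variable whose coefficients involve \<open>n\<close> variables, and the signs that the
  univariate transfer asks for are matched by the induction hypothesis. Without variables only rational
  constants remain, and their signs are the same in every ordered field.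
\<close>

theorem mpoly_sign_transfer:
  fixes \<phi> :: "rat_mpoly \<Rightarrow> 'a::real_closed_field"
  assumes \<phi>: "ring_morphism \<phi>" and "finite Q" "Q \<subseteq> polys n"
  shows "\<exists>x. \<forall>q\<in>Q. isgn (\<phi> q) = isgn (eval_mpoly q x)"
  using assms(2,3)
proof (induction n arbitrary: Q)
  case 0
  have "isgn (\<phi> q) = isgn (eval_mpoly q (\<lambda>_. 0))" if "q \<in> Q" for q
  proof -
    have "polys 0 \<subseteq> mpoly_const ` UNIV"
    proof (rule polys_generated)
      note c = ring_morphism_simps[OF ring_morphism_mpoly_const]
      show "subring_of (mpoly_const ` UNIV)"
        unfolding subring_of_def
      proof (intro conjI ballI)
        show "0 \<in> range mpoly_const" "1 \<in> range mpoly_const" using c(4,1) by (metis rangeI)+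
        fix a b assume "a \<in> range mpoly_const" "b \<in> range mpoly_const"
        then obtain r s where "a = mpoly_const r" "b = mpoly_const s" by blast
        then show "a + b \<in> range mpoly_const" "a - b \<in> range mpoly_const" "a * b \<in> range mpoly_const"
          using c(2)[of r s] c(6)[of r s] c(3)[of r s] by (metis rangeI)+
      qed
    qed auto
    with \<open>q \<in> Q\<close> 0 obtain c where "q = mpoly_const c" by blast
    moreover have "ring_morphism (\<lambda>c. \<phi> (mpoly_const c))"
      using \<phi> ring_morphism_mpoly_const by (simp add: ring_morphism_def)
    ultimately have "\<phi> q = of_rat c" using morphism_on_rat[of "\<lambda>c. \<phi> (mpoly_const c)" c] by simp
    moreover have "eval_mpoly q (\<lambda>_. 0) = of_rat c" using \<open>q = mpoly_const c\<close> by (simp add: eval_mpoly_const)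
    ultimately show ?thesis by (simp add: isgn_eq_iff)
  qed
  then show ?case by blast
next
  case (Suc n)
  define A where "A = (\<lambda>u. poly u (mpoly_var n)) ` polys_over (polys n)"
  note P = subring_ofD[OF subring_of_polys_over[OF subring_of_polys[of n]]]
  note Pn = subring_ofD[OF subring_of_polys[of n]]
  have single_in: "[:c:] \<in> polys_over (polys n)" if "c \<in> polys n" for c
    using that Pn(1) by (auto simp: polys_over_def coeff_pCons split: nat.splits)
  have "subring_of A"
    unfolding subring_of_def
  proof (intro conjI ballI)
    show "0 \<in> A" "1 \<in> A" unfolding A_def using P(1,2) by (metis imageI poly_0, metis imageI poly_1)
    fix a b assume "a \<in> A" "b \<in> A"
    then obtain u v where *: "a = poly u (mpoly_var n)" "b = poly v (mpoly_var n)"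
      "u \<in> polys_over (polys n)" "v \<in> polys_over (polys n)" unfolding A_def by blast
    show "a + b \<in> A" "a - b \<in> A" "a * b \<in> A"
      unfolding A_def using P(3-5)[OF *(3,4)] * by (metis imageI poly_add, metis imageI poly_diff, metis imageI poly_mult)
  qed
  then have "polys (Suc n) \<subseteq> A"
  proof (rule polys_generated)
    have "poly [:mpoly_const c:] (mpoly_var n) = mpoly_const c" for c by simp
    then show "mpoly_const c \<in> A" for c
      unfolding A_def using single_in[OF mpoly_const_in_polys] by (metis imageI)
    fix i assume "i < Suc n"
    show "mpoly_var i \<in> A"
    proof (cases "i = n")
      case True
      have "[:0, 1:] \<in> polys_over (polys n)"
        using Pn(1,2) by (auto simp: polys_over_def coeff_pCons split: nat.splits)
      moreover have "poly [:0, 1:] (mpoly_var n) = mpoly_var n" by simp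
      ultimately show ?thesis unfolding A_def True by (metis imageI)
    next
      case False
      then have "[:mpoly_var i:] \<in> polys_over (polys n)" using \<open>i < Suc n\<close> by (intro single_in mpoly_var_in_polys) simp
      moreover have "poly [:mpoly_var i:] (mpoly_var n) = mpoly_var i" by simp
      ultimately show ?thesis unfolding A_def by (metis imageI)
    qed
  qed
  then have "\<forall>q\<in>Q. \<exists>u. u \<in> polys_over (polys n) \<and> q = poly u (mpoly_var n)"
    using Suc.prems unfolding A_def by blast
  then obtain u where u: "\<And>q. q \<in> Q \<Longrightarrow> u q \<in> polys_over (polys n)" "\<And>q. q \<in> Q \<Longrightarrow> q = poly (u q) (mpoly_var n)"
    by metis
  obtain E where E: "finite E" "E \<subseteq> polys n"
    "\<And>(\<phi> :: rat_mpoly \<Rightarrow> 'a) (\<psi> :: rat_mpoly \<Rightarrow> real) y.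
       ring_morphism \<phi> \<Longrightarrow> ring_morphism \<psi> \<Longrightarrow> (\<And>e. e \<in> E \<Longrightarrow> isgn (\<phi> e) = isgn (\<psi> e)) \<Longrightarrow>
       \<exists>y'. \<forall>p\<in>u ` Q. isgn (poly (map_poly \<phi> p) y) = isgn (poly (map_poly \<psi> p) y')"
    by (rule univariate_sign_transfer[of "polys n" "u ` Q"])
       (use subring_of_polys Suc.prems(1) u(1) in auto)
  obtain x where x: "\<And>e. e \<in> E \<Longrightarrow> isgn (\<phi> e) = isgn (eval_mpoly e x)"
    using Suc.IH[OF E(1,2)] by blast
  obtain y' where y': "\<And>q. q \<in> Q \<Longrightarrow> isgn (poly (map_poly \<phi> (u q)) (\<phi> (mpoly_var n))) =
      isgn (poly (map_poly (\<lambda>p. eval_mpoly p x) (u q)) y')"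
    using E(3)[OF \<phi> ring_morphism_eval_mpoly[of x] x] by blast
  have "isgn (\<phi> q) = isgn (eval_mpoly q (x(n := y')))" if q: "q \<in> Q" for q
  proof -
    have "map_poly (\<lambda>p. eval_mpoly p (x(n := y'))) (u q) = map_poly (\<lambda>p. eval_mpoly p x) (u q)"
      using u(1)[OF q] eval_mpoly_cong[of _ n "x(n := y')" x]
      by (intro poly_eqI) (simp add: map_poly_morphism(1)[OF ring_morphism_eval_mpoly] polys_over_def)
    moreover have "eval_mpoly (poly (u q) (mpoly_var n)) (x(n := y')) =
        poly (map_poly (\<lambda>p. eval_mpoly p (x(n := y'))) (u q)) y'"
      using morphism_poly[OF ring_morphism_eval_mpoly, of "u q" "mpoly_var n" "x(n := y')"]
      by (simp add: eval_mpoly_var)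
    moreover have "\<phi> (poly (u q) (mpoly_var n)) = poly (map_poly \<phi> (u q)) (\<phi> (mpoly_var n))"
      by (rule morphism_poly[OF \<phi>])
    ultimately show ?thesis using y'[OF q] u(2)[OF q] by metis
  qed
  then show ?case by blast
qed

section \<open>Real points of prime cones\<close>

text \<open>
  The ordered residue ring of a prime cone has to be a type in order to use the results on ordered
  fields, but types cannot depend on a variable. Therefore the prime cone is fixed by a choice: if
  any prime cone violates the claim of this section, then \<open>critical_cone\<close> does. So it suffices to prove the
  claim for this one constant.
\<close>

definition has_real_points :: "rat_mpoly set \<Rightarrow> bool" where
  "has_real_points P \<longleftrightarrow> (\<forall>Q. finite Q \<longrightarrow> Q \<subseteq> P \<longrightarrow> (\<exists>x. \<forall>q\<in>Q. eval_mpoly q x \<ge> 0))"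

definition critical_cone :: "rat_mpoly set" where
  "critical_cone = (SOME P. prime_cone P \<and> (has_real_points P \<longrightarrow> (\<forall>P'. prime_cone P' \<longrightarrow> has_real_points P')))"

lemma prime_cone_point: "prime_cone {p. eval_mpoly p x \<ge> 0}"
  using ring_morphism_simps[OF ring_morphism_eval_mpoly[of x]]
  by (auto simp: prime_cone_def ring_preordering_def)

lemma critical_cone:
  shows prime_cone_critical: "prime_cone critical_cone"
    and critical_imp_all: "has_real_points critical_cone \<Longrightarrow> prime_cone P \<Longrightarrow> has_real_points P"
proof -
  have "\<exists>P. prime_cone P \<and> (has_real_points P \<longrightarrow> (\<forall>P'. prime_cone P' \<longrightarrow> has_real_points P'))"
    using prime_cone_point by blast
  from someI_ex[OF this] show "prime_cone critical_cone"
    and "has_real_points critical_cone \<Longrightarrow> prime_cone P \<Longrightarrow> has_real_points P"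
    unfolding critical_cone_def[symmetric] by blast+
qed

lemmas critical_add = ring_preordering_add[OF prime_cone_preordering[OF prime_cone_critical]]
lemmas critical_mult = ring_preordering_mult[OF prime_cone_preordering[OF prime_cone_critical]]
lemmas critical_total = prime_cone_total[OF prime_cone_critical]
lemmas critical_0 = ring_preordering_0[OF prime_cone_preordering[OF prime_cone_critical]]

definition critical_eq :: "rat_mpoly \<Rightarrow> rat_mpoly \<Rightarrow> bool" where
  "critical_eq p q \<longleftrightarrow> p - q \<in> critical_cone \<and> q - p \<in> critical_cone"

lemma critical_eq_refl: "critical_eq p p"
  by (simp add: critical_eq_def critical_0)

lemma critical_eq_sym: "critical_eq p q \<Longrightarrow> critical_eq q p"
  by (simp add: critical_eq_def)

lemma critical_le_trans: "q - p \<in> critical_cone \<Longrightarrow> r - q \<in> critical_cone \<Longrightarrow> r - p \<in> critical_cone"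
  using critical_add[of "q - p" "r - q"] by simp

lemma critical_eq_add: "critical_eq p p' \<Longrightarrow> critical_eq q q' \<Longrightarrow> critical_eq (p + q) (p' + q')"
  using critical_add[of "p - p'" "q - q'"] critical_add[of "p' - p" "q' - q"]
  by (simp add: critical_eq_def algebra_simps)

lemma critical_eq_minus: "critical_eq p p' \<Longrightarrow> critical_eq (- p) (- p')"
  by (simp add: critical_eq_def)

lemma critical_eq_mult_left:
  assumes "critical_eq p p'"
  shows "critical_eq (r * p) (r * p')"
proof -
  have eqs: "r * (p - p') = r * p - r * p'" "r * (p' - p) = r * p' - r * p"
    "(- r) * (p - p') = r * p' - r * p" "(- r) * (p' - p) = r * p - r * p'"
    by (simp_all add: algebra_simps)
  show ?thesis
    using critical_total[of r] assms critical_mult[of r "p - p'", unfolded eqs] critical_mult[of r "p' - p", unfolded eqs]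
      critical_mult[of "- r" "p - p'", unfolded eqs] critical_mult[of "- r" "p' - p", unfolded eqs]
    unfolding critical_eq_def by blast
qed

lemma critical_eq_trans: "critical_eq p q \<Longrightarrow> critical_eq q r \<Longrightarrow> critical_eq p r"
  unfolding critical_eq_def by (meson critical_le_trans)

lemma critical_eq_mult: "critical_eq p p' \<Longrightarrow> critical_eq q q' \<Longrightarrow> critical_eq (p * q) (p' * q')"
  using critical_eq_mult_left[of p p' q] critical_eq_mult_left[of q q' p'] critical_eq_trans
  by (metis mult.commute)

lemma critical_eq_0_mult: "critical_eq (p * q) 0 \<Longrightarrow> critical_eq p 0 \<or> critical_eq q 0"
  using prime_cone_prime[OF prime_cone_critical, of p q] by (simp add: critical_eq_def)

quotient_type critical_residue = rat_mpoly / critical_eq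
  morphisms residue_rep residue_class
proof (rule equivpI)
  show "reflp critical_eq" by (simp add: reflp_def critical_eq_refl)
  show "symp critical_eq" by (auto intro: sympI critical_eq_sym)
  show "transp critical_eq" by (auto intro: transpI critical_eq_trans)
qed

instantiation critical_residue :: linordered_idom
begin

lift_definition zero_critical_residue :: critical_residue is 0 .
lift_definition one_critical_residue :: critical_residue is 1 .
lift_definition plus_critical_residue :: "critical_residue \<Rightarrow> critical_residue \<Rightarrow> critical_residue" is "(+)"
  by (rule critical_eq_add)
lift_definition uminus_critical_residue :: "critical_residue \<Rightarrow> critical_residue" is uminus
  by (rule critical_eq_minus)
lift_definition minus_critical_residue :: "critical_residue \<Rightarrow> critical_residue \<Rightarrow> critical_residue" is "(-)"
  unfolding diff_conv_add_uminus by (intro critical_eq_add critical_eq_minus)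
lift_definition times_critical_residue :: "critical_residue \<Rightarrow> critical_residue \<Rightarrow> critical_residue" is "(*)"
  by (rule critical_eq_mult)
lift_definition less_eq_critical_residue :: "critical_residue \<Rightarrow> critical_residue \<Rightarrow> bool"
  is "\<lambda>p q. q - p \<in> critical_cone"
  unfolding critical_eq_def by (meson critical_le_trans)
definition less_critical_residue :: "critical_residue \<Rightarrow> critical_residue \<Rightarrow> bool" where
  "less_critical_residue x y \<longleftrightarrow> x \<le> y \<and> \<not> y \<le> x"
definition abs_critical_residue :: "critical_residue \<Rightarrow> critical_residue" where
  "abs_critical_residue x = (if x < 0 then - x else x)"
definition sgn_critical_residue :: "critical_residue \<Rightarrow> critical_residue" where
  "sgn_critical_residue x = (if x = 0 then 0 else if 0 < x then 1 else - 1)"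

instance
proof
  fix x y z :: critical_residue
  show "x + y + z = x + (y + z)" "x + y = y + x" "0 + x = x" "x * y * z = x * (y * z)" "x * y = y * x"
    "1 * x = x" "(x + y) * z = x * z + y * z" "x + y - x = y" "x - y - z = x - (y + z)" "0 * x = 0" "x * 0 = 0"
    "- x + x = 0" "x - y = x + - y"
    by (transfer, simp add: algebra_simps critical_eq_refl)+
  show "(0::critical_residue) \<noteq> 1"
    using prime_cone_m1[OF prime_cone_critical] by transfer (simp add: critical_eq_def)
  have le_antisym: "x = y" if "x \<le> y" "y \<le> x" for x y :: critical_residue
    using that by transfer (simp add: critical_eq_def)
  then show "x \<le> y \<Longrightarrow> y \<le> x \<Longrightarrow> x = y" .
  have no_zero_divisors: "x * y \<noteq> 0" if "x \<noteq> 0" "y \<noteq> 0" for x y :: critical_residue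
    using that by transfer (blast dest: critical_eq_0_mult)
  show "x < y \<longleftrightarrow> x \<le> y \<and> \<not> y \<le> x" by (rule less_critical_residue_def)
  show "x \<le> x" by transfer (simp add: critical_0)
  show "x \<le> y \<Longrightarrow> y \<le> z \<Longrightarrow> x \<le> z" by transfer (rule critical_le_trans)
  show "x \<le> y \<or> y \<le> x" by transfer (metis critical_total minus_diff_eq)
  show "z + x \<le> z + y" if "x \<le> y" using that by transfer simp
  show "z * x < z * y" if "x < y" "0 < z"
  proof -
    have *: "x \<le> y" "\<not> y \<le> x" "0 \<le> z" "\<not> z \<le> 0" using that by (auto simp: less_critical_residue_def)
    have "z * x \<le> z * y"
      using *(1,3) by transfer (simp add: critical_mult flip: right_diff_distrib)
    moreover have "z * x \<noteq> z * y"
    proof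
      assume "z * x = z * y"
      then have "z * (x - y) = 0" by transfer (simp add: algebra_simps critical_eq_def)
      moreover have "z \<noteq> 0" using *(3,4) by auto
      moreover have "x - y \<noteq> 0"
      proof
        assume "x - y = 0"
        then have "x = y" by transfer (simp add: critical_eq_def)
        then show False using * by simp
      qed
      ultimately show False using no_zero_divisors by blast
    qed
    ultimately show ?thesis using le_antisym by (auto simp: less_critical_residue_def)
  qed
  show "\<bar>x\<bar> = (if x < 0 then - x else x)" by (rule abs_critical_residue_def)
  show "sgn x = (if x = 0 then 0 else if 0 < x then 1 else - 1)" by (rule sgn_critical_residue_def)
qed

end

text \<open>
  The generic point of the cone: each polynomial is mapped to its residue class, regarded as an element of
  the real closure of the ordered field of fractions.
\<close>

definition critical_point :: "rat_mpoly \<Rightarrow> critical_residue fract real_closure" where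
  "critical_point p = of_base (Fraction_Field.Fract (residue_class p) 1)"

lemma ring_morphism_critical_point: "ring_morphism critical_point"
proof -
  have "residue_class (p + q) = residue_class p + residue_class q"
    "residue_class (p * q) = residue_class p * residue_class q"
    "residue_class 1 = 1" for p q
    by (simp_all add: plus_critical_residue.abs_eq times_critical_residue.abs_eq one_critical_residue.abs_eq)
  moreover have "Fraction_Field.Fract (a + b) 1 = Fraction_Field.Fract a 1 + Fraction_Field.Fract b 1"
    "Fraction_Field.Fract (a * b) 1 = Fraction_Field.Fract a 1 * Fraction_Field.Fract b 1"
    for a b :: critical_residue
    by simp_all
  ultimately show ?thesis
    using ring_morphism_simps(1-3)[OF ring_morphism_of_base[where 'a="critical_residue fract"]]
    unfolding ring_morphism_def critical_point_def by (simp only: One_fract_def[symmetric]) simp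
qed

lemma critical_point_nonneg: "p \<in> critical_cone \<Longrightarrow> 0 \<le> critical_point p"
proof -
  assume "p \<in> critical_cone"
  then have "0 \<le> residue_class p"
    by (simp add: zero_critical_residue.abs_eq less_eq_critical_residue.abs_eq)
  then have "0 \<le> Fraction_Field.Fract (residue_class p) 1" by (simp add: zero_le_Fract_iff)
  then show ?thesis unfolding critical_point_def by (rule of_base_nonneg)
qed

text \<open>
  The critical point is a point in a real closed field where all members of the cone are nonnegative, and
  signs transfer from it to a real point.
\<close>

theorem prime_cone_real_point:
  assumes "prime_cone P" "finite Q" "Q \<subseteq> P"
  obtains x where "\<And>q. q \<in> Q \<Longrightarrow> eval_mpoly q x \<ge> 0"
proof -
  have "has_real_points critical_cone"
    unfolding has_real_points_def
  proof (intro allI impI)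
    fix Q assume Q: "finite Q" "Q \<subseteq> critical_cone"
    obtain n where "Q \<subseteq> polys n" using finite_subset_polys[OF Q(1)] by blast
    then obtain x where x: "\<forall>q\<in>Q. isgn (critical_point q) = isgn (eval_mpoly q x)"
      using mpoly_sign_transfer[OF ring_morphism_critical_point Q(1)] by blast
    have "eval_mpoly q x \<ge> 0" if "q \<in> Q" for q
    proof -
      have "q \<in> critical_cone" using that Q(2) by blast
      then have "\<not> critical_point q < 0" using critical_point_nonneg[of q] by (simp only: linorder_not_less)
      then have "\<not> eval_mpoly q x < 0" using bspec[OF x that] unfolding isgn_eq_iff by simp
      then show ?thesis by simp
    qed
    then show "\<exists>x. \<forall>q\<in>Q. eval_mpoly q x \<ge> 0" by blast
  qed
  then have "has_real_points P" using critical_imp_all assms(1) by blast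
  then have "\<exists>x. \<forall>q\<in>Q. eval_mpoly q x \<ge> 0"
    using assms(2,3) unfolding has_real_points_def by simp
  then show ?thesis using that by metis
qed

section \<open>Positivstellensatz and archimedean preorderings\<close>

inductive_set generated_preordering :: "'a::comm_ring_1 set \<Rightarrow> 'a set" for G where
  square: "a^2 \<in> generated_preordering G"
| generator: "g \<in> G \<Longrightarrow> g \<in> generated_preordering G"
| add: "a \<in> generated_preordering G \<Longrightarrow> b \<in> generated_preordering G \<Longrightarrow> a + b \<in> generated_preordering G"
| mult: "a \<in> generated_preordering G \<Longrightarrow> b \<in> generated_preordering G \<Longrightarrow> a * b \<in> generated_preordering G"

lemma ring_preordering_generated: "ring_preordering (generated_preordering G)"
  by (auto simp: ring_preordering_def intro: generated_preordering.intros)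

text \<open>
  If \<open>-1 \<notin> T - f T\<close>, a prime cone that contains \<open>T - f T\<close> provides a real point with all members of \<open>S\<close> nonnegative
  and \<open>f\<close> not positive. So \<open>-1 = t - f * u\<close> with \<open>t, u \<in> T\<close>.
\<close>

lemma positivstellensatz:
  assumes T: "ring_preordering T" and S: "finite S" "S \<subseteq> polys n" "S \<subseteq> T" and f: "f \<in> polys n"
    and pos: "\<forall>x\<in>basic_closed_set n S. eval_mpoly f x > 0"
  obtains p q where "p \<in> T" "q \<in> T" "f * p = 1 + q"
proof -
  let ?A = "{t + (-f) * u | t u. t \<in> T \<and> u \<in> T}"
  have A: "ring_preordering ?A" by (rule ring_preordering_adjoin[OF T])
  have "-1 \<in> ?A"
  proof (rule ccontr)
    assume "-1 \<notin> ?A"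
    then obtain P where P: "prime_cone P" "?A \<subseteq> P" using exists_prime_cone[OF A] by blast
    have "t \<in> ?A" if "t \<in> T" for t
      using that T by (intro CollectI exI[of _ t] exI[of _ 0]) auto
    moreover have "-f \<in> ?A" using T by (intro CollectI exI[of _ 0] exI[of _ 1]) auto
    ultimately have "insert (-f) S \<subseteq> P" using P(2) S(3) by blast
    then obtain x where x: "\<And>q. q \<in> insert (-f) S \<Longrightarrow> eval_mpoly q x \<ge> 0"
      using prime_cone_real_point[OF P(1), of "insert (-f) S"] S(1) by blast
    \<comment> \<open>Points of Euclidean \<open>n\<close>-space vanish from the coordinate \<open>n\<close> on.\<close>
    define y where "y i = (if i < n then x i else 0)" for i
    have eq: "eval_mpoly q y = eval_mpoly q x" if "q \<in> polys n" for q
      using that by (rule eval_mpoly_cong) (simp add: y_def)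
    have "y \<in> basic_closed_set n S"
      using x eq S(2) by (auto simp: basic_closed_set_def topspace_Euclidean_space y_def)
    then have "eval_mpoly f x > 0" using pos eq[OF f] by force
    moreover have "eval_mpoly (-f) x \<ge> 0" using x by simp
    ultimately show False by (simp add: ring_morphism_simps[OF ring_morphism_eval_mpoly])
  qed
  then obtain t u where "t \<in> T" "u \<in> T" "-1 = t + (-f) * u" by blast
  moreover from this(3) have "f * u = 1 + t" by (simp add: algebra_simps eq_neg_iff_add_eq_0)
  ultimately show ?thesis using that by blast
qed

lemma ring_preordering_of_nat: "ring_preordering T \<Longrightarrow> of_nat k \<in> T"
  by (induction k) (auto intro: ring_preordering_add)

lemma mpoly_const_cancel: "k > 0 \<Longrightarrow> mpoly_const (1 / of_nat k) * of_nat k = 1"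
  using ring_morphism_simps(1,3,8)[OF ring_morphism_mpoly_const]
  by (metis nonzero_divide_eq_eq of_nat_eq_0_iff less_numeral_extra(3))

text \<open>
  Division by \<open>k\<close> is multiplication by \<open>k * (1 / k) ^ 2\<close>, and \<open>k\<close> is a sum of squares.
\<close>

lemma ring_preordering_divide:
  assumes T: "ring_preordering T" and "k > 0" "of_nat k * a \<in> T"
  shows "(a :: rat_mpoly) \<in> T"
proof -
  let ?c = "mpoly_const (1 / of_nat k)"
  have "?c^2 * (of_nat k * (of_nat k * a)) = (?c * of_nat k) * (?c * of_nat k) * a"
    by (simp only: power2_eq_square ac_simps)
  also have "\<dots> = a" by (simp only: mpoly_const_cancel[OF \<open>k > 0\<close>] mult_1)
  finally show ?thesis
    using ring_preordering_mult[OF T ring_preordering_sq[OF T] ring_preordering_mult[OF T ring_preordering_of_nat[OF T] assms(3)]]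
    by metis
qed

definition bounded_elements :: "rat_mpoly set \<Rightarrow> rat_mpoly set" where
  "bounded_elements T = {a. \<exists>N. of_nat N - a \<in> T \<and> of_nat N + a \<in> T}"

text \<open>
  Closure under products rests on \<open>2 * (N * M - a * b) = (N - a) * (M + b) + (N + a) * (M - b)\<close>.
\<close>

lemma subring_of_bounded_elements:
  assumes T: "ring_preordering T"
  shows "subring_of (bounded_elements T)"
  unfolding subring_of_def
proof (intro conjI ballI)
  note add = ring_preordering_add[OF T] and mult = ring_preordering_mult[OF T]
  show "0 \<in> bounded_elements T" "1 \<in> bounded_elements T"
    using T ring_preordering_of_nat[OF T, of 2]
    by (auto simp: bounded_elements_def intro!: exI[of _ 0] exI[of _ 1])
  fix a b assume "a \<in> bounded_elements T" "b \<in> bounded_elements T"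
  then obtain N M where *: "of_nat N - a \<in> T" "of_nat N + a \<in> T" "of_nat M - b \<in> T" "of_nat M + b \<in> T"
    unfolding bounded_elements_def by blast
  have "of_nat (N + M) - (a + b) = (of_nat N - a) + (of_nat M - b)"
    "of_nat (N + M) + (a + b) = (of_nat N + a) + (of_nat M + b)"
    "of_nat (N + M) - (a - b) = (of_nat N - a) + (of_nat M + b)"
    "of_nat (N + M) + (a - b) = (of_nat N + a) + (of_nat M - b)"
    by simp_all
  then show "a + b \<in> bounded_elements T" "a - b \<in> bounded_elements T"
    unfolding bounded_elements_def using add * by (metis (mono_tags, lifting) mem_Collect_eq)+
  have "of_nat 2 * (of_nat (N * M) - a * b) = (of_nat N - a) * (of_nat M + b) + (of_nat N + a) * (of_nat M - b)"
    "of_nat 2 * (of_nat (N * M) + a * b) = (of_nat N - a) * (of_nat M - b) + (of_nat N + a) * (of_nat M + b)"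
    by (simp_all add: algebra_simps)
  then have "of_nat (N * M) - a * b \<in> T" "of_nat (N * M) + a * b \<in> T"
    using add mult * by (metis ring_preordering_divide[OF T] zero_less_numeral)+
  then show "a * b \<in> bounded_elements T" unfolding bounded_elements_def by blast
qed

text \<open>
  It is enough to bound the squares of the variables, because
  \<open>2 * (N + 1 - X) = (1 - X) ^ 2 + (N - X ^ 2) + (N + 1)\<close>, and similarly for \<open>-X\<close>.
\<close>

lemma bounded_elements_all:
  assumes T: "ring_preordering T" and sq: "\<And>i. \<exists>N. of_nat N - mpoly_var i ^ 2 \<in> T"
  shows "p \<in> bounded_elements T"
proof -
  note add = ring_preordering_add[OF T] and mult = ring_preordering_mult[OF T]
  have var: "mpoly_var i \<in> bounded_elements T" for i
  proof -
    obtain N where N: "of_nat N - mpoly_var i ^ 2 \<in> T" using sq by blast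
    have "of_nat 2 * (of_nat (Suc N) - mpoly_var i) = (1 - mpoly_var i)^2 + (of_nat N - mpoly_var i ^ 2) + of_nat (Suc N)"
      "of_nat 2 * (of_nat (Suc N) + mpoly_var i) = (1 + mpoly_var i)^2 + (of_nat N - mpoly_var i ^ 2) + of_nat (Suc N)"
      by (simp_all add: algebra_simps power2_eq_square)
    then have "of_nat (Suc N) - mpoly_var i \<in> T" "of_nat (Suc N) + mpoly_var i \<in> T"
      using add[OF add[OF ring_preordering_sq[OF T] N] ring_preordering_of_nat[OF T]]
      by (metis ring_preordering_divide[OF T] zero_less_numeral)+
    then show ?thesis unfolding bounded_elements_def by blast
  qed
  have const: "mpoly_const c \<in> bounded_elements T" for c
  proof -
    note cm = ring_morphism_simps[OF ring_morphism_mpoly_const]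
    have nonneg: "mpoly_const d \<in> T" if "d \<ge> 0" for d
    proof -
      obtain a b where ab: "d = Rat.Fract a b" "b > 0" by (cases d) auto
      then have "a \<ge> 0" using that by (simp add: Rat.zero_le_Fract_iff)
      have "of_nat (nat b) * d = of_nat (nat a)"
        using ab \<open>a \<ge> 0\<close> by (simp add: Fract_of_int_quotient)
      then have "of_nat (nat b) * mpoly_const d = of_nat (nat a)" by (metis cm(3,8))
      then show ?thesis
        using ring_preordering_divide[OF T, of "nat b"] ring_preordering_of_nat[OF T] ab by simp
    qed
    obtain N where N: "\<bar>c\<bar> \<le> of_nat N" using reals_Archimedean2[of "\<bar>c\<bar>"] less_imp_le by blast
    have "of_nat N - mpoly_const c = mpoly_const (of_nat N - c)" "of_nat N + mpoly_const c = mpoly_const (of_nat N + c)"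
      by (simp_all add: cm)
    then show ?thesis
      unfolding bounded_elements_def using nonneg[of "of_nat N - c"] nonneg[of "of_nat N + c"] N
      by (intro CollectI exI[of _ N]) (auto simp: abs_le_iff)
  qed
  obtain n where "{p} \<subseteq> polys n" using finite_subset_polys[of "{p}"] by blast
  moreover have "polys n \<subseteq> bounded_elements T"
    using subring_of_bounded_elements[OF T] const var by (rule polys_generated)
  ultimately show ?thesis by blast
qed

lemma compact_norm_bound:
  assumes "compactin (Euclidean_space n) K"
  obtains N :: nat where "\<And>x. x \<in> K \<Longrightarrow> (\<Sum>i<n. x i ^ 2) < of_nat N"
proof -
  have "continuous_map (Euclidean_space n) euclideanreal (\<lambda>x. \<Sum>i<n. x i ^ 2)"
    unfolding Euclidean_space_def
    by (intro continuous_map_sum continuous_map_real_pow continuous_map_from_subtopology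
        continuous_map_product_projection) auto
  then have "compactin euclideanreal ((\<lambda>x. \<Sum>i<n. x i ^ 2) ` K)"
    using image_compactin assms by blast
  then have "bounded ((\<lambda>x. \<Sum>i<n. x i ^ 2) ` K)" by (simp add: compact_imp_bounded)
  then obtain B where B: "\<And>x. x \<in> K \<Longrightarrow> \<bar>\<Sum>i<n. x i ^ 2\<bar> \<le> B"
    by (auto simp: bounded_iff)
  obtain N :: nat where N: "B < of_nat N" using reals_Archimedean2 by blast
  show ?thesis by (rule that[of N]) (use B N in force)
qed

text \<open>
  Let \<open>h = N - V\<close> with \<open>V = (\<Sum>i<n. X i ^ 2)\<close> be positive on the compact set and \<open>h * t = 1 + q\<close>, so that
  \<open>(1 + q) * h = t * h ^ 2 \<in> T\<close>. The preordering \<open>T + h T\<close> is archimedean since it contains \<open>h\<close>, hence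
  \<open>m - q\<close> for some \<open>m\<close>, and multiplication by \<open>1 + q\<close> maps \<open>T + h T\<close> into \<open>T\<close>. From this a bound \<open>M - q \<in> T\<close>
  is obtained, and it allows to clear the factor \<open>1 + q\<close> from \<open>(1 + q) * h\<close>.
\<close>

lemma archimedean_if_compact:
  assumes T: "ring_preordering T" and S: "finite S" "S \<subseteq> polys n" "S \<subseteq> T"
    and outside: "\<And>i. i \<ge> n \<Longrightarrow> - (mpoly_var i ^ 2) \<in> T"
    and compact: "compactin (Euclidean_space n) (basic_closed_set n S)"
  shows "p \<in> bounded_elements T"
proof -
  note add = ring_preordering_add and mult = ring_preordering_mult and sq = ring_preordering_sq
  define V where "V = (\<Sum>i<n. mpoly_var i ^ 2)"
  have V_bound: "\<exists>N. of_nat N - mpoly_var i ^ 2 \<in> T'"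
    if T': "ring_preordering T'" "T \<subseteq> T'" and N: "of_nat N - V \<in> T'" for T' N i
  proof (cases "i < n")
    case True
    have sums: "(\<Sum>j\<in>J. mpoly_var j ^ 2) \<in> T'" for J
      using T'(1) by (induction J rule: infinite_finite_induct) (auto intro: add sq)
    have "V = mpoly_var i ^ 2 + (\<Sum>j\<in>{..<n} - {i}. mpoly_var j ^ 2)"
      unfolding V_def using True by (intro sum.remove) auto
    then have "of_nat N - mpoly_var i ^ 2 = (of_nat N - V) + (\<Sum>j\<in>{..<n} - {i}. mpoly_var j ^ 2)" by simp
    then show ?thesis using add[OF T'(1) N sums] by metis
  next
    case False
    then have "of_nat 0 - mpoly_var i ^ 2 \<in> T'" using outside T'(2) by auto
    then show ?thesis by blast
  qed
  obtain N where N: "\<And>x. x \<in> basic_closed_set n S \<Longrightarrow> (\<Sum>i<n. x i ^ 2) < of_nat N"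
    using compact_norm_bound[OF compact] by blast
  define h where "h = of_nat N - V"
  note ev = ring_morphism_simps[OF ring_morphism_eval_mpoly]
  have eval_V: "eval_mpoly (\<Sum>i<k. mpoly_var i ^ 2) x = (\<Sum>i<k. x i ^ 2)" for k x
    by (induction k) (simp_all add: ev eval_mpoly_var)
  have "eval_mpoly h x > 0" if "x \<in> basic_closed_set n S" for x
    using N[OF that] by (simp add: h_def V_def ev eval_V)
  moreover have "h \<in> polys n"
    unfolding h_def V_def power2_eq_square
    by (intro subring_ofD[OF subring_of_polys] subring_of_of_nat[OF subring_of_polys]
        subring_of_sum[OF subring_of_polys] mpoly_var_in_polys) auto
  ultimately obtain t q where tq: "t \<in> T" "q \<in> T" "h * t = 1 + q"
    using positivstellensatz[OF T S] by blast
  have "(1 + q) * h = t * h^2" using tq(3) by (simp add: power2_eq_square ac_simps flip: tq(3))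
  then have qh: "(1 + q) * h \<in> T" using mult[OF T tq(1) sq[OF T]] by simp
  define T' where "T' = {\<sigma> + h * \<tau> | \<sigma> \<tau>. \<sigma> \<in> T \<and> \<tau> \<in> T}"
  have T': "ring_preordering T'" unfolding T'_def by (rule ring_preordering_adjoin[OF T])
  have "T \<subseteq> T'"
  proof
    fix t assume "t \<in> T"
    then show "t \<in> T'" unfolding T'_def using T by (intro CollectI exI[of _ t] exI[of _ 0]) auto
  qed
  have "h \<in> T'" unfolding T'_def using T by (intro CollectI exI[of _ 0] exI[of _ 1]) auto
  then have "q \<in> bounded_elements T'"
    using V_bound[OF T' \<open>T \<subseteq> T'\<close>] by (intro bounded_elements_all[OF T']) (auto simp: h_def)
  then obtain m where m: "of_nat m - q \<in> T'" unfolding bounded_elements_def by blast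
  \<comment> \<open>The bound \<open>m\<close> is doubled so that adding \<open>(q - m) ^ 2\<close> below cancels the terms \<open>2 * m * q\<close> and \<open>q ^ 2\<close>.\<close>
  have "of_nat m \<in> T'" by (rule ring_preordering_of_nat[OF T'])
  then have "(of_nat m - q) + of_nat m \<in> T'" using add[OF T' m] by blast
  then obtain \<sigma> \<tau> where st: "(of_nat m - q) + of_nat m = \<sigma> + h * \<tau>" "\<sigma> \<in> T" "\<tau> \<in> T"
    unfolding T'_def by blast
  have "(1 + q) * ((of_nat m - q) + of_nat m) = (1 + q) * \<sigma> + ((1 + q) * h) * \<tau>"
    unfolding st(1) by (simp add: algebra_simps)
  also have "\<dots> \<in> T"
    by (intro add[OF T] mult[OF T] qh st tq ring_preordering_1[OF T])
  finally have "(1 + q) * ((of_nat m - q) + of_nat m) + (q - of_nat m)^2 \<in> T"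
    by (rule add[OF T _ sq[OF T]])
  also have "(1 + q) * ((of_nat m - q) + of_nat m) + (q - of_nat m)^2 = of_nat (2 * m + m^2) - q"
    by (simp add: algebra_simps power2_eq_square)
  finally have q_bound: "of_nat (2 * m + m^2) - q \<in> T" .
  have VT: "V \<in> T"
  proof -
    have "(\<Sum>i<k. mpoly_var i ^ 2) \<in> T" for k
      using T by (induction k) (auto intro: add sq)
    then show ?thesis by (simp add: V_def)
  qed
  define M where "M = 2 * m + m^2"
  have "of_nat (N * (1 + M)) - V = (1 + q) * h + of_nat N * (of_nat M - q) + q * V"
    by (simp add: h_def algebra_simps)
  also have "\<dots> \<in> T"
    using q_bound by (intro add[OF T] mult[OF T] qh tq VT ring_preordering_of_nat[OF T]) (simp add: M_def)
  finally show ?thesis using V_bound[OF T subset_refl] by (intro bounded_elements_all[OF T]) blast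
qed

text \<open>
  With \<open>f * t = 1 + q\<close> and \<open>k - t \<in> T\<close>, the identity
  \<open>k * (k * f + j) = (k - t) * (k * f + j + 1) + k * q + (j + 1) * t\<close> lowers the constant \<open>j + 1\<close> in \<open>k * f + j + 1 \<in> T\<close> by one.
\<close>

lemma archimedean_representation:
  assumes T: "ring_preordering T" and S: "finite S" "S \<subseteq> polys n" "S \<subseteq> T"
    and arch: "\<And>p. p \<in> bounded_elements T"
    and f: "f \<in> polys n" "\<forall>x\<in>basic_closed_set n S. eval_mpoly f x > 0"
  shows "f \<in> T"
proof -
  note add = ring_preordering_add[OF T] and mult = ring_preordering_mult[OF T]
  obtain t q where tq: "t \<in> T" "q \<in> T" "f * t = 1 + q" using positivstellensatz[OF T S f] by blast
  obtain l where "of_nat l - t \<in> T" using arch[of t] unfolding bounded_elements_def by blast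
  then have "(of_nat l - t) + 1 \<in> T" using add ring_preordering_1[OF T] by blast
  moreover define k where "k = Suc l"
  ultimately have k: "of_nat k - t \<in> T" "k > 0" by (simp_all add: algebra_simps)
  have step: "of_nat k * f + of_nat j \<in> T" if "of_nat k * f + of_nat (Suc j) \<in> T" for j
  proof -
    have "of_nat k * (of_nat k * f + of_nat j) =
        of_nat k * (of_nat k * f + of_nat (Suc j)) - of_nat k * (1 + q) + of_nat k * q"
      by (simp add: algebra_simps)
    also have "\<dots> = (of_nat k - t) * (of_nat k * f + of_nat (Suc j)) + of_nat k * q + of_nat (Suc j) * t"
      unfolding tq(3)[symmetric] by (simp add: algebra_simps)
    also have "\<dots> \<in> T" by (intro add mult k that tq ring_preordering_of_nat[OF T])
    finally show ?thesis using ring_preordering_divide[OF T \<open>k > 0\<close>] by blast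
  qed
  have "f \<in> T" if "of_nat k * f + of_nat j \<in> T" for j
    using that
  proof (induction j)
    case 0
    then show ?case using ring_preordering_divide[OF T \<open>k > 0\<close>, of f] by simp
  next
    case (Suc j)
    then show ?case using step by blast
  qed
  moreover obtain r where "of_nat r + of_nat k * f \<in> T"
    using arch[of "of_nat k * f"] unfolding bounded_elements_def by blast
  ultimately show ?thesis by (simp add: add.commute)
qed

section \<open>Representations with square-free products of generators\<close>

lemma sums_of_squares_add:
  assumes "a \<in> sums_of_squares n" "b \<in> sums_of_squares n"
  shows "a + b \<in> sums_of_squares n"
proof -
  obtain ps qs where "a = (\<Sum>p\<leftarrow>ps. p ^ 2)" "set ps \<subseteq> polys n" "b = (\<Sum>p\<leftarrow>qs. p ^ 2)" "set qs \<subseteq> polys n"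
    using assms unfolding sums_of_squares_def by blast
  then have "a + b = (\<Sum>p\<leftarrow>ps @ qs. p ^ 2)" "set (ps @ qs) \<subseteq> polys n" by auto
  then show ?thesis unfolding sums_of_squares_def by blast
qed

lemma sums_of_squares_square:
  assumes "p \<in> polys n"
  shows "p^2 \<in> sums_of_squares n"
proof -
  have "p^2 = (\<Sum>p\<leftarrow>[p]. p ^ 2)" "set [p] \<subseteq> polys n" using assms by auto
  then show ?thesis unfolding sums_of_squares_def by blast
qed

lemma sums_of_squares_induct [consumes 1, case_names zero add]:
  assumes "a \<in> sums_of_squares n" and "Q 0"
    and "\<And>p a. p \<in> polys n \<Longrightarrow> Q a \<Longrightarrow> Q (p^2 + a)"
  shows "Q a"
proof -
  have "Q (\<Sum>p\<leftarrow>ps. p ^ 2)" if "set ps \<subseteq> polys n" for ps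
    using that assms(2,3) by (induction ps) auto
  then show ?thesis using assms(1) unfolding sums_of_squares_def by blast
qed

lemma sums_of_squares_0: "0 \<in> sums_of_squares n"
  using sums_of_squares_square[OF subring_ofD(1)[OF subring_of_polys]] by simp

lemma sums_of_squares_mult:
  assumes "a \<in> sums_of_squares n" "b \<in> sums_of_squares n"
  shows "a * b \<in> sums_of_squares n"
  using assms(1)
proof (induction rule: sums_of_squares_induct)
  case zero
  then show ?case by (simp add: sums_of_squares_0)
next
  case (add p a)
  have "p^2 * b \<in> sums_of_squares n" using assms(2)
  proof (induction rule: sums_of_squares_induct)
    case zero
    then show ?case by (simp add: sums_of_squares_0)
  next
    case (add r b)
    have "p^2 * (r^2 + b) = (p * r)^2 + p^2 * b" by (simp add: distrib_left power_mult_distrib)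
    moreover have "(p * r)^2 \<in> sums_of_squares n"
      using \<open>p \<in> polys n\<close> add(1) by (intro sums_of_squares_square subring_ofD(5)[OF subring_of_polys])
    ultimately show ?case using sums_of_squares_add add(2) by simp
  qed
  then show ?case using add sums_of_squares_add by (simp add: distrib_right)
qed

text \<open>
  The sums in the theorem, built up by splitting off the last generator: \<open>a\<close> collects the products
  without \<open>g (Suc s)\<close> and \<open>b\<close> those with it. In this form closure under multiplication is an easy induction,
  as \<open>g (Suc s) ^ 2\<close> is a sum of squares and can be absorbed into the coefficients.
\<close>

primrec square_free_combinations :: "nat \<Rightarrow> (nat \<Rightarrow> rat_mpoly) \<Rightarrow> nat \<Rightarrow> rat_mpoly set" where
  "square_free_combinations n g 0 = sums_of_squares n"
| "square_free_combinations n g (Suc s) =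
     {a + g (Suc s) * b | a b. a \<in> square_free_combinations n g s \<and> b \<in> square_free_combinations n g s}"

lemma square_free_combinations_mono:
  "square_free_combinations n g s \<subseteq> square_free_combinations n g (s + k)"
proof (induction k)
  case (Suc k)
  have "0 \<in> square_free_combinations n g s" for s
  proof (induction s)
    case (Suc s)
    have "0 = 0 + g (Suc s) * 0" by simp
    then show ?case using Suc unfolding square_free_combinations.simps by blast
  qed (simp add: sums_of_squares_0)
  moreover have "a = a + g (Suc (s + k)) * 0" for a by simp
  ultimately have "square_free_combinations n g (s + k) \<subseteq> square_free_combinations n g (Suc (s + k))"
    unfolding square_free_combinations.simps by blast
  then show ?case using Suc by simp
qed simp

lemma square_free_combinations_closed:
  assumes "\<forall>i\<in>{1..s}. g i \<in> polys n" "a \<in> square_free_combinations n g s" "b \<in> square_free_combinations n g s"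
  shows "a + b \<in> square_free_combinations n g s \<and> a * b \<in> square_free_combinations n g s"
  using assms
proof (induction s arbitrary: a b)
  case 0
  then show ?case by (simp add: sums_of_squares_add sums_of_squares_mult)
next
  case (Suc s)
  let ?R = "square_free_combinations n g s" and ?h = "g (Suc s)"
  have IH: "a + b \<in> ?R" "a * b \<in> ?R" if "a \<in> ?R" "b \<in> ?R" for a b
    using Suc.IH[of a b] Suc.prems(1) that by auto
  obtain a1 a2 b1 b2 where ab: "a = a1 + ?h * a2" "b = b1 + ?h * b2" "a1 \<in> ?R" "a2 \<in> ?R" "b1 \<in> ?R" "b2 \<in> ?R"
    using Suc.prems(2,3) by auto
  have "?h^2 \<in> sums_of_squares n" using Suc.prems(1) by (intro sums_of_squares_square) auto
  then have h2: "?h^2 \<in> ?R" using square_free_combinations_mono[of n g 0 s] by (simp add: subset_iff)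
  have "a1 * b1 + ?h^2 * (a2 * b2) \<in> ?R" by (intro IH ab h2)
  moreover have "a1 * b2 + a2 * b1 \<in> ?R" by (intro IH ab)
  moreover have "a1 + b1 \<in> ?R" "a2 + b2 \<in> ?R" using IH(1) ab by blast+
  ultimately have "(a1 + b1) + ?h * (a2 + b2) \<in> square_free_combinations n g (Suc s)"
    "(a1 * b1 + ?h^2 * (a2 * b2)) + ?h * (a1 * b2 + a2 * b1) \<in> square_free_combinations n g (Suc s)"
    unfolding square_free_combinations.simps by blast+
  moreover have "a + b = (a1 + b1) + ?h * (a2 + b2)"
    "a * b = (a1 * b1 + ?h^2 * (a2 * b2)) + ?h * (a1 * b2 + a2 * b1)"
    unfolding ab by (simp_all add: algebra_simps power2_eq_square)
  ultimately show ?case by simp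
qed

lemma square_free_combinations_square:
  "p \<in> polys n \<Longrightarrow> p^2 \<in> square_free_combinations n g s"
  using square_free_combinations_mono[of n g 0 s] sums_of_squares_square by auto

lemma square_free_combinations_generator:
  assumes "i \<in> {1..s}"
  shows "g i \<in> square_free_combinations n g s"
proof -
  obtain j where j: "i = Suc j" using assms by (cases i) auto
  have "1 \<in> polys n" by (rule subring_ofD(2)[OF subring_of_polys])
  then have "0^2 \<in> square_free_combinations n g j" "1^2 \<in> square_free_combinations n g j"
    using square_free_combinations_square subring_ofD(1)[OF subring_of_polys] by blast+
  moreover have "g i = 0^2 + g (Suc j) * 1^2" using j by simp
  ultimately have "g i \<in> square_free_combinations n g i" unfolding j square_free_combinations.simps by blast
  then show ?thesis using square_free_combinations_mono[of n g i "s - i"] assms by auto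
qed

lemma square_free_combinations_expand:
  assumes "f \<in> square_free_combinations n g s"
  shows "\<exists>\<sigma> :: (nat \<Rightarrow> nat) \<Rightarrow> rat_mpoly.
           (\<forall>e \<in> {1..s} \<rightarrow>\<^sub>E {0, 1}. \<sigma> e \<in> sums_of_squares n) \<and>
           f = (\<Sum>e \<in> {1..s} \<rightarrow>\<^sub>E {0, 1}. \<sigma> e * (\<Prod>i = 1..s. g i ^ e i))"
  using assms
proof (induction s arbitrary: f)
  case 0
  then show ?case by (intro exI[of _ "\<lambda>_. f"]) simp
next
  case (Suc s)
  let ?E = "{1..s} \<rightarrow>\<^sub>E {0, 1::nat}"
  obtain a b where ab: "f = a + g (Suc s) * b" "a \<in> square_free_combinations n g s" "b \<in> square_free_combinations n g s"
    using Suc.prems by auto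
  obtain \<alpha> \<beta> :: "(nat \<Rightarrow> nat) \<Rightarrow> rat_mpoly" where
    \<alpha>: "\<forall>e\<in>?E. \<alpha> e \<in> sums_of_squares n" "a = (\<Sum>e\<in>?E. \<alpha> e * (\<Prod>i = 1..s. g i ^ e i))" and
    \<beta>: "\<forall>e\<in>?E. \<beta> e \<in> sums_of_squares n" "b = (\<Sum>e\<in>?E. \<beta> e * (\<Prod>i = 1..s. g i ^ e i))"
    using Suc.IH[OF ab(2)] Suc.IH[OF ab(3)] by blast
  define \<sigma> where "\<sigma> e = (if e (Suc s) = 0 then \<alpha> (restrict e {1..s}) else \<beta> (restrict e {1..s}))" for e :: "nat \<Rightarrow> nat"
  let ?F = "\<lambda>e. \<sigma> e * (\<Prod>i = 1..Suc s. g i ^ e i)"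
  have ins: "{1..Suc s} = insert (Suc s) {1..s}" by auto
  have E: "({1..Suc s} \<rightarrow>\<^sub>E {0, 1::nat}) = (\<lambda>(y, e). e(Suc s := y)) ` ({0, 1} \<times> ?E)"
    unfolding ins by (rule PiE_insert_eq)
  have restr: "restrict (e(Suc s := y)) {1..s} = e" if "e \<in> ?E" for e y
    using that by (auto simp: restrict_def PiE_def extensional_def fun_eq_iff)
  have summand: "?F (e(Suc s := y)) = (if y = 0 then \<alpha> e else g (Suc s) ^ y * \<beta> e) * (\<Prod>i = 1..s. g i ^ e i)" if "e \<in> ?E" for e y
  proof -
    have "(\<Prod>i = 1..Suc s. g i ^ (e(Suc s := y)) i) = g (Suc s) ^ y * (\<Prod>i = 1..s. g i ^ (e(Suc s := y)) i)"
      by (simp add: mult.commute)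
    also have "(\<Prod>i = 1..s. g i ^ (e(Suc s := y)) i) = (\<Prod>i = 1..s. g i ^ e i)"
      by (rule prod.cong) auto
    finally show ?thesis using restr[OF that] by (simp add: \<sigma>_def ac_simps)
  qed
  have inj: "inj_on (\<lambda>(y, e). e(Suc s := y)) ({0, 1} \<times> ?E)"
    by (rule inj_combinator) simp
  have "sum ?F ({1..Suc s} \<rightarrow>\<^sub>E {0, 1}) = (\<Sum>(y, e)\<in>{0, 1} \<times> ?E. ?F (e(Suc s := y)))"
    unfolding E by (subst sum.reindex[OF inj]) (simp add: case_prod_unfold)
  also have "\<dots> = (\<Sum>y\<in>{0, 1}. \<Sum>e\<in>?E. ?F (e(Suc s := y)))"
    by (rule sum.cartesian_product[symmetric])
  also have "\<dots> = (\<Sum>e\<in>?E. ?F (e(Suc s := 0))) + (\<Sum>e\<in>?E. ?F (e(Suc s := 1)))" by simp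
  also have "(\<Sum>e\<in>?E. ?F (e(Suc s := 0))) = a"
    unfolding \<alpha>(2) using summand[of _ 0] by (intro sum.cong) auto
  also have "(\<Sum>e\<in>?E. ?F (e(Suc s := 1))) = g (Suc s) * b"
    unfolding \<beta>(2) sum_distrib_left using summand[of _ 1] by (intro sum.cong) (auto simp: ac_simps)
  finally have "f = sum ?F ({1..Suc s} \<rightarrow>\<^sub>E {0, 1})" using ab(1) by simp
  moreover have "\<forall>e\<in>{1..Suc s} \<rightarrow>\<^sub>E {0, 1}. \<sigma> e \<in> sums_of_squares n"
    unfolding E using \<alpha>(1) \<beta>(1) restr by (auto simp: \<sigma>_def)
  ultimately show ?case by blast
qed

definition truncate_vars :: "nat \<Rightarrow> rat_mpoly \<Rightarrow> rat_mpoly" where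
  "truncate_vars n = evaluate mpoly_const (\<lambda>i. if i < n then mpoly_var i else 0)"

lemma ring_morphism_truncate: "ring_morphism (truncate_vars n)"
  unfolding truncate_vars_def by (rule ring_morphism_evaluate[OF ring_morphism_mpoly_const])

lemma truncate_simps:
  "truncate_vars n (mpoly_const c) = mpoly_const c"
  "truncate_vars n (mpoly_var i) = (if i < n then mpoly_var i else 0)"
  unfolding truncate_vars_def
  by (rule evaluate_const[OF ring_morphism_mpoly_const], rule evaluate_var[OF ring_morphism_mpoly_const])

lemma truncate_in_polys: "truncate_vars n p \<in> polys n"
proof -
  note S = subring_ofD[OF subring_of_polys[of n]]
  have "subring_of {p. truncate_vars n p \<in> polys n}"
    unfolding subring_of_def using S by (auto simp: ring_morphism_simps[OF ring_morphism_truncate])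
  then have "polys m \<subseteq> {p. truncate_vars n p \<in> polys n}" for m
    by (rule polys_generated) (auto simp: truncate_simps mpoly_const_in_polys mpoly_var_in_polys S(1))
  then show ?thesis using finite_subset_polys[of "{p}"] by blast
qed

lemma truncate_id:
  assumes "p \<in> polys n"
  shows "truncate_vars n p = p"
  using morphisms_agree_on_polys[OF ring_morphism_truncate, of "\<lambda>p. p" n n p] assms
  by (simp add: ring_morphism_def truncate_simps)

text \<open>
  The preordering generated by the \<open>g i\<close> and by \<open>- (X i ^ 2)\<close> for \<open>i \<ge> n\<close> is archimedean, so it contains \<open>f\<close>.
  Truncation fixes \<open>f\<close> and the \<open>g i\<close> and maps the additional generators to \<open>0\<close>.
\<close>

theorem theorem4:
  fixes n s :: nat and g :: "nat \<Rightarrow> rat_mpoly" and f :: rat_mpoly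
  assumes "\<forall>i \<in> {1..s}. g i \<in> polys n"
    and "compactin (Euclidean_space n) (basic_closed_set n (g ` {1..s}))"
    and "f \<in> polys n"
    and "\<forall>x \<in> basic_closed_set n (g ` {1..s}). eval_mpoly f x > 0"
  shows "\<exists>\<sigma> :: (nat \<Rightarrow> nat) \<Rightarrow> rat_mpoly.
           (\<forall>e \<in> {1..s} \<rightarrow>\<^sub>E {0, 1}. \<sigma> e \<in> sums_of_squares n) \<and>
           f = (\<Sum>e \<in> {1..s} \<rightarrow>\<^sub>E {0, 1}. \<sigma> e * (\<Prod>i = 1..s. g i ^ e i))"
proof -
  define T where "T = generated_preordering (g ` {1..s} \<union> {- (mpoly_var i ^ 2) | i. i \<ge> n})"
  have T: "ring_preordering T" unfolding T_def by (rule ring_preordering_generated)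
  have S: "finite (g ` {1..s})" "g ` {1..s} \<subseteq> polys n" "g ` {1..s} \<subseteq> T"
    using assms(1) by (auto simp: T_def intro: generated_preordering.generator)
  have outside: "- (mpoly_var i ^ 2) \<in> T" if "i \<ge> n" for i
    using that by (auto simp: T_def intro: generated_preordering.generator)
  have "f \<in> T"
    using archimedean_representation[OF T S archimedean_if_compact[OF T S outside assms(2)] assms(3,4)] .
  note \<pi> = ring_morphism_simps[OF ring_morphism_truncate[of n]]
  have "truncate_vars n p \<in> square_free_combinations n g s" if "p \<in> T" for p
    using that unfolding T_def
  proof induction
    case (square a)
    show ?case unfolding \<pi> by (rule square_free_combinations_square[OF truncate_in_polys])
  next
    case (generator p)
    then consider i where "i \<in> {1..s}" "p = g i" | i where "i \<ge> n" "p = - (mpoly_var i ^ 2)" by blast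
    then show ?case
    proof cases
      case 1
      then show ?thesis using square_free_combinations_generator assms(1) by (simp add: truncate_id)
    next
      case 2
      then have "truncate_vars n p = 0^2" by (simp add: \<pi> truncate_simps)
      then show ?thesis using square_free_combinations_square[OF subring_ofD(1)[OF subring_of_polys]] by simp
    qed
  next
    case (add a b)
    then show ?case unfolding \<pi> using square_free_combinations_closed[OF assms(1)] by blast
  next
    case (mult a b)
    then show ?case unfolding \<pi> using square_free_combinations_closed[OF assms(1)] by blast
  qed
  from this[OF \<open>f \<in> T\<close>] have "f \<in> square_free_combinations n g s" using truncate_id[OF assms(3)] by simp
  then show ?thesis by (rule square_free_combinations_expand)
qed

end
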